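(* Let $(F_j)_{j\in\mathbb Z}$ be an admissible family and let $u_0$ and $(\xi_0^\varepsilon)_{\varepsilon>0}$ be functions $\mathbb R\to\mathbb R$ for which there exist $K_0>0$ and $M_0>0$ such that for all $\varepsilon>0$ $$0<1/K_0\le (u_0)_x\le K_0,\qquad 0<1/K_0\le(\xi_0^\varepsilon)_x\le K_0\ \text{ on }\mathbb R,\qquad \|u_0-\xi_0^\varepsilon\|_\infty\le M_0\varepsilon .$$ For $\varepsilon>0$ consider the (viscosity) solution $((u_j^\varepsilon)_{j\in\mathbb Z},(\xi_j^\varepsilon)_{j\in\mathbb Z})$ of the problem: for all $j\in\mathbb Z$, $t>0$, $x\in\mathbb R$, $$\begin{cases}(u_j^\varepsilon)_t=\alpha_0\dfrac{\xi_j^\varepsilon-u_j^\varepsilon}{\varepsilon},\\[2mm](\xi_j^\varepsilon)_t=2F_j\Big(\dfrac t\varepsilon,\Big[\dfrac{u^\varepsilon(t,\cdot)}{\varepsilon}\Big]_{j,m}(x)\Big)+\alpha_0\dfrac{u_j^\varepsilon-\xi_j^\varepsilon}{\varepsilon},\\[2mm] u_{j+n}^\varepsilon(t,x)=u_j^\varepsilon(t,x+\varepsilon),\quad \xi_{j+n}^\varepsilon(t,x)=\xi_j^\varepsilon(t,x+\varepsilon),\end{cases}$$ with initial conditions $u_j^\varepsilon(0,x)=u_0\big(x+\frac{j\varepsilon}n\big)$, $\xi_j^\varepsilon(0,x)=\xi_0^\varepsilon\big(x+\frac{j\varepsilon}n\big)$. Then there exists a continuous function $\overline F:\mathbb R\to\mathbb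 R$ such that for every integer $j\in\mathbb Z$, as $\varepsilon\to0$, the functions $u_j^\varepsilon$ and $\xi_j^\varepsilon$ converge uniformly on compact subsets of $(0,+\infty)\times\mathbb R$ to the unique viscosity solution $u^0$ of $$u^0_t=\overline F(u^0_x)\ \text{ for }(t,x)\in(0,+\infty)\times\mathbb R,\qquad u^0(0,x)=u_0(x)\ \text{ for }x\in\mathbb R.$$
   Context: Fix integers $n\ge1$, $m\in\mathbb N$ and a real $\alpha_0>0$. For a family $v=(v_j)_{j\in\mathbb Z}$ of functions, $[v]_{j,m}(y)=(v_{j-m}(y),\dots,v_{j+m}(y))$. A family of functions $F_j:\mathbb R\times\mathbb R^{2m+1}\to\mathbb R$, $(\tau,V)\mapsto F_j(\tau,V)$, $V=(V_{-m},\dots,V_m)$, $j\in\mathbb Z$, is called admissible if: (A1) $F_j$ is continuous, and Lipschitz continuous in $V$ uniformly in $\tau$ and $j$; (A2) $F_j(\tau,V)$ is non-decreasing in $V_i$ for each $i\ne0$; (A3) $\alpha_0+2\,\partial F_j/\partial V_0\ge0$ for all $j$, i.e. $V_0\mapsto 2F_j(\tau,V)+\alpha_0V_0$ is non-decreasing; (A4) $F_j(\tau,V_{-m}+1,\dots,V_m+1)=F_j(\tau,V_{-m},\dots,V_m)$ and $F_j(\tau+1,V)=F_j(\tau,V)$; (A5) $F_{j+n}=F_j$ for all $j\in\mathbb Z$; (A6) for all $(V_{-m},\dots,V_m,V_{m+1})\in\mathbb R^{2m+2}$ with $V_{i+1}\ge V_i$ for all $|i|\le m$, $2F_{j+1}(\tau,V_{-m+1},\dots,V_{m+1})+\alpha_0V_1\ge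 2F_j(\tau,V_{-m},\dots,V_m)+\alpha_0V_0$. Viscosity solutions of the system. A family $((u_j)_j,(\xi_j)_j)$ of locally bounded functions on $[0,+\infty)\times\mathbb R$ satisfying $u_{j+n}(t,x)=u_j(t,x+\varepsilon)$, $\xi_{j+n}(t,x)=\xi_j(t,x+\varepsilon)$ is a sub-solution (resp. super-solution) if all $u_j,\xi_j$ are upper (resp. lower) semi-continuous, if at $t=0$ they are $\le$ (resp. $\ge$) the prescribed initial data, and if for every $C^1$ test function $\phi$ and $(t,x)\in(0,+\infty)\times\mathbb R$: whenever $u_j-\phi$ has a local maximum (resp. minimum) at $(t,x)$, $\phi_t\le$ (resp. $\ge$) $\alpha_0(\xi_j-u_j)/\varepsilon$ at $(t,x)$; and whenever $\xi_j-\phi$ has a local maximum (resp. minimum) at $(t,x)$, $\phi_t\le$ (resp. $\ge$) $2F_j(t/\varepsilon,[u(t,\cdot)/\varepsilon]_{j,m}(x))+\alpha_0(u_j-\xi_j)/\varepsilon$ at $(t,x)$. It is a viscosity solution if the family of upper semi-continuous envelopes is a sub-solution and the family of lower semi-continuous envelopes is a super-solution. "The solution" is the one staying, for every $T>0$ and every $j$, at bounded distance from its initial data on $[0,T]\times\mathbb R$. *)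

theory Defs
  imports "HOL-Analysis.Analysis"
begin

section \<open>Admissible families\<close>

text \<open>
  A vector \<open>V = (V\<^sub>-\<^sub>m, \<dots>, V\<^sub>m)\<close> of \<open>\<real>\<^sup>2\<^sup>m\<^sup>+\<^sup>1\<close> is an extensional function on \<open>{-m..m}\<close>, that is, an
  element of \<open>Rvec m\<close>; the topology is the product topology of \<open>int \<Rightarrow> real\<close>, in which \<open>Rvec m\<close> is
  homeomorphic to \<open>\<real>\<^sup>2\<^sup>m\<^sup>+\<^sup>1\<close> because all other coordinates are constant.
\<close>

definition window :: "nat \<Rightarrow> int set" where
  "window m = {- int m..int m}"

definition Rvec :: "nat \<Rightarrow> (int \<Rightarrow> real) set" where
  "Rvec m = window m \<rightarrow>\<^sub>E UNIV"

definition stencil :: "nat \<Rightarrow> (int \<Rightarrow> real \<Rightarrow> real) \<Rightarrow> int \<Rightarrow> real \<Rightarrow> int \<Rightarrow> real" where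
  "stencil m v j y = (\<lambda>i\<in>window m. v (j + i) y)"

definition admissible ::
    "nat \<Rightarrow> nat \<Rightarrow> real \<Rightarrow> (int \<Rightarrow> real \<Rightarrow> (int \<Rightarrow> real) \<Rightarrow> real) \<Rightarrow> bool" where
  "admissible n m \<alpha>\<^sub>0 F \<longleftrightarrow>
     (\<forall>j. continuous_on (UNIV \<times> Rvec m) (\<lambda>(\<tau>, V). F j \<tau> V)) \<and>
     (\<exists>L. \<forall>j \<tau>. \<forall>V\<in>Rvec m. \<forall>W\<in>Rvec m.
        \<bar>F j \<tau> V - F j \<tau> W\<bar> \<le> L * L2_set (\<lambda>i. V i - W i) (window m)) \<and>
     (\<forall>j \<tau>. \<forall>V\<in>Rvec m. \<forall>i\<in>window m - {0}. mono (\<lambda>s. F j \<tau> (V(i := s)))) \<and>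
     (\<forall>j \<tau>. \<forall>V\<in>Rvec m. mono (\<lambda>s. 2 * F j \<tau> (V(0 := s)) + \<alpha>\<^sub>0 * s)) \<and>
     (\<forall>j \<tau>. \<forall>V\<in>Rvec m. F j \<tau> (\<lambda>i\<in>window m. V i + 1) = F j \<tau> V \<and> F j (\<tau> + 1) V = F j \<tau> V) \<and>
     (\<forall>j \<tau>. \<forall>V\<in>Rvec m. F (j + int n) \<tau> V = F j \<tau> V) \<and>
     \<comment> \<open>in the last condition, only the coordinates \<open>-m, \<dots>, m+1\<close> of \<open>V\<close> are used\<close>
     (\<forall>j \<tau>. \<forall>V::int \<Rightarrow> real. (\<forall>i\<in>window m. V i \<le> V (i + 1)) \<longrightarrow>
        2 * F j \<tau> (\<lambda>i\<in>window m. V i) + \<alpha>\<^sub>0 * V 0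
          \<le> 2 * F (j + 1) \<tau> (\<lambda>i\<in>window m. V (i + 1)) + \<alpha>\<^sub>0 * V 1)"

text \<open>
  The bounds \<open>1/K \<le> f\<^sub>x \<le> K\<close> are those of the weak derivative, i.e. the almost everywhere
  derivative of a Lipschitz function.  A function which is differentiable everywhere with
  derivative in \<open>[1/K, K]\<close> is a special case.  Without the Lipschitz condition, the almost
  everywhere bounds would say nothing about a singular part of \<open>f\<close>.
\<close>

definition gradient_bounds :: "real \<Rightarrow> (real \<Rightarrow> real) \<Rightarrow> bool" where
  "gradient_bounds K f \<longleftrightarrow>
     (\<exists>L. L-lipschitz_on UNIV f) \<and>
     (AE x in lborel. \<exists>D. (f has_real_derivative D) (at x) \<and> 1 / K \<le> D \<and> D \<le> K)"

section \<open>Semicontinuity and test functions\<close>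

text \<open>
  Functions of \<open>(t, x) \<in> [0,+\<infinity>) \<times> \<real>\<close> are represented by functions on \<open>real \<times> real\<close>, whose values for
  \<open>t < 0\<close> are irrelevant.
\<close>

abbreviation time_space :: "(real \<times> real) set" where
  "time_space \<equiv> {0..} \<times> UNIV"

abbreviation pos_time_space :: "(real \<times> real) set" where
  "pos_time_space \<equiv> {0<..} \<times> UNIV"

definition locally_bdd :: "(real \<times> real \<Rightarrow> real) \<Rightarrow> bool" where
  "locally_bdd f \<longleftrightarrow> (\<forall>p\<in>time_space. \<exists>r>0. bounded (f ` (ball p r \<inter> time_space)))"

definition upper_semicont :: "(real \<times> real \<Rightarrow> real) \<Rightarrow> bool" where
  "upper_semicont f \<longleftrightarrow>
     (\<forall>p\<in>time_space. \<forall>a. f p < a \<longrightarrow> (\<forall>\<^sub>F q in at p within time_space. f q < a))"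

definition lower_semicont :: "(real \<times> real \<Rightarrow> real) \<Rightarrow> bool" where
  "lower_semicont f \<longleftrightarrow>
     (\<forall>p\<in>time_space. \<forall>a. a < f p \<longrightarrow> (\<forall>\<^sub>F q in at p within time_space. a < f q))"

text \<open>
  The envelopes are taken along all \<open>q \<rightarrow> p\<close> in \<open>[0,+\<infinity>) \<times> \<real>\<close>, including \<open>q = p\<close>; hence the filter is
  not \<open>at p within time_space\<close>, which leaves out \<open>p\<close> itself.  The limits are finite for
  \<open>p \<in> time_space\<close> when the function is locally bounded.
\<close>

definition usc_envelope :: "(real \<times> real \<Rightarrow> real) \<Rightarrow> real \<times> real \<Rightarrow> real" where
  "usc_envelope f p =
     real_of_ereal (Limsup (inf (nhds p) (principal time_space)) (\<lambda>q. ereal (f q)))"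

definition lsc_envelope :: "(real \<times> real \<Rightarrow> real) \<Rightarrow> real \<times> real \<Rightarrow> real" where
  "lsc_envelope f p =
     real_of_ereal (Liminf (inf (nhds p) (principal time_space)) (\<lambda>q. ereal (f q)))"

text \<open>\<open>\<phi>\<close> is \<open>C\<^sup>1\<close> on \<open>(0,+\<infinity>) \<times> \<real>\<close> with partial derivatives \<open>\<phi>\<^sub>t\<close> and \<open>\<phi>\<^sub>x\<close>.\<close>

definition C1_test ::
    "(real \<times> real \<Rightarrow> real) \<Rightarrow> (real \<times> real \<Rightarrow> real) \<Rightarrow> (real \<times> real \<Rightarrow> real) \<Rightarrow> bool" where
  "C1_test \<phi> \<phi>\<^sub>t \<phi>\<^sub>x \<longleftrightarrow>
     continuous_on pos_time_space \<phi>\<^sub>t \<and> continuous_on pos_time_space \<phi>\<^sub>x \<and>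
     (\<forall>p\<in>pos_time_space. (\<phi> has_derivative (\<lambda>(s, y). \<phi>\<^sub>t p * s + \<phi>\<^sub>x p * y)) (at p))"

definition local_max_at :: "(real \<times> real \<Rightarrow> real) \<Rightarrow> real \<times> real \<Rightarrow> bool" where
  "local_max_at g p \<longleftrightarrow> (\<forall>\<^sub>F q in nhds p. g q \<le> g p)"

definition local_min_at :: "(real \<times> real \<Rightarrow> real) \<Rightarrow> real \<times> real \<Rightarrow> bool" where
  "local_min_at g p \<longleftrightarrow> (\<forall>\<^sub>F q in nhds p. g p \<le> g q)"

section \<open>Viscosity solutions of the system\<close>

definition shift_periodic :: "nat \<Rightarrow> real \<Rightarrow> (int \<Rightarrow> real \<times> real \<Rightarrow> real) \<Rightarrow> bool" where
  "shift_periodic n \<epsilon> u \<longleftrightarrow> (\<forall>j. \<forall>t\<ge>0. \<forall>x. u (j + int n) (t, x) = u j (t, x + \<epsilon>))"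

definition u_rhs ::
    "real \<Rightarrow> real \<Rightarrow> (int \<Rightarrow> real \<times> real \<Rightarrow> real) \<Rightarrow> (int \<Rightarrow> real \<times> real \<Rightarrow> real)
     \<Rightarrow> int \<Rightarrow> real \<times> real \<Rightarrow> real" where
  "u_rhs \<alpha>\<^sub>0 \<epsilon> u \<xi> j p = \<alpha>\<^sub>0 * (\<xi> j p - u j p) / \<epsilon>"

definition \<xi>_rhs ::
    "nat \<Rightarrow> real \<Rightarrow> (int \<Rightarrow> real \<Rightarrow> (int \<Rightarrow> real) \<Rightarrow> real) \<Rightarrow> real
     \<Rightarrow> (int \<Rightarrow> real \<times> real \<Rightarrow> real) \<Rightarrow> (int \<Rightarrow> real \<times> real \<Rightarrow> real) \<Rightarrow> int \<Rightarrow> real \<times> real \<Rightarrow> real" where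
  "\<xi>_rhs m \<alpha>\<^sub>0 F \<epsilon> u \<xi> j = (\<lambda>(t, x).
     2 * F j (t / \<epsilon>) (stencil m (\<lambda>k y. u k (t, y) / \<epsilon>) j x)
       + \<alpha>\<^sub>0 * (u j (t, x) - \<xi> j (t, x)) / \<epsilon>)"

text \<open>In the following, \<open>u_ini\<close> and \<open>\<xi>_ini\<close> are the prescribed values at time \<open>0\<close>.\<close>

definition system_subsolution ::
    "nat \<Rightarrow> nat \<Rightarrow> real \<Rightarrow> (int \<Rightarrow> real \<Rightarrow> (int \<Rightarrow> real) \<Rightarrow> real) \<Rightarrow> real
     \<Rightarrow> (int \<Rightarrow> real \<Rightarrow> real) \<Rightarrow> (int \<Rightarrow> real \<Rightarrow> real)
     \<Rightarrow> (int \<Rightarrow> real \<times> real \<Rightarrow> real) \<Rightarrow> (int \<Rightarrow> real \<times> real \<Rightarrow> real) \<Rightarrow> bool" where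
  "system_subsolution n m \<alpha>\<^sub>0 F \<epsilon> u_ini \<xi>_ini u \<xi> \<longleftrightarrow>
     (\<forall>j. locally_bdd (u j) \<and> locally_bdd (\<xi> j)) \<and>
     shift_periodic n \<epsilon> u \<and> shift_periodic n \<epsilon> \<xi> \<and>
     (\<forall>j. upper_semicont (u j) \<and> upper_semicont (\<xi> j)) \<and>
     (\<forall>j x. u j (0, x) \<le> u_ini j x \<and> \<xi> j (0, x) \<le> \<xi>_ini j x) \<and>
     (\<forall>\<phi> \<phi>\<^sub>t \<phi>\<^sub>x. C1_test \<phi> \<phi>\<^sub>t \<phi>\<^sub>x \<longrightarrow>
        (\<forall>j. \<forall>p\<in>pos_time_space.
           (local_max_at (\<lambda>q. u j q - \<phi> q) p \<longrightarrow> \<phi>\<^sub>t p \<le> u_rhs \<alpha>\<^sub>0 \<epsilon> u \<xi> j p) \<and>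
           (local_max_at (\<lambda>q. \<xi> j q - \<phi> q) p \<longrightarrow> \<phi>\<^sub>t p \<le> \<xi>_rhs m \<alpha>\<^sub>0 F \<epsilon> u \<xi> j p)))"

definition system_supersolution ::
    "nat \<Rightarrow> nat \<Rightarrow> real \<Rightarrow> (int \<Rightarrow> real \<Rightarrow> (int \<Rightarrow> real) \<Rightarrow> real) \<Rightarrow> real
     \<Rightarrow> (int \<Rightarrow> real \<Rightarrow> real) \<Rightarrow> (int \<Rightarrow> real \<Rightarrow> real)
     \<Rightarrow> (int \<Rightarrow> real \<times> real \<Rightarrow> real) \<Rightarrow> (int \<Rightarrow> real \<times> real \<Rightarrow> real) \<Rightarrow> bool" where
  "system_supersolution n m \<alpha>\<^sub>0 F \<epsilon> u_ini \<xi>_ini u \<xi> \<longleftrightarrow>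
     (\<forall>j. locally_bdd (u j) \<and> locally_bdd (\<xi> j)) \<and>
     shift_periodic n \<epsilon> u \<and> shift_periodic n \<epsilon> \<xi> \<and>
     (\<forall>j. lower_semicont (u j) \<and> lower_semicont (\<xi> j)) \<and>
     (\<forall>j x. u_ini j x \<le> u j (0, x) \<and> \<xi>_ini j x \<le> \<xi> j (0, x)) \<and>
     (\<forall>\<phi> \<phi>\<^sub>t \<phi>\<^sub>x. C1_test \<phi> \<phi>\<^sub>t \<phi>\<^sub>x \<longrightarrow>
        (\<forall>j. \<forall>p\<in>pos_time_space.
           (local_min_at (\<lambda>q. u j q - \<phi> q) p \<longrightarrow> u_rhs \<alpha>\<^sub>0 \<epsilon> u \<xi> j p \<le> \<phi>\<^sub>t p) \<and>
           (local_min_at (\<lambda>q. \<xi> j q - \<phi> q) p \<longrightarrow> \<xi>_rhs m \<alpha>\<^sub>0 F \<epsilon> u \<xi> j p \<le> \<phi>\<^sub>t p)))"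

definition system_viscosity_solution ::
    "nat \<Rightarrow> nat \<Rightarrow> real \<Rightarrow> (int \<Rightarrow> real \<Rightarrow> (int \<Rightarrow> real) \<Rightarrow> real) \<Rightarrow> real
     \<Rightarrow> (int \<Rightarrow> real \<Rightarrow> real) \<Rightarrow> (int \<Rightarrow> real \<Rightarrow> real)
     \<Rightarrow> (int \<Rightarrow> real \<times> real \<Rightarrow> real) \<Rightarrow> (int \<Rightarrow> real \<times> real \<Rightarrow> real) \<Rightarrow> bool" where
  "system_viscosity_solution n m \<alpha>\<^sub>0 F \<epsilon> u_ini \<xi>_ini u \<xi> \<longleftrightarrow>
     (\<forall>j. locally_bdd (u j) \<and> locally_bdd (\<xi> j)) \<and>
     shift_periodic n \<epsilon> u \<and> shift_periodic n \<epsilon> \<xi> \<and>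
     system_subsolution n m \<alpha>\<^sub>0 F \<epsilon> u_ini \<xi>_ini
       (\<lambda>j. usc_envelope (u j)) (\<lambda>j. usc_envelope (\<xi> j)) \<and>
     system_supersolution n m \<alpha>\<^sub>0 F \<epsilon> u_ini \<xi>_ini
       (\<lambda>j. lsc_envelope (u j)) (\<lambda>j. lsc_envelope (\<xi> j))"

definition near_initial :: "(real \<Rightarrow> real) \<Rightarrow> (real \<times> real \<Rightarrow> real) \<Rightarrow> bool" where
  "near_initial g w \<longleftrightarrow> (\<forall>T>0. \<exists>C. \<forall>t\<in>{0..T}. \<forall>x. \<bar>w (t, x) - g x\<bar> \<le> C)"

text \<open>
  The class in which the solution of the system is unique: viscosity solutions at bounded
  distance from their initial data on bounded time intervals.
\<close>

definition is_system_solution ::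
    "nat \<Rightarrow> nat \<Rightarrow> real \<Rightarrow> (int \<Rightarrow> real \<Rightarrow> (int \<Rightarrow> real) \<Rightarrow> real) \<Rightarrow> real
     \<Rightarrow> (int \<Rightarrow> real \<Rightarrow> real) \<Rightarrow> (int \<Rightarrow> real \<Rightarrow> real)
     \<Rightarrow> (int \<Rightarrow> real \<times> real \<Rightarrow> real) \<Rightarrow> (int \<Rightarrow> real \<times> real \<Rightarrow> real) \<Rightarrow> bool" where
  "is_system_solution n m \<alpha>\<^sub>0 F \<epsilon> u_ini \<xi>_ini u \<xi> \<longleftrightarrow>
     system_viscosity_solution n m \<alpha>\<^sub>0 F \<epsilon> u_ini \<xi>_ini u \<xi> \<and>
     (\<forall>j. near_initial (u_ini j) (u j) \<and> near_initial (\<xi>_ini j) (\<xi> j))"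

section \<open>Viscosity solutions of \<open>w\<^sub>t = H(w\<^sub>x)\<close>, \<open>w(0,\<cdot>) = g\<close>\<close>

definition HJ_subsolution ::
    "(real \<Rightarrow> real) \<Rightarrow> (real \<Rightarrow> real) \<Rightarrow> (real \<times> real \<Rightarrow> real) \<Rightarrow> bool" where
  "HJ_subsolution H g w \<longleftrightarrow>
     locally_bdd w \<and> upper_semicont w \<and> (\<forall>x. w (0, x) \<le> g x) \<and>
     (\<forall>\<phi> \<phi>\<^sub>t \<phi>\<^sub>x. C1_test \<phi> \<phi>\<^sub>t \<phi>\<^sub>x \<longrightarrow>
        (\<forall>p\<in>pos_time_space. local_max_at (\<lambda>q. w q - \<phi> q) p \<longrightarrow> \<phi>\<^sub>t p \<le> H (\<phi>\<^sub>x p)))"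

definition HJ_supersolution ::
    "(real \<Rightarrow> real) \<Rightarrow> (real \<Rightarrow> real) \<Rightarrow> (real \<times> real \<Rightarrow> real) \<Rightarrow> bool" where
  "HJ_supersolution H g w \<longleftrightarrow>
     locally_bdd w \<and> lower_semicont w \<and> (\<forall>x. g x \<le> w (0, x)) \<and>
     (\<forall>\<phi> \<phi>\<^sub>t \<phi>\<^sub>x. C1_test \<phi> \<phi>\<^sub>t \<phi>\<^sub>x \<longrightarrow>
        (\<forall>p\<in>pos_time_space. local_min_at (\<lambda>q. w q - \<phi> q) p \<longrightarrow> H (\<phi>\<^sub>x p) \<le> \<phi>\<^sub>t p))"

definition HJ_viscosity_solution ::
    "(real \<Rightarrow> real) \<Rightarrow> (real \<Rightarrow> real) \<Rightarrow> (real \<times> real \<Rightarrow> real) \<Rightarrow> bool" where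
  "HJ_viscosity_solution H g w \<longleftrightarrow>
     locally_bdd w \<and> HJ_subsolution H g (usc_envelope w) \<and> HJ_supersolution H g (lsc_envelope w)"

text \<open>As for the system, solutions stay at bounded distance from their initial datum.\<close>

definition is_HJ_solution ::
    "(real \<Rightarrow> real) \<Rightarrow> (real \<Rightarrow> real) \<Rightarrow> (real \<times> real \<Rightarrow> real) \<Rightarrow> bool" where
  "is_HJ_solution H g w \<longleftrightarrow> HJ_viscosity_solution H g w \<and> near_initial g w"

definition is_unique_HJ_solution ::
    "(real \<Rightarrow> real) \<Rightarrow> (real \<Rightarrow> real) \<Rightarrow> (real \<times> real \<Rightarrow> real) \<Rightarrow> bool" where
  "is_unique_HJ_solution H g w \<longleftrightarrow>
     is_HJ_solution H g w \<and> (\<forall>w'. is_HJ_solution H g w' \<longrightarrow> (\<forall>p\<in>time_space. w' p = w p))"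

end

(*
  The system contains no space derivative and its shift condition only relates parallel copies, so
  at each fixed x it is, after rescaling time and values by epsilon, a cooperative system of ordinary
  differential equations for infinitely many particles. Comparison, invariance of the dynamics under
  addition of integers and under shifts of the index by n and of time by 1, and preservation of the
  order of the particles show that the solution issued from a linear configuration of slope p stays
  at bounded distance from a linear configuration of slope p moving with a constant speed, which
  defines Fbar(p) for p >= 0; other slopes do not occur, the data being increasing. Perturbations
  travel at finite speed up to exponentially small errors; hence any configuration which is affine
  of slope p near a point moves there with speed Fbar(p). Therefore the upper and lower relaxed
  limits are a sub- and a supersolution of the Hamilton-Jacobi equation, and they coincide by
  comparison, Fbar being Lipschitz continuous.
*)
theory Submission
  imports Defs
begin

section \<open>Semicontinuous functions\<close>

text \<open>The invariances are discrete: values and times may be shifted by integers, indices by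
  multiples of \<open>n\<close>. Every comparison therefore loses a bounded amount at the
  microscopic scale, which is O(\<open>\<epsilon>\<close>) after rescaling; so bounded distance from
  a linear motion is all that is proved, and no exact profile is constructed. Inside a block of
  \<open>n\<close> indices the particles are controlled by their order alone, and the two kinds of
  particles stay together because their difference is damped at rate \<open>2 * \<alpha>\<close>.
  The given solutions of the system are not assumed continuous. A classical solution of the particle
  system is constructed at every \<open>x\<close>, and both semicontinuous envelopes are compared
  with it; this identifies the given solution with it pointwise. Infinitely many unknowns with
  linear growth in the index are handled by the weight \<open>exp \<bar>j\<bar>\<close>. A
  perturbation of this shape grows at most exponentially in time, which also yields the locality of
  the dynamics.\<close>

definition usc_on :: "'a::topological_space set \<Rightarrow> ('a \<Rightarrow> real) \<Rightarrow> bool" where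
  "usc_on S f \<longleftrightarrow> (\<forall>p\<in>S. \<forall>a. f p < a \<longrightarrow> (\<forall>\<^sub>F q in at p within S. f q < a))"

lemma upper_semicont_iff_usc_on: "upper_semicont f \<longleftrightarrow> usc_on time_space f"
  by (simp add: upper_semicont_def usc_on_def)

lemma usc_onD:
  assumes "usc_on S f" "p \<in> S" "f p < a"
  obtains A where "open A" "p \<in> A" "\<And>q. q \<in> A \<Longrightarrow> q \<in> S \<Longrightarrow> f q < a"
proof -
  have "\<forall>\<^sub>F q in at p within S. f q < a"
    using assms by (auto simp: usc_on_def)
  then obtain A where "open A" "p \<in> A" and *: "\<forall>q\<in>A. q \<noteq> p \<longrightarrow> q \<in> S \<longrightarrow> f q < a"
    unfolding eventually_at_topological by blast
  show ?thesis
  proof (rule that)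
    fix q assume "q \<in> A" "q \<in> S"
    then show "f q < a" using * assms(3) by (cases "q = p") auto
  qed fact+
qed

lemma usc_onI:
  assumes "\<And>p a. p \<in> S \<Longrightarrow> f p < a \<Longrightarrow> \<exists>A. open A \<and> p \<in> A \<and> (\<forall>q\<in>A \<inter> S. f q < a)"
  shows "usc_on S f"
  unfolding usc_on_def eventually_at_topological
proof (intro ballI allI impI)
  fix p a assume "p \<in> S" "f p < a"
  from assms[OF this] show "\<exists>A. open A \<and> p \<in> A \<and> (\<forall>q\<in>A. q \<noteq> p \<longrightarrow> q \<in> S \<longrightarrow> f q < a)" by blast
qed

lemma usc_on_subset: "usc_on S f \<Longrightarrow> T \<subseteq> S \<Longrightarrow> usc_on T f"
  unfolding usc_on_def using at_le[of T S] by (meson filter_leD subsetD)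

lemma continuous_on_imp_usc_on:
  assumes "continuous_on S f" shows "usc_on S f"
  using assms unfolding usc_on_def continuous_on_def by (auto intro: order_tendstoD(2))

lemma usc_on_add:
  assumes f: "usc_on S f" and g: "usc_on S g"
  shows "usc_on S (\<lambda>x. f x + g x)"
proof (rule usc_onI)
  fix p a assume p: "p \<in> S" "f p + g p < a"
  define e where "e = (a - f p - g p) / 2"
  have e: "e > 0" using p by (simp add: e_def)
  obtain A where A: "open A" "p \<in> A" "\<And>q. q \<in> A \<Longrightarrow> q \<in> S \<Longrightarrow> f q < f p + e"
    using usc_onD[OF f p(1), of "f p + e"] e by (metis less_add_same_cancel1)
  obtain B where B: "open B" "p \<in> B" "\<And>q. q \<in> B \<Longrightarrow> q \<in> S \<Longrightarrow> g q < g p + e"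
    using usc_onD[OF g p(1), of "g p + e"] e by (metis less_add_same_cancel1)
  have "f q + g q < a" if "q \<in> (A \<inter> B) \<inter> S" for q
    using A(3)[of q] B(3)[of q] that by (simp add: e_def field_simps)
  then show "\<exists>A. open A \<and> p \<in> A \<and> (\<forall>q\<in>A \<inter> S. f q + g q < a)"
    using A B by (intro exI[of _ "A \<inter> B"]) auto
qed

lemma usc_on_compose:
  assumes f: "usc_on T f" and g: "continuous_on S g" and "g ` S \<subseteq> T"
  shows "usc_on S (\<lambda>x. f (g x))"
proof (rule usc_onI)
  fix p a assume p: "p \<in> S" "f (g p) < a"
  obtain B where B: "open B" "g p \<in> B" "\<And>q. q \<in> B \<Longrightarrow> q \<in> T \<Longrightarrow> f q < a"
    using usc_onD[OF f _ p(2)] p assms(3) by blast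
  obtain A where "open A" "A \<inter> S = g -` B \<inter> S"
    using continuous_on_open_invariant[THEN iffD1, OF g] B(1) by blast
  then show "\<exists>A. open A \<and> p \<in> A \<and> (\<forall>q\<in>A \<inter> S. f (g q) < a)"
    using p B assms(3) by (intro exI[of _ A]) blast
qed

text \<open>Without a maximum every \<open>x\<close> has a better point \<open>g x\<close>, and the
  open sets where \<open>f\<close> is below \<open>f (g x)\<close> cover \<open>S\<close>. In a
  finite subcover the largest value \<open>f (g c)\<close> is taken at a point lying in some
  \<open>A d\<close>, hence is below \<open>f (g d)\<close>, a contradiction.\<close>

lemma usc_on_attains_sup:
  assumes S: "compact S" "S \<noteq> {}" and f: "usc_on S f"
  obtains x where "x \<in> S" "\<And>y. y \<in> S \<Longrightarrow> f y \<le> f x"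
proof (rule ccontr)
  assume "\<not> thesis"
  with that have nex: "\<forall>x\<in>S. \<exists>y\<in>S. f x < f y"
    by (meson not_le_imp_less)
  then obtain g where g: "\<And>x. x \<in> S \<Longrightarrow> g x \<in> S \<and> f x < f (g x)"
    by metis
  have "\<exists>A. open A \<and> x \<in> A \<and> (\<forall>q\<in>A \<inter> S. f q < f (g x))" if "x \<in> S" for x
    using usc_onD[OF f that, of "f (g x)"] g[OF that] by (metis IntD1 IntD2)
  then obtain A where A: "\<And>x. x \<in> S \<Longrightarrow> open (A x)" "\<And>x. x \<in> S \<Longrightarrow> x \<in> A x"
    "\<And>x q. x \<in> S \<Longrightarrow> q \<in> A x \<Longrightarrow> q \<in> S \<Longrightarrow> f q < f (g x)"
    by (metis Int_iff)
  obtain C where C: "C \<subseteq> S" "finite C" "S \<subseteq> (\<Union>c\<in>C. A c)"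
    using compactE_image[OF S(1), of S A] A(1,2) by blast
  have "C \<noteq> {}" using C S(2) by auto
  define M where "M = Max ((\<lambda>c. f (g c)) ` C)"
  have "M \<in> (\<lambda>c. f (g c)) ` C"
    unfolding M_def using C \<open>C \<noteq> {}\<close> by (intro Max_in) auto
  then obtain c where c: "c \<in> C" "M = f (g c)" by auto
  with C g have "g c \<in> S" by blast
  with C obtain d where d: "d \<in> C" "g c \<in> A d" by auto
  then have "f (g c) < f (g d)" using A(3) C \<open>g c \<in> S\<close> by blast
  moreover have "f (g d) \<le> M" unfolding M_def using C d by (intro Max_ge) auto
  ultimately show False using c by simp
qed

lemma usc_on_mult_pos:
  assumes f: "usc_on S f" and g: "continuous_on S g" and pos: "\<And>x. x \<in> S \<Longrightarrow> g x > (0::real)"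
  shows "usc_on S (\<lambda>x. f x * g x)"
  unfolding usc_on_def
proof (intro ballI allI impI)
  fix p a assume p: "p \<in> S" "f p * g p < a"
  then have "f p < a / g p" using pos[of p] by (simp add: field_simps)
  \<comment> \<open>No sign of \<open>f\<close> is known, so bounds for the two factors cannot
    simply be multiplied; the constant \<open>c\<close> is compared with each factor
    separately.\<close>
  then obtain c where c: "f p < c" "c < a / g p" using dense by blast
  then have "c * g p < a" using pos[of p] p by (simp add: field_simps)
  moreover have "((\<lambda>x. c * g x) \<longlongrightarrow> c * g p) (at p within S)"
    using g p by (auto simp: continuous_on_def intro!: tendsto_intros)
  ultimately have "\<forall>\<^sub>F q in at p within S. c * g q < a"
    by (auto intro: order_tendstoD(2))
  moreover have "\<forall>\<^sub>F q in at p within S. f q < c"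
    using f p c by (auto simp: usc_on_def)
  moreover have "\<forall>\<^sub>F q in at p within S. q \<in> S"
    by (simp add: eventually_at_filter)
  ultimately show "\<forall>\<^sub>F q in at p within S. f q * g q < a"
  proof eventually_elim
    case (elim q)
    then have "f q * g q \<le> c * g q" using pos[of q] by (intro mult_right_mono) auto
    with elim show ?case by simp
  qed
qed

section \<open>Comparison principles for cooperative lattice systems\<close>

declare split_paired_All [simp del] split_paired_Ex [simp del]

text \<open>The site \<open>(True, j)\<close> carries \<open>u\<^sub>j\<close> and \<open>(False, j)\<close> carries \<open>\<xi>\<^sub>j\<close>.\<close>

type_synonym site = "bool \<times> int"

text \<open>The square of the positive part vanishes up to \<open>a\<close> and is still
  continuously differentiable: a penalisation that acts only after a given time. At
  \<open>x = a\<close> the difference quotient is bounded by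
  \<open>\<bar>y - a\<bar>\<close>.\<close>

lemma DERIV_max_0_power2:
  "((\<lambda>x. (max 0 (x - a))\<^sup>2) has_real_derivative 2 * max 0 (x - a)) (at (x::real))"
proof (cases x a rule: linorder_cases)
  case less
  have "((\<lambda>x::real. 0) has_real_derivative 2 * max 0 (x - a)) (at x)"
    using less by auto
  then show ?thesis
    by (rule has_field_derivative_transform_within_open[where S = "{..<a}"]) (use less in auto)
next
  case greater
  have "((\<lambda>x::real. (x - a)\<^sup>2) has_real_derivative 2 * max 0 (x - a)) (at x)"
    using greater by (auto intro!: derivative_eq_intros)
  then show ?thesis
    by (rule has_field_derivative_transform_within_open[where S = "{a<..}"]) (use greater in auto)
next
  case equal
  have "((\<lambda>y. (max 0 (y - a))\<^sup>2 / (y - a)) \<longlongrightarrow> 0) (at a)"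
  proof (rule Lim_null_comparison)
    show "\<forall>\<^sub>F y in at a. norm ((max 0 (y - a))\<^sup>2 / (y - a)) \<le> \<bar>y - a\<bar>"
      by (auto intro!: always_eventually simp: max_def power2_eq_square)
    show "((\<lambda>y. \<bar>y - a\<bar>) \<longlongrightarrow> 0) (at a)"
      by (rule tendsto_eq_intros | simp)+
  qed
  then show ?thesis using equal by (simp add: has_field_derivative_iff)
qed

text \<open>
  The function \<open>\<theta>\<close> is coercive just after the time under consideration, so that a touching time is
  interior and the touching functions are \<open>C\<^sup>1\<close> on the whole half line.
\<close>

lemma maximum_principle:
  fixes w :: "'i \<Rightarrow> real \<Rightarrow> real" and \<rho> :: "'i \<Rightarrow> real"
  assumes usc: "\<And>i. usc_on {0..} (w i)"
    and init: "\<And>i. w i 0 \<le> 0"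
    and \<rho>: "\<And>i. \<rho> i > 0" and "\<Lambda> \<ge> 0"
    and decay: "\<And>T \<delta>. \<delta> > 0 \<Longrightarrow> finite {i. \<exists>t\<in>{0..T}. w i t > \<delta> * \<rho> i}"
    and touch: "\<And>i t \<theta> \<theta>'. t > 0 \<Longrightarrow> (\<And>s. s > 0 \<Longrightarrow> (\<theta> has_real_derivative \<theta>' s) (at s)) \<Longrightarrow>
      continuous_on {0<..} \<theta>' \<Longrightarrow> (\<And>s. s > 0 \<Longrightarrow> \<Lambda> * \<theta> s \<le> \<theta>' s) \<Longrightarrow> (\<And>s. \<theta> s > 0) \<Longrightarrow>
      (\<forall>\<^sub>F s in nhds t. \<forall>k. w k s \<le> \<theta> s * \<rho> k) \<Longrightarrow> w i t = \<theta> t * \<rho> i \<Longrightarrow> False"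
    and "\<tau> \<ge> 0"
  shows "w i\<^sub>0 \<tau> \<le> 0"
proof (rule ccontr)
  assume "\<not> w i\<^sub>0 \<tau> \<le> 0"
  then have pos: "w i\<^sub>0 \<tau> > 0" by simp
  with init[of i\<^sub>0] \<open>\<tau> \<ge> 0\<close> have "\<tau> > 0" by (cases "\<tau> = 0") auto
  \<comment> \<open>The extra unit of time leaves room for the penalisation after \<tau> to act, so
    that the maximum over \<open>{0..T}\<close> is not attained at \<open>T\<close>.\<close>
  define T where "T = \<tau> + 1"
  have usc': "usc_on {0..T} (w k)" for k
    by (rule usc_on_subset[OF usc]) auto
  have T: "compact {0..T}" "{0..T} \<noteq> {}" using \<open>\<tau> > 0\<close> by (auto simp: T_def)
  have "\<exists>b. \<forall>t\<in>{0..T}. w k t \<le> b" for k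
    using usc_on_attains_sup[OF T usc'[of k]] by metis
  then obtain b where b: "\<And>k t. t \<in> {0..T} \<Longrightarrow> w k t \<le> b k" by metis
  \<comment> \<open>Finitely many sites exceed their weight. They are bounded one by one, which
    gives a single multiple \<open>B\<close> of the weight for all sites.\<close>
  define I1 where "I1 = {i. \<exists>t\<in>{0..T}. w i t > 1 * \<rho> i}"
  have "finite I1" unfolding I1_def by (rule decay) simp
  define B where "B = 1 + (\<Sum>k\<in>I1. \<bar>b k\<bar> / \<rho> k)"
  have "B \<ge> 1" unfolding B_def using \<rho> by (auto intro!: sum_nonneg simp: less_imp_le)
  have B: "w k t \<le> B * \<rho> k" if "t \<in> {0..T}" for k t
  proof (cases "k \<in> I1")
    case True
    then have "\<bar>b k\<bar> / \<rho> k \<le> B"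
      unfolding B_def using \<open>finite I1\<close> \<rho> member_le_sum[of k I1 "\<lambda>k. \<bar>b k\<bar> / \<rho> k"]
      by (auto simp: less_imp_le)
    then have "\<bar>b k\<bar> \<le> B * \<rho> k" using \<rho>[of k] by (simp add: field_simps)
    with b[OF that, of k] show ?thesis by linarith
  next
    case False
    then have "w k t \<le> 1 * \<rho> k" using that unfolding I1_def by force
    also have "\<dots> \<le> B * \<rho> k" using \<open>B \<ge> 1\<close> \<rho>[of k] by (intro mult_right_mono) auto
    finally show ?thesis .
  qed
  \<comment> \<open>\<open>r\<close> is the positive value of the normalised function
    \<open>f\<close> at the site and time under consideration. With \<open>A = 8 * B / r\<close> the
    function \<open>\<theta>\<close> is at least \<open>2 * B / r\<close> from time
    \<open>\<tau> + 1/2\<close> on, so every \<open>f k\<close> is at most \<open>r / 2\<close>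
    there.\<close>
  define r where "r = w i\<^sub>0 \<tau> / (\<rho> i\<^sub>0 * exp (\<Lambda> * \<tau>))"
  have "r > 0" using pos \<rho> by (simp add: r_def)
  define A where "A = 8 * B / r"
  have "A > 0" using \<open>B \<ge> 1\<close> \<open>r > 0\<close> by (simp add: A_def)
  define \<theta> where "\<theta> t = exp (\<Lambda> * t) * (1 + A * (max 0 (t - \<tau>))\<^sup>2)" for t
  define \<theta>' where "\<theta>' t = \<Lambda> * \<theta> t + exp (\<Lambda> * t) * (A * (2 * max 0 (t - \<tau>)))" for t
  have \<theta>_ge: "\<theta> t \<ge> 1 + A * (max 0 (t - \<tau>))\<^sup>2" if "t \<ge> 0" for t
  proof -
    have "1 \<le> exp (\<Lambda> * t)" using \<open>\<Lambda> \<ge> 0\<close> that by simp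
    then have "1 * (1 + A * (max 0 (t - \<tau>))\<^sup>2) \<le> \<theta> t"
      unfolding \<theta>_def using \<open>A > 0\<close> by (intro mult_right_mono) auto
    then show ?thesis by simp
  qed
  have \<theta>_pos: "\<theta> t > 0" for t
    unfolding \<theta>_def using \<open>A > 0\<close> by (simp add: add_pos_nonneg)
  have \<theta>_cont: "continuous_on S \<theta>" for S
    unfolding \<theta>_def by (intro continuous_intros)
  have \<theta>_deriv: "(\<theta> has_real_derivative \<theta>' t) (at t)" for t
    unfolding \<theta>_def \<theta>'_def
    by (rule derivative_eq_intros DERIV_max_0_power2 refl | simp add: algebra_simps)+
  define f where "f k t = w k t / (\<rho> k * \<theta> t)" for k t
  have f_eq: "f k t = w k t * (1 / (\<rho> k * \<theta> t))" for k t by (simp add: f_def)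
  have f_usc: "usc_on {0..T} (f k)" for k
    unfolding f_eq using \<rho>[of k] \<theta>_pos
    by (intro usc_on_mult_pos usc' continuous_intros \<theta>_cont)
      (auto simp: less_imp_neq[symmetric] intro!: mult_pos_pos)
  have w_f: "w k t = f k t * (\<rho> k * \<theta> t)" for k t
    using \<rho>[of k] \<theta>_pos[of t] by (simp add: f_def)
  have r_eq: "f i\<^sub>0 \<tau> = r" by (simp add: f_def r_def \<theta>_def)
  \<comment> \<open>Outside this finite set the normalised functions never exceed
    \<open>r / 2\<close>, so the supremum over infinitely many sites is a maximum over
    \<open>I\<close>.\<close>
  define I where "I = {i. \<exists>t\<in>{0..T}. w i t > (r / 2) * \<rho> i}"
  have "finite I" unfolding I_def by (rule decay) (use \<open>r > 0\<close> in simp)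
  have f_I: "f k t \<le> r / 2" if "k \<notin> I" "t \<in> {0..T}" for k t
  proof -
    have "w k t \<le> r / 2 * \<rho> k" using that unfolding I_def by force
    also have "\<dots> \<le> r / 2 * \<rho> k * \<theta> t"
    proof -
      have "1 \<le> \<theta> t" using \<theta>_ge[of t] that \<open>A > 0\<close> by (auto intro: order_trans[rotated])
      then have "r / 2 * \<rho> k * 1 \<le> r / 2 * \<rho> k * \<theta> t"
        using \<open>r > 0\<close> \<rho>[of k] by (intro mult_left_mono) auto
      then show ?thesis by simp
    qed
    finally show ?thesis using \<rho>[of k] \<theta>_pos[of t] by (simp add: f_def field_simps)
  qed
  have "i\<^sub>0 \<in> I" using f_I[of i\<^sub>0 \<tau>] r_eq \<open>r > 0\<close> \<open>\<tau> > 0\<close> by (auto simp: T_def)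
  have "\<exists>s\<in>{0..T}. \<forall>t\<in>{0..T}. f k t \<le> f k s" for k
    using usc_on_attains_sup[OF T f_usc[of k]] by metis
  then obtain s where s: "\<And>k. s k \<in> {0..T}" "\<And>k t. t \<in> {0..T} \<Longrightarrow> f k t \<le> f k (s k)" by metis
  define \<delta> where "\<delta> = Max ((\<lambda>k. f k (s k)) ` I)"
  have "\<delta> \<in> (\<lambda>k. f k (s k)) ` I"
    unfolding \<delta>_def using \<open>finite I\<close> \<open>i\<^sub>0 \<in> I\<close> by (intro Max_in) auto
  then obtain k where k: "k \<in> I" "\<delta> = f k (s k)" by auto
  have \<delta>_ge: "f l t \<le> \<delta>" if "l \<in> I" "t \<in> {0..T}" for l t
  proof -
    have "f l (s l) \<le> \<delta>" unfolding \<delta>_def using that \<open>finite I\<close> by (intro Max_ge) auto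
    with s(2)[OF that(2), of l] show ?thesis by simp
  qed
  have "\<delta> \<ge> r" using \<delta>_ge[OF \<open>i\<^sub>0 \<in> I\<close>, of \<tau>] r_eq \<open>\<tau> > 0\<close> by (simp add: T_def)
  have f_le: "f l t \<le> \<delta>" if "t \<in> {0..T}" for l t
    using \<delta>_ge[of l t] f_I[of l t] that \<open>\<delta> \<ge> r\<close> \<open>r > 0\<close> by (cases "l \<in> I") auto
  have "s k \<noteq> 0"
  proof
    assume "s k = 0"
    then have "f k (s k) \<le> 0" using init[of k] \<rho>[of k] \<theta>_pos[of 0]
      by (simp add: f_def divide_nonpos_pos)
    with k \<open>\<delta> \<ge> r\<close> \<open>r > 0\<close> show False by simp
  qed
  then have "s k > 0" using s(1)[of k] by simp
  have "s k < \<tau> + 1/2"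
  proof (rule ccontr)
    assume "\<not> s k < \<tau> + 1/2"
    then have "(max 0 (s k - \<tau>))\<^sup>2 \<ge> (1/2)\<^sup>2" by (intro power_mono) auto
    then have "A * (max 0 (s k - \<tau>))\<^sup>2 \<ge> A * (1/2)\<^sup>2"
      by (rule mult_left_mono[OF _ less_imp_le[OF \<open>A > 0\<close>]])
    moreover have "A * (1/2)\<^sup>2 = A / 4" by (simp add: power2_eq_square)
    ultimately have "\<theta> (s k) \<ge> A / 4" using \<theta>_ge[of "s k"] \<open>s k > 0\<close> by linarith
    then have "r / 2 * \<rho> k * \<theta> (s k) \<ge> r / 2 * \<rho> k * (A / 4)"
      using \<open>r > 0\<close> \<rho>[of k] by (intro mult_left_mono) auto
    also have "r / 2 * \<rho> k * (A / 4) = B * \<rho> k" using \<open>r > 0\<close> by (simp add: A_def)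
    finally have "w k (s k) \<le> r / 2 * (\<rho> k * \<theta> (s k))" using B[OF s(1), of k k] by (simp add: mult.assoc)
    then have "f k (s k) \<le> r / 2" unfolding f_def using \<rho>[of k] \<theta>_pos[of "s k"] by (subst pos_divide_le_eq) auto
    with k \<open>\<delta> \<ge> r\<close> \<open>r > 0\<close> show False by simp
  qed
  have "\<delta> > 0" using \<open>\<delta> \<ge> r\<close> \<open>r > 0\<close> by simp
  show False
  proof (rule touch[of "s k" "\<lambda>t. \<delta> * \<theta> t" "\<lambda>t. \<delta> * \<theta>' t" k])
    show "((\<lambda>t. \<delta> * \<theta> t) has_real_derivative \<delta> * \<theta>' t) (at t)" for t
      by (rule DERIV_cmult[OF \<theta>_deriv])
    show "continuous_on {0<..} (\<lambda>t. \<delta> * \<theta>' t)"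
      unfolding \<theta>'_def by (intro continuous_intros \<theta>_cont)
    show "\<Lambda> * (\<delta> * \<theta> t) \<le> \<delta> * \<theta>' t" for t
      unfolding \<theta>'_def using \<open>\<delta> > 0\<close> \<open>A > 0\<close> by (simp add: algebra_simps)
    have "\<forall>\<^sub>F t in nhds (s k). t \<in> {0<..<T}"
      using \<open>s k > 0\<close> \<open>s k < \<tau> + 1/2\<close> by (intro eventually_nhds_in_open) (auto simp: T_def)
    then show "\<forall>\<^sub>F t in nhds (s k). \<forall>l. w l t \<le> \<delta> * \<theta> t * \<rho> l"
    proof eventually_elim
      case (elim t)
      show ?case
      proof
        fix l
        have "f l t * (\<rho> l * \<theta> t) \<le> \<delta> * (\<rho> l * \<theta> t)"
          using f_le[of t l] elim \<rho>[of l] \<theta>_pos[of t] by (intro mult_right_mono) auto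
        then show "w l t \<le> \<delta> * \<theta> t * \<rho> l" by (simp add: w_f mult.assoc mult.commute[of "\<rho> l"])
      qed
    qed
  qed (use \<open>s k > 0\<close> \<open>\<delta> > 0\<close> \<theta>_pos k w_f[of k "s k"] in \<open>auto simp: mult_ac\<close>)
qed

text \<open>Linear growth loses against exponential weights. Splitting \<open>exp x\<close> into two
  factors \<open>exp (x / 2)\<close> gives a quadratic lower bound that keeps a factor
  \<open>1 + x\<close>; cancelling it against the growth bound yields the explicit radius
  \<open>J\<close>.\<close>

lemma finite_sites_exceeding_exp:
  fixes w :: "site \<Rightarrow> real \<Rightarrow> real"
  assumes "\<And>c j t. t \<in> S \<Longrightarrow> w (c, j) t \<le> C * (1 + \<bar>real_of_int j\<bar>)"
    and "\<delta> > 0" "a > 0" and \<rho>: "\<And>c j. \<rho> (c, j) \<ge> a * exp \<bar>real_of_int j\<bar>"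
  shows "finite {i. \<exists>t\<in>S. w i t > \<delta> * \<rho> i}"
proof (rule finite_subset)
  define J where "J = \<lceil>4 * \<bar>C\<bar> / (\<delta> * a)\<rceil>"
  show "{i. \<exists>t\<in>S. w i t > \<delta> * \<rho> i} \<subseteq> UNIV \<times> {-J..J}"
  proof
    fix i assume "i \<in> {i. \<exists>t\<in>S. w i t > \<delta> * \<rho> i}"
    then obtain c j t where i: "i = (c, j)" and t: "t \<in> S" "w (c, j) t > \<delta> * \<rho> (c, j)"
      by (cases i) auto
    define x where "x = \<bar>real_of_int j\<bar>"
    have "x \<ge> 0" by (simp add: x_def)
    have "(1 + x / 2) * ((1 + x) / 2) \<le> (1 + x / 2) * (1 + x / 2)"
      using \<open>x \<ge> 0\<close> by (intro mult_left_mono) auto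
    also have "\<dots> \<le> exp (x / 2) * exp (x / 2)"
      using \<open>x \<ge> 0\<close> by (intro mult_mono) (auto simp: exp_ge_add_one_self)
    also have "\<dots> = exp x" by (simp add: exp_add[symmetric])
    finally have "\<delta> * (a * ((1 + x / 2) * ((1 + x) / 2))) \<le> \<delta> * (a * exp x)"
      using assms by (intro mult_left_mono) auto
    also have "\<dots> \<le> \<delta> * \<rho> (c, j)" using \<rho>[where c = c and j = j] assms by (intro mult_left_mono) (auto simp: x_def)
    also have "\<dots> \<le> C * (1 + x)"
      using t assms(1)[OF t(1), of c j] by (simp flip: x_def)
    also have "\<dots> \<le> \<bar>C\<bar> * (1 + x)" using \<open>x \<ge> 0\<close> by (intro mult_right_mono) auto
    finally have "(\<delta> * a * (1 + x / 2) / 2) * (1 + x) \<le> \<bar>C\<bar> * (1 + x)" by (simp add: algebra_simps)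
    then have "\<delta> * a * (1 + x / 2) / 2 \<le> \<bar>C\<bar>"
      using \<open>x \<ge> 0\<close> by (subst (asm) mult_le_cancel_right) auto
    moreover have "0 < \<delta> * a" using assms by simp
    ultimately have "x \<le> 4 * \<bar>C\<bar> / (\<delta> * a)" by (simp add: field_simps)
    then have "x \<le> J" unfolding J_def by linarith
    then show "i \<in> UNIV \<times> {- J..J}" by (auto simp: i x_def abs_le_iff)
  qed
qed simp

text \<open>Viscosity subsolutions in time alone: the space variable of the original system is frozen.\<close>

definition visc_sub :: "(site \<Rightarrow> real \<Rightarrow> (site \<Rightarrow> real) \<Rightarrow> real) \<Rightarrow> (site \<Rightarrow> real \<Rightarrow> real) \<Rightarrow> bool" where
  "visc_sub G w \<longleftrightarrow> (\<forall>i. usc_on {0..} (w i)) \<and>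
     (\<forall>i \<psi> \<psi>' t. (\<forall>s>0. (\<psi> has_real_derivative \<psi>' s) (at s)) \<longrightarrow> continuous_on {0<..} \<psi>' \<longrightarrow>
        t > 0 \<longrightarrow> (\<forall>\<^sub>F s in nhds t. w i s - \<psi> s \<le> w i t - \<psi> t) \<longrightarrow> \<psi>' t \<le> G i t (\<lambda>k. w k t))"

text \<open>The derivative has to be continuous because \<open>V\<close> becomes part of the C1
  functions that touch a viscosity subsolution.\<close>

definition classical_super :: "(site \<Rightarrow> real \<Rightarrow> (site \<Rightarrow> real) \<Rightarrow> real) \<Rightarrow> (site \<Rightarrow> real \<Rightarrow> real) \<Rightarrow> bool" where
  "classical_super G V \<longleftrightarrow> (\<forall>i. continuous_on {0..} (V i)) \<and>
     (\<exists>V'. (\<forall>i. continuous_on {0<..} (V' i)) \<and>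
        (\<forall>i. \<forall>t>0. (V i has_real_derivative V' i t) (at t) \<and> G i t (\<lambda>k. V k t) \<le> V' i t))"

lemma visc_subD:
  assumes "visc_sub G w" "\<And>s. s > 0 \<Longrightarrow> (\<psi> has_real_derivative \<psi>' s) (at s)" "continuous_on {0<..} \<psi>'"
    "t > 0" "\<forall>\<^sub>F s in nhds t. w i s - \<psi> s \<le> w i t - \<psi> t"
  shows "\<psi>' t \<le> G i t (\<lambda>k. w k t)"
  using assms unfolding visc_sub_def by blast

lemma classical_imp_visc_sub:
  assumes cont: "\<And>i. continuous_on {0..} (w i)"
    and deriv: "\<And>i t. t > 0 \<Longrightarrow> (w i has_real_derivative w' i t) (at t)"
    and le: "\<And>i t. t > 0 \<Longrightarrow> w' i t \<le> G i t (\<lambda>k. w k t)"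
  shows "visc_sub G w"
  unfolding visc_sub_def
proof (intro conjI allI impI)
  fix i \<psi> \<psi>' and t :: real
  assume \<psi>: "\<forall>s>0. (\<psi> has_real_derivative \<psi>' s) (at s)" "t > 0"
    and max: "\<forall>\<^sub>F s in nhds t. w i s - \<psi> s \<le> w i t - \<psi> t"
  obtain d where d: "d > 0" "\<And>s. dist s t < d \<Longrightarrow> w i s - \<psi> s \<le> w i t - \<psi> t"
    using max unfolding eventually_nhds_metric by blast
  have "w' i t - \<psi>' t = 0"
  proof (rule DERIV_local_max[where d = d])
    show "((\<lambda>s. w i s - \<psi> s) has_real_derivative w' i t - \<psi>' t) (at t)"
      using deriv[OF \<open>t > 0\<close>, of i] \<psi> by (intro DERIV_diff) auto
  qed (use d in \<open>auto simp: dist_real_def\<close>)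
  with le[OF \<open>t > 0\<close>, of i] show "\<psi>' t \<le> G i t (\<lambda>k. w k t)" by simp
qed (rule continuous_on_imp_usc_on[OF cont])

text \<open>\<open>quasimono\<close> is Kamke's condition: raising the other unknowns cannot slow
  down the one considered. By \<open>lip\<close> a site depends only on the indices at distance at
  most \<open>m\<close>, with sites of both kinds counted.\<close>

locale cooperative =
  fixes G :: "site \<Rightarrow> real \<Rightarrow> (site \<Rightarrow> real) \<Rightarrow> real" and m :: nat and Lg :: real
  assumes Lg_nonneg: "Lg \<ge> 0"
    and lip: "\<And>c j t z z' d. (\<And>c' k. \<bar>k - j\<bar> \<le> int m \<Longrightarrow> \<bar>z (c', k) - z' (c', k)\<bar> \<le> d) \<Longrightarrow>
      \<bar>G (c, j) t z - G (c, j) t z'\<bar> \<le> Lg * d"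
    and quasimono: "\<And>i t z z'. (\<And>k. z k \<le> z' k) \<Longrightarrow> z i = z' i \<Longrightarrow> G i t z \<le> G i t z'"
begin

text \<open>Within distance \<open>m\<close> the weight \<open>exp \<bar>j\<bar>\<close> grows by at
  most \<open>exp m\<close>, so \<open>Lg * exp m\<close> is the Lipschitz constant of the field in
  the weighted norm; the added 1 makes exponential barriers strict.\<close>

definition rate :: real where "rate = Lg * exp m + 1"

lemma rate_pos: "rate > 0"
  unfolding rate_def using Lg_nonneg by (simp add: add_nonneg_pos)

lemma exp_neighbour_le: "\<bar>k - j\<bar> \<le> int m \<Longrightarrow> exp \<bar>real_of_int k\<bar> \<le> exp m * exp \<bar>real_of_int j\<bar>"
  by (simp add: exp_add[symmetric])

lemma perturb_le:
  assumes "b \<ge> 0"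
  shows "\<bar>G (c, j) t (\<lambda>(c, k). z (c, k) + b * exp \<bar>real_of_int k\<bar>) - G (c, j) t z\<bar>
    \<le> (rate - 1) * (b * exp \<bar>real_of_int j\<bar>)"
proof -
  have "\<bar>G (c, j) t (\<lambda>(c, k). z (c, k) + b * exp \<bar>real_of_int k\<bar>) - G (c, j) t z\<bar>
      \<le> Lg * (b * (exp m * exp \<bar>real_of_int j\<bar>))"
    by (rule lip) (use assms in \<open>auto simp: abs_mult intro!: mult_left_mono exp_neighbour_le\<close>)
  then show ?thesis by (simp add: rate_def mult_ac)
qed

text \<open>Where \<open>w\<close> touches the barrier \<open>V + \<theta> * \<rho>\<close> from
  below, quasimonotonicity replaces \<open>w\<close> by the barrier at all other sites, and
  \<open>perturb_le\<close> bounds the effect of the barrier on the field. The resulting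
  \<open>\<theta>' \<le> (rate - 1) * \<theta>\<close> contradicts
  \<open>rate * \<theta> \<le> \<theta>'\<close>.\<close>

theorem comparison:
  assumes w: "visc_sub G w" and V: "classical_super G V"
    and growth: "\<And>T. \<exists>C. \<forall>c j. \<forall>t\<in>{0..T}. w (c, j) t - V (c, j) t \<le> C * (1 + \<bar>real_of_int j\<bar>)"
    and init: "\<And>i. w i 0 \<le> V i 0" and "t \<ge> 0"
  shows "w i t \<le> V i t"
proof -
  obtain V' where V': "\<And>i. continuous_on {0<..} (V' i)"
    "\<And>i t. t > 0 \<Longrightarrow> (V i has_real_derivative V' i t) (at t)"
    "\<And>i t. t > 0 \<Longrightarrow> G i t (\<lambda>k. V k t) \<le> V' i t"
    and Vc: "\<And>i. continuous_on {0..} (V i)"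
    using V unfolding classical_super_def by blast
  define \<rho> :: "site \<Rightarrow> real" where "\<rho> = (\<lambda>(c, j). exp \<bar>real_of_int j\<bar>)"
  have "w i t - V i t \<le> 0"
  proof (rule maximum_principle[where w = "\<lambda>i t. w i t - V i t" and \<rho> = \<rho> and \<Lambda> = rate])
    fix i
    have "usc_on {0..} (\<lambda>t. w i t + - V i t)"
      using w Vc[of i] unfolding visc_sub_def
      by (intro usc_on_add continuous_on_imp_usc_on[of "{0..}" "\<lambda>t. - V i t"] continuous_intros) auto
    then show "usc_on {0..} (\<lambda>t. w i t - V i t)" by simp
  next
    fix T \<delta> :: real assume "\<delta> > 0"
    obtain C where "\<forall>c j. \<forall>t\<in>{0..T}. w (c, j) t - V (c, j) t \<le> C * (1 + \<bar>real_of_int j\<bar>)"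
      using growth by blast
    then show "finite {i. \<exists>t\<in>{0..T}. w i t - V i t > \<delta> * \<rho> i}"
      by (intro finite_sites_exceeding_exp[where a = 1 and C = C]) (use \<open>\<delta> > 0\<close> in \<open>auto simp: \<rho>_def\<close>)
  next
    fix i t \<theta> \<theta>'
    assume t: "t > 0" and \<theta>: "\<And>s. s > 0 \<Longrightarrow> (\<theta> has_real_derivative \<theta>' s) (at s)"
      "continuous_on {0<..} \<theta>'" "\<And>s. s > 0 \<Longrightarrow> rate * \<theta> s \<le> \<theta>' s" "\<And>s. \<theta> s > 0"
      and ev: "\<forall>\<^sub>F s in nhds t. \<forall>k. w k s - V k s \<le> \<theta> s * \<rho> k"
      and eq: "w i t - V i t = \<theta> t * \<rho> i"
    obtain c j where i: "i = (c, j)" by (cases i)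
    have "V' i t + \<theta>' t * \<rho> i \<le> G i t (\<lambda>k. w k t)"
    proof (rule visc_subD[OF w, where \<psi> = "\<lambda>s. V i s + \<theta> s * \<rho> i" and \<psi>' = "\<lambda>s. V' i s + \<theta>' s * \<rho> i"])
      show "((\<lambda>s. V i s + \<theta> s * \<rho> i) has_real_derivative V' i s + \<theta>' s * \<rho> i) (at s)" if "s > 0" for s
        using V'(2) \<theta>(1) that by (intro DERIV_add DERIV_cmult_right)
      show "\<forall>\<^sub>F s in nhds t. w i s - (V i s + \<theta> s * \<rho> i) \<le> w i t - (V i t + \<theta> t * \<rho> i)"
        using ev by eventually_elim (use eq in \<open>auto simp: algebra_simps\<close>)
      show "continuous_on {0<..} (\<lambda>s. V' i s + \<theta>' s * \<rho> i)"
        using V'(1)[of i] \<theta>(2) by (intro continuous_intros)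
    qed (rule t)
    also have "\<dots> \<le> G i t (\<lambda>(c, k). V (c, k) t + \<theta> t * exp \<bar>real_of_int k\<bar>)"
    proof (rule quasimono)
      have "w (d, k) t - V (d, k) t \<le> \<theta> t * \<rho> (d, k)" for d k using eventually_nhds_x_imp_x[OF ev] by blast
      then show "w k t \<le> (case k of (c, k) \<Rightarrow> V (c, k) t + \<theta> t * exp \<bar>real_of_int k\<bar>)" for k
        by (cases k) (auto simp: \<rho>_def algebra_simps)
    qed (use eq i in \<open>auto simp: \<rho>_def\<close>)
    also have "\<dots> \<le> G i t (\<lambda>k. V k t) + (rate - 1) * (\<theta> t * \<rho> i)"
      using perturb_le[of "\<theta> t" c j t "\<lambda>k. V k t"] \<theta>(4)[of t] by (simp add: i \<rho>_def)
    also have "\<dots> \<le> V' i t + (rate - 1) * (\<theta> t * \<rho> i)" using V'(3)[OF t] by simp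
    finally have "\<theta>' t * \<rho> i \<le> (rate * \<theta> t - \<theta> t) * \<rho> i" by (simp add: algebra_simps)
    moreover have "\<rho> i > 0" by (simp add: \<rho>_def i)
    ultimately have "\<theta>' t \<le> rate * \<theta> t - \<theta> t" by simp
    with \<theta>(3)[OF t] \<theta>(4)[of t] show False by simp
  qed (use init rate_pos \<open>t \<ge> 0\<close> in \<open>auto simp: \<rho>_def\<close>)
  then show ?thesis by simp
qed

text \<open>Changing the signs of field and unknowns turns supersolutions into subsolutions, so the
  lower envelopes are treated by the same comparison and the same freezing of
  \<open>x\<close>.\<close>

definition dual_field :: "site \<Rightarrow> real \<Rightarrow> (site \<Rightarrow> real) \<Rightarrow> real" where
  "dual_field i t z = - G i t (\<lambda>k. - z k)"

lemma cooperative_dual: "cooperative dual_field m Lg"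
proof
  show "Lg \<ge> 0" by (rule Lg_nonneg)
  fix c j t and z z' :: "site \<Rightarrow> real" and d
  assume *: "\<And>c' k. \<bar>k - j\<bar> \<le> int m \<Longrightarrow> \<bar>z (c', k) - z' (c', k)\<bar> \<le> d"
  have "\<bar>G (c, j) t (\<lambda>k. - z k) - G (c, j) t (\<lambda>k. - z' k)\<bar> \<le> Lg * d"
    by (rule lip) (use * in \<open>simp add: abs_minus_commute\<close>)
  then show "\<bar>dual_field (c, j) t z - dual_field (c, j) t z'\<bar> \<le> Lg * d"
    by (simp add: dual_field_def abs_minus_commute)
qed (auto simp: dual_field_def intro!: quasimono)

end

text \<open>\<open>order\<close> says that a particle which meets its successor is not faster, so
  they do not cross. By \<open>relax\<close> the distance between the two particles of index
  \<open>j\<close> is damped at rate \<open>2 * \<alpha>\<close>, with a forcing that depends on the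
  \<open>u\<close> particles alone.\<close>

locale ordered_lattice = cooperative +
  fixes n :: nat and \<alpha> :: real
  assumes n_pos: "n \<ge> 1" and \<alpha>_pos: "\<alpha> > 0"
    and continuous_field: "\<And>S i z. (\<And>k. continuous_on S (z k)) \<Longrightarrow> continuous_on S (\<lambda>t. G i t (\<lambda>k. z k t))"
    and time_periodic: "\<And>i t z. G i (t + 1) z = G i t z"
    and value_periodic: "\<And>i t z. G i t (\<lambda>k. z k + 1) = G i t z"
    and type_periodic: "\<And>c j t z. G (c, j + int n) t z = G (c, j) t (\<lambda>(c, k). z (c, k + int n))"
    and order: "\<And>c j t z. (\<And>c k. z (c, k) \<le> z (c, k + 1)) \<Longrightarrow> z (c, j) = z (c, j + 1) \<Longrightarrow>
      G (c, j) t z \<le> G (c, j + 1) t z"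
    and relax: "\<And>j t z. G (False, j) t z - G (True, j) t z =
      G (False, j) t (\<lambda>(c, k). z (True, k)) - 2 * \<alpha> * (z (False, j) - z (True, j))"
begin

text \<open>Linear growth in the index, locally uniform in time, is the class in which comparison
  with the exponential weight applies; two solutions with the same data therefore coincide.\<close>

definition solution :: "(site \<Rightarrow> real \<Rightarrow> real) \<Rightarrow> bool" where
  "solution z \<longleftrightarrow> (\<forall>i. continuous_on {0..} (z i)) \<and>
     (\<forall>i. \<forall>t>0. (z i has_real_derivative G i t (\<lambda>k. z k t)) (at t)) \<and>
     (\<forall>T. \<exists>C. \<forall>c j. \<forall>t\<in>{0..T}. \<bar>z (c, j) t\<bar> \<le> C * (1 + \<bar>real_of_int j\<bar>))"

lemma solution_continuous: "solution z \<Longrightarrow> continuous_on {0..} (z i)"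
  by (simp add: solution_def)

lemma solution_deriv: "solution z \<Longrightarrow> t > 0 \<Longrightarrow> (z i has_real_derivative G i t (\<lambda>k. z k t)) (at t)"
  by (simp add: solution_def)

lemma solution_growth:
  assumes "solution z"
  obtains C where "\<And>c j t. t \<in> {0..T} \<Longrightarrow> \<bar>z (c, j) t\<bar> \<le> C * (1 + \<bar>real_of_int j\<bar>)"
  using assms unfolding solution_def by blast

lemma solution_visc_sub: "solution z \<Longrightarrow> visc_sub G z"
  by (rule classical_imp_visc_sub[OF solution_continuous solution_deriv]) auto

lemma continuous_field_solution:
  assumes "solution z" "S \<subseteq> {0..}" shows "continuous_on S (\<lambda>t. G i t (\<lambda>k. z k t))"
  by (rule continuous_field) (rule continuous_on_subset[OF solution_continuous[OF assms(1)] assms(2)])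

lemma solution_classical_super:
  assumes "solution z" shows "classical_super G z"
  unfolding classical_super_def
  using assms by (intro conjI exI[of _ "\<lambda>i t. G i t (\<lambda>k. z k t)"])
    (auto intro: solution_continuous solution_deriv continuous_field_solution)

lemma solution_growth_diff:
  assumes z: "solution z" and z': "solution z'"
  shows "\<exists>C. \<forall>c j. \<forall>t\<in>{0..T}. z (c, j) t - z' (c, j) t \<le> C * (1 + \<bar>real_of_int j\<bar>)"
proof -
  obtain C where C: "\<And>c j t. t \<in> {0..T} \<Longrightarrow> \<bar>z (c, j) t\<bar> \<le> C * (1 + \<bar>real_of_int j\<bar>)"
    by (rule solution_growth[OF z]) blast
  obtain C' where C': "\<And>c j t. t \<in> {0..T} \<Longrightarrow> \<bar>z' (c, j) t\<bar> \<le> C' * (1 + \<bar>real_of_int j\<bar>)"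
    by (rule solution_growth[OF z']) blast
  have "z (c, j) t - z' (c, j) t \<le> (C + C') * (1 + \<bar>real_of_int j\<bar>)" if "t \<in> {0..T}" for c j t
    using C[OF that, of c j] C'[OF that, of c j] by (simp add: distrib_right)
  then show ?thesis by blast
qed

lemma solution_mono:
  assumes "solution z" "solution z'" "\<And>i. z i 0 \<le> z' i 0" "t \<ge> 0"
  shows "z i t \<le> z' i t"
  by (rule comparison[OF solution_visc_sub solution_classical_super])
    (use assms solution_growth_diff in auto)

text \<open>Finite speed of propagation, up to exponentially small errors.\<close>

lemma solution_le_perturbed:
  assumes z: "solution z" and z': "solution z'" and "b \<ge> 0" "t \<ge> 0"
    and init: "\<And>c j. z (c, j) 0 \<le> z' (c, j) 0 + b * exp \<bar>real_of_int j\<bar>"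
  shows "z (c, j) t \<le> z' (c, j) t + b * exp (rate * t) * exp \<bar>real_of_int j\<bar>"
proof -
  define V where "V = (\<lambda>(c, j) t. z' (c, j) t + b * exp (rate * t) * exp \<bar>real_of_int j\<bar>)"
  have "z (c, j) t \<le> V (c, j) t"
  proof (rule comparison[OF solution_visc_sub[OF z]])
    have "continuous_on {0..} (V i)" for i
      using solution_continuous[OF z', of i] by (cases i) (auto simp: V_def intro!: continuous_intros)
    moreover define V' where "V' = (\<lambda>(c, j) t. G (c, j) t (\<lambda>k. z' k t) + b * (rate * exp (rate * t)) * exp \<bar>real_of_int j\<bar>)"
    have "continuous_on {0<..} (V' i)" for i
    proof -
      have "continuous_on {0<..} (\<lambda>t. G i t (\<lambda>k. z' k t))"
        by (rule continuous_field_solution[OF z']) auto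
      then show ?thesis by (cases i) (auto simp: V'_def intro!: continuous_intros)
    qed
    moreover have "(V i has_real_derivative V' i s) (at s)" if "s > 0" for i s
      using solution_deriv[OF z' that, of i]
      by (cases i) (auto simp: V_def V'_def intro!: derivative_eq_intros)
    moreover have "G i s (\<lambda>k. V k s) \<le> V' i s" if "s > 0" for i s
    proof (cases i)
      case (Pair c j)
      have "(\<lambda>k. V k s) = (\<lambda>(c, k). z' (c, k) s + (b * exp (rate * s)) * exp \<bar>real_of_int k\<bar>)"
        by (auto simp: V_def)
      \<comment> \<open>The perturbation grows at \<open>rate\<close>, whereas by
        \<open>perturb_le\<close> it changes the field by only \<open>rate - 1\<close> times its
        size.\<close>
      moreover have "(rate - 1) * (b * exp (rate * s) * exp \<bar>real_of_int j\<bar>) \<le> rate * (b * exp (rate * s) * exp \<bar>real_of_int j\<bar>)"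
        using \<open>b \<ge> 0\<close> by (intro mult_right_mono) auto
      ultimately show ?thesis
        using perturb_le[of "b * exp (rate * s)" c j s "\<lambda>k. z' k s"] \<open>b \<ge> 0\<close>
        by (simp add: V'_def Pair mult_ac)
    qed
    ultimately show "classical_super G V" unfolding classical_super_def by blast
    fix T
    obtain C where "\<forall>c j. \<forall>t\<in>{0..T}. z (c, j) t - z' (c, j) t \<le> C * (1 + \<bar>real_of_int j\<bar>)"
      using solution_growth_diff[OF z z'] by blast
    moreover have "z' (c, j) t \<le> V (c, j) t" for c j t using \<open>b \<ge> 0\<close> by (simp add: V_def)
    ultimately show "\<exists>C. \<forall>c j. \<forall>t\<in>{0..T}. z (c, j) t - V (c, j) t \<le> C * (1 + \<bar>real_of_int j\<bar>)"
      by (meson diff_left_mono order_trans)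
  next
    show "z i 0 \<le> V i 0" for i using init by (cases i) (auto simp: V_def)
  qed (rule \<open>t \<ge> 0\<close>)
  then show ?thesis by (simp add: V_def)
qed

section \<open>Invariance under integer values, integer times and blocks of \<open>n\<close>
  indices\<close>

lemma value_periodic_int: "G i t (\<lambda>k. z k + real_of_int l) = G i t z"
proof (induction l rule: int_induct[where k = 0])
  case (step1 l)
  then show ?case using value_periodic[of i t "\<lambda>k. z k + real_of_int l"] by (simp add: add.assoc)
next
  case (step2 l)
  then show ?case using value_periodic[of i t "\<lambda>k. z k + real_of_int (l - 1)"] by (simp add: add.assoc)
qed simp

lemma time_periodic_nat: "G i (t + real N) z = G i t z"
proof (induction N)
  case (Suc N)
  then show ?case using time_periodic[of i "t + real N" z] by (simp add: algebra_simps)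
qed simp

lemma type_periodic_nat: "G (c, j + int k * int n) t z = G (c, j) t (\<lambda>(c, l). z (c, l + int k * int n))"
proof (induction k arbitrary: z)
  case (Suc k)
  have "G (c, j + int (Suc k) * int n) t z = G (c, (j + int k * int n) + int n) t z"
    by (simp add: algebra_simps)
  also have "\<dots> = G (c, j) t (\<lambda>(c, l). (\<lambda>(c, l). z (c, l + int n)) (c, l + int k * int n))"
    by (subst type_periodic, subst Suc.IH) simp
  also have "(\<lambda>(c, l). (\<lambda>(c, l). z (c, l + int n)) (c, l + int k * int n)) = (\<lambda>(c, l). z (c, l + int (Suc k) * int n))"
    by (auto simp: algebra_simps)
  finally show ?case .
qed simp

lemma solution_add_int:
  assumes z: "solution z" shows "solution (\<lambda>i t. z i t + real_of_int l)"
  unfolding solution_def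
proof (intro conjI allI impI)
  fix T
  obtain C where C: "\<And>c j t. t \<in> {0..T} \<Longrightarrow> \<bar>z (c, j) t\<bar> \<le> C * (1 + \<bar>real_of_int j\<bar>)"
    by (rule solution_growth[OF z]) blast
  have "\<bar>z (c, j) t + real_of_int l\<bar> \<le> (C + \<bar>real_of_int l\<bar>) * (1 + \<bar>real_of_int j\<bar>)" if "t \<in> {0..T}" for c j t
    using C[OF that, of c j] mult_left_mono[of 1 "1 + \<bar>real_of_int j\<bar>" "\<bar>real_of_int l\<bar>"]
    by (simp add: distrib_right)
  then show "\<exists>C. \<forall>c j. \<forall>t\<in>{0..T}. \<bar>z (c, j) t + real_of_int l\<bar> \<le> C * (1 + \<bar>real_of_int j\<bar>)"
    by blast
next
  fix i and t :: real assume "t > 0"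
  then show "((\<lambda>t. z i t + real_of_int l) has_real_derivative G i t (\<lambda>k. z k t + real_of_int l)) (at t)"
    using solution_deriv[OF z, of t i] by (auto simp: value_periodic_int intro!: derivative_eq_intros)
qed (intro continuous_intros solution_continuous[OF z])

lemma solution_shift_time:
  assumes z: "solution z" shows "solution (\<lambda>i t. z i (real N + t))"
  unfolding solution_def
proof (intro conjI allI impI)
  fix T
  obtain C where C: "\<And>c j t. t \<in> {0..real N + T} \<Longrightarrow> \<bar>z (c, j) t\<bar> \<le> C * (1 + \<bar>real_of_int j\<bar>)"
    by (rule solution_growth[OF z]) blast
  then show "\<exists>C. \<forall>c j. \<forall>t\<in>{0..T}. \<bar>z (c, j) (real N + t)\<bar> \<le> C * (1 + \<bar>real_of_int j\<bar>)"
    by (intro exI[of _ C]) auto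
next
  fix i and t :: real assume "t > 0"
  then have "(z i has_real_derivative G i (real N + t) (\<lambda>k. z k (real N + t))) (at (real N + t))"
    by (intro solution_deriv[OF z]) auto
  then have "((\<lambda>t. z i (real N + t)) has_real_derivative G i (real N + t) (\<lambda>k. z k (real N + t))) (at t)"
    by (simp add: DERIV_shift add.commute)
  then show "((\<lambda>t. z i (real N + t)) has_real_derivative G i t (\<lambda>k. z k (real N + t))) (at t)"
    using time_periodic_nat[of i t N] by (simp add: add.commute)
next
  fix i show "continuous_on {0..} (\<lambda>t. z i (real N + t))"
    by (rule continuous_on_compose2[OF solution_continuous[OF z]]) (auto intro!: continuous_intros)
qed

lemma solution_shift_type:
  assumes z: "solution z" shows "solution (\<lambda>(c, j). z (c, j + int k * int n))"
  unfolding solution_def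
proof (intro conjI allI impI)
  fix T
  obtain C where C: "\<And>c j t. t \<in> {0..T} \<Longrightarrow> \<bar>z (c, j) t\<bar> \<le> C * (1 + \<bar>real_of_int j\<bar>)"
    by (rule solution_growth[OF z]) blast
  have "\<bar>z (c, j + int k * int n) t\<bar> \<le> (\<bar>C\<bar> * (1 + real k * real n)) * (1 + \<bar>real_of_int j\<bar>)" if "t \<in> {0..T}" for c j t
  proof -
    have "\<bar>z (c, j + int k * int n) t\<bar> \<le> \<bar>C\<bar> * (1 + \<bar>real_of_int (j + int k * int n)\<bar>)"
      by (rule order_trans[OF C[OF that]]) (intro mult_right_mono, auto)
    also have "1 + \<bar>real_of_int (j + int k * int n)\<bar> \<le> 1 + (\<bar>real_of_int j\<bar> + real k * real n)"
      using abs_triangle_ineq[of "real_of_int j" "real k * real n"] by simp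
    also have "\<dots> \<le> (1 + real k * real n) * (1 + \<bar>real_of_int j\<bar>)" by (simp add: algebra_simps)
    finally show ?thesis by (simp add: mult_left_mono mult.assoc)
  qed
  then show "\<exists>C. \<forall>c j. \<forall>t\<in>{0..T}. \<bar>(case (c, j) of (c, j) \<Rightarrow> z (c, j + int k * int n)) t\<bar> \<le> C * (1 + \<bar>real_of_int j\<bar>)"
    by (simp del: atLeastAtMost_iff) blast
next
  fix i :: site and t :: real assume "t > 0"
  obtain c j where i: "i = (c, j)" by (cases i)
  have "(\<lambda>l. (case l of (c, j) \<Rightarrow> z (c, j + int k * int n)) t) = (\<lambda>(c, l). z (c, l + int k * int n) t)" by auto
  then show "((case i of (c, j) \<Rightarrow> z (c, j + int k * int n)) has_real_derivative
      G i t (\<lambda>l. (case l of (c, j) \<Rightarrow> z (c, j + int k * int n)) t)) (at t)"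
    using solution_deriv[OF z \<open>t > 0\<close>, of "(c, j + int k * int n)"] by (simp add: i type_periodic_nat)
qed (auto split: prod.splits intro: solution_continuous[OF z])

end

text \<open>In the norm weighted by \<open>exp (- \<Lambda> * t)\<close> an integration gains the
  factor \<open>1 / \<Lambda>\<close>; this is the source of the contraction in the construction of
  solutions.\<close>

lemma integral_exp_bound:
  fixes g :: "real \<Rightarrow> real"
  assumes g: "continuous_on {0..} g" and le: "\<And>s. 0 \<le> s \<Longrightarrow> s \<le> t \<Longrightarrow> \<bar>g s\<bar> \<le> D * exp (\<Lambda> * s)"
    and "\<Lambda> > 0" "t \<ge> 0" "D \<ge> 0"
  shows "\<bar>integral {0..t} g\<bar> \<le> D * exp (\<Lambda> * t) / \<Lambda>"
proof -
  have *: "((\<lambda>s. D * exp (\<Lambda> * s)) has_integral D * exp (\<Lambda> * t) / \<Lambda> - D * exp (\<Lambda> * 0) / \<Lambda>) {0..t}"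
    by (rule fundamental_theorem_of_calculus)
      (use assms in \<open>auto intro!: derivative_eq_intros simp flip: has_real_derivative_iff_has_vector_derivative\<close>)
  have "g integrable_on {0..t}"
    by (rule integrable_continuous_real[OF continuous_on_subset[OF g]]) auto
  then have "norm (integral {0..t} g) \<le> integral {0..t} (\<lambda>s. D * exp (\<Lambda> * s))"
    by (rule integral_norm_bound_integral) (use * le in \<open>auto simp: has_integral_integrable\<close>)
  also have "\<dots> = D * exp (\<Lambda> * t) / \<Lambda> - D / \<Lambda>" using integral_unique[OF *] by simp
  also have "\<dots> \<le> D * exp (\<Lambda> * t) / \<Lambda>" using assms by simp
  finally show ?thesis by simp
qed

lemma integral_from_0:
  fixes g :: "real \<Rightarrow> real"
  assumes g: "continuous_on {0..} g"
  shows "continuous_on {0..} (\<lambda>x. integral {0..x} g)"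
    and "t > 0 \<Longrightarrow> ((\<lambda>x. integral {0..x} g) has_real_derivative g t) (at t)"
proof -
  have D: "((\<lambda>x. integral {0..x} g) has_real_derivative g t) (at t within {0..b})" if "0 \<le> t" "t \<le> b" for t b
    by (rule integral_has_real_derivative[OF continuous_on_subset[OF g]]) (use that in auto)
  show "continuous_on {0..} (\<lambda>x. integral {0..x} g)"
    unfolding continuous_on_eq_continuous_within
  proof
    fix t :: real assume t: "t \<in> {0..}"
    have "continuous (at t within {0..t+1}) (\<lambda>x. integral {0..x} g)"
      by (rule DERIV_continuous[OF D]) (use t in auto)
    moreover have "at t within {0..t+1} = at t within {0..}"
      using t by (intro at_within_nhd[of t "{..<t+1}"]) auto
    ultimately show "continuous (at t within {0..}) (\<lambda>x. integral {0..x} g)" by simp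
  qed
  show "((\<lambda>x. integral {0..x} g) has_real_derivative g t) (at t)" if "t > 0"
    using D[of t "t + 1"] that at_within_Icc_at[of 0 t "t + 1"] by simp
qed

lemma continuous_on_prod_discrete:
  fixes f :: "'a::topological_space \<times> 'b::topological_space \<Rightarrow> 'c::topological_space"
  assumes discrete: "\<And>i::'b. open {i}" and cont: "\<And>i. continuous_on UNIV (\<lambda>t. f (t, i))"
  shows "continuous_on UNIV f"
proof -
  have "continuous_on (\<Union>i. UNIV \<times> {i}) f"
  proof (rule continuous_on_open_UN)
    show "open (UNIV \<times> {i})" for i :: 'b by (intro open_Times open_UNIV discrete)
    show "continuous_on (UNIV \<times> {i}) f" for i :: 'b
    proof (rule continuous_on_eq)
      show "continuous_on (UNIV \<times> {i}) (\<lambda>p. f (fst p, i))"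
        by (rule continuous_on_compose2[OF cont]) (auto intro!: continuous_intros)
    qed auto
  qed
  moreover have "(\<Union>i::'b. UNIV \<times> {i}) = (UNIV :: ('a \<times> 'b) set)" by auto
  ultimately show ?thesis by simp
qed

text \<open>The product \<open>exp (\<alpha> * s) * (D s - B / \<alpha>)\<close> does not increase.
  Hence \<open>D\<close> exceeds the equilibrium value \<open>B / \<alpha>\<close> by no more than
  it did at time 0.\<close>

lemma relaxation_bound:
  fixes D g :: "real \<Rightarrow> real"
  assumes cont: "continuous_on {0..} D" and "\<alpha> > 0"
    and D: "\<And>s. s > 0 \<Longrightarrow> (D has_real_derivative g s - \<alpha> * D s) (at s)"
    and g: "\<And>s. s > 0 \<Longrightarrow> g s \<le> B" and "t \<ge> 0" "B \<ge> 0"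
  shows "D t \<le> max (D 0) 0 + B / \<alpha>"
proof -
  define E where "E s = - exp (\<alpha> * s) * (D s - B / \<alpha>)" for s
  have "E 0 \<le> E t"
  proof (rule DERIV_nonneg_imp_increasing_open[OF \<open>t \<ge> 0\<close>])
    fix s assume s: "0 < s" "s < t"
    have "(E has_real_derivative exp (\<alpha> * s) * (B - g s)) (at s)"
      unfolding E_def using \<open>\<alpha> > 0\<close> by (auto intro!: derivative_eq_intros D[OF s(1)] simp: algebra_simps)
    then show "\<exists>y. (E has_real_derivative y) (at s) \<and> 0 \<le> y" using g[OF s(1)] by auto
  next
    have "continuous_on {0..t} D" by (rule continuous_on_subset[OF cont]) auto
    then show "continuous_on {0..t} E" unfolding E_def by (intro continuous_intros)
  qed
  then have *: "exp (\<alpha> * t) * (D t - B / \<alpha>) \<le> D 0 - B / \<alpha>" by (simp add: E_def)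
  have "B / \<alpha> \<ge> 0" using assms by simp
  have e: "1 \<le> exp (\<alpha> * t)" using assms by simp
  show ?thesis
  proof (cases "D t \<le> B / \<alpha>")
    case True then show ?thesis by simp
  next
    case False
    then have "1 * (D t - B / \<alpha>) \<le> exp (\<alpha> * t) * (D t - B / \<alpha>)"
      using e by (intro mult_right_mono) auto
    with * \<open>B / \<alpha> \<ge> 0\<close> show ?thesis by (simp add: max_def)
  qed
qed

definition increasing :: "(site \<Rightarrow> real) \<Rightarrow> bool" where
  "increasing z \<longleftrightarrow> (\<forall>c j. z (c, j) \<le> z (c, j + 1))"

text \<open>Only differences are bounded, so the notion survives translations. The kinds of the two
  sites are arbitrary: for \<open>j = k\<close> the bound controls the distance of the two particles
  with the same index.\<close>

definition spread :: "real \<Rightarrow> (site \<Rightarrow> real) \<Rightarrow> bool" where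
  "spread K z \<longleftrightarrow> (\<forall>c j c' k. \<bar>z (c, j) - z (c', k)\<bar> \<le> K * (1 + \<bar>real_of_int (j - k)\<bar>))"

lemma spreadD: "spread K z \<Longrightarrow> \<bar>z (c, j) - z (c', k)\<bar> \<le> K * (1 + \<bar>real_of_int (j - k)\<bar>)"
  unfolding spread_def by blast

lemma increasingD:
  assumes "increasing z" "j \<le> k" shows "z (c, j) \<le> z (c, k)"
  using \<open>j \<le> k\<close>
proof (induction k rule: int_ge_induct)
  case (step k)
  then show ?case using assms(1) unfolding increasing_def by (meson order_trans)
qed simp

section \<open>Preservation of the order of the particles\<close>

context ordered_lattice
begin

text \<open>
  The perturbation \<open>\<theta>(t) (e\<^sup>j - e\<^bsup>-j\<^esup>)\<close> is increasing in \<open>j\<close>, with increments comparable to its size.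
\<close>

theorem solution_increasing:
  assumes z: "solution z" and "increasing (\<lambda>i. z i 0)" "t \<ge> 0"
  shows "increasing (\<lambda>i. z i t)"
  unfolding increasing_def
proof (intro allI)
  fix c\<^sub>0 j\<^sub>0
  define \<sigma> :: "int \<Rightarrow> real" where "\<sigma> j = exp (real_of_int j) - exp (- real_of_int j)" for j
  define \<rho> :: "site \<Rightarrow> real" where "\<rho> = (\<lambda>(c, j). \<sigma> (j + 1) - \<sigma> j)"
  define w :: "site \<Rightarrow> real \<Rightarrow> real" where "w = (\<lambda>(c, j) t. z (c, j) t - z (c, j + 1) t)"
  \<comment> \<open>The weight equals
    \<open>exp j * (exp 1 - 1) + exp (- j) * (1 - exp (- 1))\<close>. Here \<open>a\<close> is the
    smaller of the two coefficients, so it serves for both signs of \<open>j\<close>.\<close>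
  define a :: real where "a = 1 - exp (-1)"
  have "a > 0" by (simp add: a_def)
  have \<rho>_ge: "\<rho> (c, j) \<ge> a * exp \<bar>real_of_int j\<bar>" for c j
  proof -
    have "\<rho> (c, j) = exp (real_of_int j) * (exp 1 - 1) + exp (- real_of_int j) * a"
      by (simp add: \<rho>_def \<sigma>_def a_def exp_add exp_diff exp_minus field_simps)
    moreover have "a \<le> exp 1 - 1"
      using exp_ge_add_one_self[of 1] exp_gt_zero[of "-1::real"] unfolding a_def by linarith
    then have "exp (real_of_int j) * a \<le> exp (real_of_int j) * (exp 1 - 1)" by simp
    moreover have "0 \<le> exp (real_of_int j) * a" "0 \<le> exp (- real_of_int j) * a"
      using \<open>a > 0\<close> by auto
    ultimately have "\<rho> (c, j) \<ge> a * exp (real_of_int j)" "\<rho> (c, j) \<ge> a * exp (- real_of_int j)"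
      unfolding mult.commute[of a] by linarith+
    then show ?thesis by (cases "j \<ge> 0") simp_all
  qed
  have \<rho>_pos: "\<rho> (c, j) > 0" for c j
    by (rule less_le_trans[OF _ \<rho>_ge]) (use \<open>a > 0\<close> in simp)
  have \<sigma>_le: "\<bar>\<sigma> j\<bar> \<le> exp \<bar>real_of_int j\<bar>" for j
  proof (cases "j \<ge> 0")
    case True
    then have "exp (- real_of_int j) \<le> exp (real_of_int j)" by simp
    then show ?thesis using True exp_gt_zero[of "- real_of_int j"] unfolding \<sigma>_def by simp
  next
    case False
    then have "exp (real_of_int j) \<le> exp (- real_of_int j)" by simp
    then show ?thesis using False exp_gt_zero[of "real_of_int j"] unfolding \<sigma>_def by simp
  qed
  \<comment> \<open>The perturbed and the unperturbed field are compared at \<open>j\<close> and at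
    \<open>j + 1\<close>, whence \<open>1 + exp 1\<close>; \<open>exp m\<close> accounts for the
    neighbours, division by \<open>a\<close> expresses the error through \<open>\<rho>\<close>, and
    the last 1 gives strictness.\<close>
  define \<Lambda> where "\<Lambda> = Lg * exp m * (1 + exp 1) / a + 1"
  have "\<Lambda> \<ge> 0" using Lg_nonneg \<open>a > 0\<close> by (simp add: \<Lambda>_def)
  have "w (c\<^sub>0, j\<^sub>0) t \<le> 0"
  proof (rule maximum_principle[where w = w and \<rho> = \<rho> and \<Lambda> = \<Lambda>])
    fix i show "usc_on {0..} (w i)"
      by (rule continuous_on_imp_usc_on)
        (cases i, auto simp: w_def intro!: continuous_intros solution_continuous[OF z])
    show "w i 0 \<le> 0" using assms(2) by (cases i) (auto simp: w_def increasing_def)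
    show "\<rho> i > 0" using \<rho>_pos by (cases i) simp
  next
    fix T \<delta> :: real assume "\<delta> > 0"
    obtain C where C: "\<And>c j t. t \<in> {0..T} \<Longrightarrow> \<bar>z (c, j) t\<bar> \<le> C * (1 + \<bar>real_of_int j\<bar>)"
      by (rule solution_growth[OF z]) blast
    have bound: "w (c, j) s \<le> (3 * \<bar>C\<bar>) * (1 + \<bar>real_of_int j\<bar>)" if "s \<in> {0..T}" for c j s
    proof -
      have "w (c, j) s \<le> C * (1 + \<bar>real_of_int j\<bar>) + C * (1 + \<bar>real_of_int (j + 1)\<bar>)"
        using C[OF that, of c j] C[OF that, of c "j + 1"] by (simp add: w_def)
      also have "\<dots> \<le> \<bar>C\<bar> * (1 + \<bar>real_of_int j\<bar>) + \<bar>C\<bar> * (1 + \<bar>real_of_int (j + 1)\<bar>)"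
        by (intro add_mono mult_right_mono) auto
      also have "\<dots> \<le> \<bar>C\<bar> * (1 + \<bar>real_of_int j\<bar>) + \<bar>C\<bar> * (2 * (1 + \<bar>real_of_int j\<bar>))"
        by (intro add_left_mono mult_left_mono) auto
      finally show ?thesis by (simp add: algebra_simps)
    qed
    show "finite {i. \<exists>t\<in>{0..T}. w i t > \<delta> * \<rho> i}"
      by (rule finite_sites_exceeding_exp[OF bound \<open>\<delta> > 0\<close> \<open>a > 0\<close> \<rho>_ge])
  next
    fix i t \<theta> \<theta>'
    assume t: "t > 0" and \<theta>: "\<And>s. s > 0 \<Longrightarrow> (\<theta> has_real_derivative \<theta>' s) (at s)"
      "continuous_on {0<..} \<theta>'" "\<And>s. s > 0 \<Longrightarrow> \<Lambda> * \<theta> s \<le> \<theta>' s" "\<And>s. \<theta> s > 0"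
      and ev: "\<forall>\<^sub>F s in nhds t. \<forall>k. w k s \<le> \<theta> s * \<rho> k"
      and eq: "w i t = \<theta> t * \<rho> i"
    obtain c j where i: "i = (c, j)" by (cases i)
    \<comment> \<open>The perturbed state is nondecreasing in the index, and at the touching site
      its particles \<open>j\<close> and \<open>j + 1\<close> coincide: exactly the situation of
      \<open>order\<close>.\<close>
    define y where "y = (\<lambda>(c, k). z (c, k) t + \<theta> t * \<sigma> k)"
    have y_diff: "y (c, k) - y (c, k + 1) = w (c, k) t - \<theta> t * \<rho> (c, k)" for c k
      by (simp add: y_def w_def \<rho>_def algebra_simps)
    have order_y: "G (c, j) t y \<le> G (c, j + 1) t y"
    proof (rule order)
      have touch: "w (c, k) t \<le> \<theta> t * \<rho> (c, k)" for c k using eventually_nhds_x_imp_x[OF ev] by blast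
      show "y (c, k) \<le> y (c, k + 1)" for c k
        using y_diff[of c k] touch[of c k] by linarith
      show "y (c, j) = y (c, j + 1)" using y_diff[of c j] eq i by simp
    qed
    have y_z: "\<bar>G (c, l) t y - G (c, l) t (\<lambda>k. z k t)\<bar> \<le> Lg * (\<theta> t * (exp m * exp \<bar>real_of_int l\<bar>))" for l
    proof (rule lip)
      fix c' k assume "\<bar>k - l\<bar> \<le> int m"
      then have "\<bar>\<sigma> k\<bar> \<le> exp m * exp \<bar>real_of_int l\<bar>"
        by (rule order_trans[OF \<sigma>_le exp_neighbour_le])
      then show "\<bar>y (c', k) - z (c', k) t\<bar> \<le> \<theta> t * (exp m * exp \<bar>real_of_int l\<bar>)"
        using \<theta>(4)[of t] by (simp add: y_def abs_mult)
    qed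
    define E where "E = Lg * \<theta> t * exp m * exp \<bar>real_of_int j\<bar>"
    have "Lg * (\<theta> t * (exp m * exp \<bar>real_of_int (j + 1)\<bar>)) \<le> Lg * (\<theta> t * (exp m * exp (1 + \<bar>real_of_int j\<bar>)))"
      using Lg_nonneg \<theta>(4)[of t] by (intro mult_left_mono) auto
    also have "\<dots> = E * exp 1" by (simp add: E_def exp_add mult_ac)
    finally have y_z1: "\<bar>G (c, j + 1) t y - G (c, j + 1) t (\<lambda>k. z k t)\<bar> \<le> E * exp 1"
      using y_z[of "j + 1"] by linarith
    have y_z0: "\<bar>G (c, j) t y - G (c, j) t (\<lambda>k. z k t)\<bar> \<le> E" using y_z[of j] by (simp add: E_def mult_ac)
    have "G (c, j) t (\<lambda>k. z k t) - G (c, j + 1) t (\<lambda>k. z k t) \<le> E + E * exp 1"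
      using order_y y_z0 y_z1 by linarith
    also have "\<dots> = \<theta> t * (Lg * exp m * (1 + exp 1) / a) * (a * exp \<bar>real_of_int j\<bar>)"
      using \<open>a > 0\<close> by (simp add: E_def field_simps)
    also have "\<dots> \<le> \<theta> t * (\<Lambda> - 1) * \<rho> (c, j)"
      using \<rho>_ge \<open>a > 0\<close> \<theta>(4)[of t] Lg_nonneg by (intro mult_mono) (auto simp: \<Lambda>_def)
    finally have upper: "G (c, j) t (\<lambda>k. z k t) - G (c, j + 1) t (\<lambda>k. z k t) \<le> (\<Lambda> * \<theta> t - \<theta> t) * \<rho> i"
      by (simp add: i algebra_simps)
    obtain d where d: "d > 0" "\<And>s. dist s t < d \<Longrightarrow> \<forall>k. w k s \<le> \<theta> s * \<rho> k"
      using ev unfolding eventually_nhds_metric by blast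
    have "G (c, j) t (\<lambda>k. z k t) - G (c, j + 1) t (\<lambda>k. z k t) - \<theta>' t * \<rho> i = 0"
    proof (rule DERIV_local_max[where d = d and f = "\<lambda>s. w i s - \<theta> s * \<rho> i"])
      show "((\<lambda>s. w i s - \<theta> s * \<rho> i) has_real_derivative
          G (c, j) t (\<lambda>k. z k t) - G (c, j + 1) t (\<lambda>k. z k t) - \<theta>' t * \<rho> i) (at t)"
        unfolding w_def i prod.case
        by (intro DERIV_diff DERIV_cmult_right solution_deriv[OF z] \<theta>(1) t)
    qed (use d eq in \<open>auto simp: dist_real_def\<close>)
    with upper have "\<theta>' t * \<rho> i \<le> (\<Lambda> * \<theta> t - \<theta> t) * \<rho> i" by simp
    moreover have "\<rho> i > 0" using \<rho>_pos by (simp add: i)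
    ultimately have "\<theta>' t \<le> \<Lambda> * \<theta> t - \<theta> t" by simp
    with \<theta>(3)[OF t] \<theta>(4)[of t] show False by simp
  qed (use \<open>\<Lambda> \<ge> 0\<close> \<open>t \<ge> 0\<close> in auto)
  then show "z (c\<^sub>0, j\<^sub>0) t \<le> z (c\<^sub>0, j\<^sub>0 + 1) t" by (simp add: w_def)
qed

end

text \<open>
  The contraction principle is applied in a space of bounded continuous functions on
  \<open>real \<times> int\<close>, the lattice sites being enumerated by the integers.
\<close>

instantiation int :: metric_space
begin

definition dist_int :: "int \<Rightarrow> int \<Rightarrow> real" where
  "dist_int k l = \<bar>real_of_int (k - l)\<bar>"

definition uniformity_int :: "(int \<times> int) filter" where
  "uniformity_int = (INF e\<in>{0<..}. principal {(k, l). dist k l < e})"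

instance
proof
  fix U :: "int set"
  have eq: "l = k" if "dist k l < (1::real)" for k l :: int using that unfolding dist_int_def by linarith
  have "\<forall>\<^sub>F (k', l) in uniformity. k' = k \<longrightarrow> l \<in> U" if "k \<in> U" for k
  proof -
    have "\<forall>\<^sub>F p in principal {(k, l). dist k l < (1::real)}. case p of (k', l) \<Rightarrow> k' = k \<longrightarrow> l \<in> U"
      using that eq by (auto simp: eventually_principal)
    moreover have "uniformity \<le> principal {(k::int, l). dist k l < (1::real)}"
      unfolding uniformity_int_def by (rule INF_lower) simp
    ultimately show ?thesis by (rule filter_leD[rotated])
  qed
  then show "open U \<longleftrightarrow> (\<forall>k\<in>U. \<forall>\<^sub>F (k', l) in uniformity. k' = k \<longrightarrow> l \<in> U)"
    by (simp add: open_discrete)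
qed (auto simp: dist_int_def uniformity_int_def)

end

section \<open>Construction of solutions by a contraction\<close>

context ordered_lattice
begin

text \<open>The unknown \<open>Y\<close> is the displacement from the initial state divided by
  \<open>exp (\<Lambda> * t)\<close>. It is bounded because the field is bounded at the initial
  state and Lipschitz, although the state itself grows with the index. With
  \<open>\<Lambda> = 2 * Lg + 1\<close> the contraction factor \<open>Lg / \<Lambda>\<close> is
  below 1/2.\<close>

lemma solution_exists:
  fixes a :: "site \<Rightarrow> real"
  assumes B: "\<And>i t. t \<ge> 0 \<Longrightarrow> \<bar>G i t a\<bar> \<le> B"
    and growth: "\<And>c j. \<bar>a (c, j)\<bar> \<le> C * (1 + \<bar>real_of_int j\<bar>)"
  obtains z where "solution z" "\<And>i. z i 0 = a i"
proof -
  define \<Lambda> where "\<Lambda> = 2 * Lg + 1"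
  have "\<Lambda> > 0" using Lg_nonneg by (simp add: \<Lambda>_def)
  have "B \<ge> 0" using B[of 0 undefined] by simp
  define enc :: "site \<Rightarrow> int" where "enc = (\<lambda>(c, j). 2 * j + of_bool c)"
  define dec :: "int \<Rightarrow> site" where "dec l = (odd l, l div 2)" for l
  have dec_enc: "dec (enc k) = k" for k by (cases k) (simp add: enc_def dec_def)
  define st where "st Y s k = a k + exp (\<Lambda> * s) * apply_bcontfun Y (s, enc k)"
    for Y :: "(real \<times> int) \<Rightarrow>\<^sub>C real" and s k
  define g where "g Y i s = G i s (st Y s)" for Y i s
  \<comment> \<open>Bounded continuous functions live on the whole line; \<open>max 0 t\<close>
    extends the integral operator by 0 to negative times.\<close>
  define \<Phi>\<^sub>0 where "\<Phi>\<^sub>0 Y = (\<lambda>(t, l). exp (- \<Lambda> * max 0 t) * integral {0..max 0 t} (g Y (dec l)))" for Y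
  have exp_cancel: "exp (- \<Lambda> * x) * (D * exp (\<Lambda> * x) / \<Lambda>) = D / \<Lambda>" for x D
    using exp_not_eq_zero[of "\<Lambda> * x"] by (simp add: exp_minus)
  have slice: "continuous_on S (\<lambda>s. apply_bcontfun Y (s, k))" for S Y and k :: int
    by (rule continuous_on_compose2[OF continuous_on_apply_bcontfun]) (auto intro!: continuous_intros)
  have g_cont: "continuous_on S (g Y i)" for S Y i
    unfolding g_def st_def by (rule continuous_field) (intro continuous_intros slice)
  have Lip_g: "\<bar>g Y i s - g Y' i s\<bar> \<le> (Lg * dist Y Y') * exp (\<Lambda> * s)" for Y Y' i s
  proof (cases i)
    case (Pair c j)
    have "\<bar>G (c, j) s (st Y s) - G (c, j) s (st Y' s)\<bar> \<le> Lg * (exp (\<Lambda> * s) * dist Y Y')"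
    proof (rule lip)
      fix c' k
      have "\<bar>st Y s (c', k) - st Y' s (c', k)\<bar> = exp (\<Lambda> * s) * dist (apply_bcontfun Y (s, enc (c', k))) (apply_bcontfun Y' (s, enc (c', k)))"
        by (simp add: st_def dist_real_def abs_mult flip: right_diff_distrib)
      also have "\<dots> \<le> exp (\<Lambda> * s) * dist Y Y'" by (intro mult_left_mono dist_bounded) auto
      finally show "\<bar>st Y s (c', k) - st Y' s (c', k)\<bar> \<le> exp (\<Lambda> * s) * dist Y Y'" .
    qed
    then show ?thesis by (simp add: g_def Pair mult_ac)
  qed
  have \<Phi>\<^sub>0_bound: "\<bar>\<Phi>\<^sub>0 Y (t, l)\<bar> \<le> (B + Lg * norm Y) / \<Lambda>" for Y t l
  proof -
    have "\<bar>integral {0..max 0 t} (g Y (dec l))\<bar> \<le> (B + Lg * norm Y) * exp (\<Lambda> * max 0 t) / \<Lambda>"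
    proof (rule integral_exp_bound[OF g_cont])
      fix s :: real assume s: "0 \<le> s" "s \<le> max 0 t"
      have "st 0 s = a" by (simp add: st_def fun_eq_iff)
      then have "g 0 (dec l) s = G (dec l) s a" by (simp add: g_def)
      then have "\<bar>g Y (dec l) s\<bar> \<le> B + (Lg * norm Y) * exp (\<Lambda> * s)"
        using Lip_g[of Y "dec l" s 0] B[OF s(1), of "dec l"] by (simp add: dist_norm)
      also have "\<dots> \<le> B * exp (\<Lambda> * s) + (Lg * norm Y) * exp (\<Lambda> * s)"
        using s \<open>\<Lambda> > 0\<close> \<open>B \<ge> 0\<close> by (simp add: mult_le_cancel_left1)
      finally show "\<bar>g Y (dec l) s\<bar> \<le> (B + Lg * norm Y) * exp (\<Lambda> * s)" by (simp add: distrib_right)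
    qed (use \<open>\<Lambda> > 0\<close> \<open>B \<ge> 0\<close> Lg_nonneg in auto)
    then have "\<bar>\<Phi>\<^sub>0 Y (t, l)\<bar> \<le> exp (- \<Lambda> * max 0 t) * ((B + Lg * norm Y) * exp (\<Lambda> * max 0 t) / \<Lambda>)"
      unfolding \<Phi>\<^sub>0_def by (simp only: prod.case abs_mult abs_exp_cancel) (rule mult_left_mono, auto)
    also have "\<dots> = (B + Lg * norm Y) / \<Lambda>" by (rule exp_cancel)
    finally show ?thesis .
  qed
  have in_bcontfun: "\<Phi>\<^sub>0 Y \<in> bcontfun" for Y
  proof (rule bcontfun_normI)
    show "norm (\<Phi>\<^sub>0 Y p) \<le> (B + Lg * norm Y) / \<Lambda>" for p using \<Phi>\<^sub>0_bound by (cases p) auto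
    show "continuous_on UNIV (\<Phi>\<^sub>0 Y)"
    proof (rule continuous_on_prod_discrete)
      show "open {l}" for l :: int by (rule open_discrete)
      fix l :: int
      have "continuous_on UNIV (\<lambda>t. integral {0..max 0 t} (g Y (dec l)))"
        by (rule continuous_on_compose2[OF integral_from_0(1)[OF g_cont]]) (auto intro!: continuous_intros)
      then show "continuous_on UNIV (\<lambda>t. \<Phi>\<^sub>0 Y (t, l))"
        unfolding \<Phi>\<^sub>0_def prod.case by (intro continuous_intros)
    qed
  qed
  define \<Phi> where "\<Phi> Y = Bcontfun (\<Phi>\<^sub>0 Y)" for Y
  have \<Phi>: "apply_bcontfun (\<Phi> Y) = \<Phi>\<^sub>0 Y" for Y
    unfolding \<Phi>_def by (rule Bcontfun_inverse[OF in_bcontfun])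
  have "dist (\<Phi> Y) (\<Phi> Y') \<le> (1/2) * dist Y Y'" for Y Y'
  proof (rule dist_bound)
    fix p :: "real \<times> int"
    obtain t l where p: "p = (t, l)" by (cases p)
    have "integral {0..max 0 t} (g Y (dec l)) - integral {0..max 0 t} (g Y' (dec l))
        = integral {0..max 0 t} (\<lambda>s. g Y (dec l) s - g Y' (dec l) s)"
      by (rule integral_diff[symmetric]; rule integrable_continuous_real[OF g_cont])
    moreover have "\<bar>integral {0..max 0 t} (\<lambda>s. g Y (dec l) s - g Y' (dec l) s)\<bar> \<le> (Lg * dist Y Y') * exp (\<Lambda> * max 0 t) / \<Lambda>"
      by (rule integral_exp_bound)
        (use \<open>\<Lambda> > 0\<close> Lg_nonneg Lip_g in \<open>auto intro!: continuous_intros g_cont\<close>)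
    ultimately have "\<bar>\<Phi>\<^sub>0 Y p - \<Phi>\<^sub>0 Y' p\<bar> \<le> exp (- \<Lambda> * max 0 t) * ((Lg * dist Y Y') * exp (\<Lambda> * max 0 t) / \<Lambda>)"
      unfolding \<Phi>\<^sub>0_def p
      by (simp only: prod.case right_diff_distrib[symmetric] abs_mult abs_exp_cancel) (rule mult_left_mono, auto)
    also have "\<dots> = (Lg * dist Y Y') / \<Lambda>" by (rule exp_cancel)
    also have "\<dots> \<le> (1/2) * dist Y Y'"
      using Lg_nonneg \<open>\<Lambda> > 0\<close> zero_le_dist[of Y Y'] by (simp add: \<Lambda>_def field_simps)
    finally show "dist (apply_bcontfun (\<Phi> Y) p) (apply_bcontfun (\<Phi> Y') p) \<le> (1/2) * dist Y Y'"
      by (simp add: \<Phi> dist_real_def)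
  qed
  then obtain Y where Y: "\<Phi> Y = Y"
    using banach_fix_type[of "1/2" \<Phi>] by auto
  define z where "z i t = a i + integral {0..max 0 t} (g Y i)" for i t
  have st_z: "st Y t = (\<lambda>k. z k t)" if "t \<ge> 0" for t
  proof
    fix k
    have "apply_bcontfun Y (t, enc k) = \<Phi>\<^sub>0 Y (t, enc k)" using Y \<Phi> by metis
    then show "st Y t k = z k t" using that by (simp add: st_def z_def \<Phi>\<^sub>0_def dec_enc exp_minus)
  qed
  have z_growth: "\<bar>z (c, j) t\<bar> \<le> (C + exp (\<Lambda> * T) * norm Y) * (1 + \<bar>real_of_int j\<bar>)" if "t \<in> {0..T}" for T c j t
  proof -
    have "\<bar>z (c, j) t\<bar> \<le> \<bar>a (c, j)\<bar> + \<bar>exp (\<Lambda> * t) * apply_bcontfun Y (t, enc (c, j))\<bar>"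
      using fun_cong[OF st_z[of t], of "(c, j)"] that abs_triangle_ineq by (simp add: st_def)
    also have "\<dots> \<le> C * (1 + \<bar>real_of_int j\<bar>) + exp (\<Lambda> * T) * norm Y"
      unfolding abs_mult
      using growth[of c j] that \<open>\<Lambda> > 0\<close> norm_bounded[of Y "(t, enc (c, j))"] by (intro add_mono mult_mono) auto
    also have "\<dots> \<le> C * (1 + \<bar>real_of_int j\<bar>) + (exp (\<Lambda> * T) * norm Y) * (1 + \<bar>real_of_int j\<bar>)"
      using mult_left_mono[of 1 "1 + \<bar>real_of_int j\<bar>" "exp (\<Lambda> * T) * norm Y"] by simp
    finally show ?thesis by (simp add: distrib_right)
  qed
  have "solution z"
    unfolding solution_def
  proof (intro conjI allI impI)
    show "continuous_on {0..} (z i)" for i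
      unfolding z_def
      by (intro continuous_intros continuous_on_compose2[OF integral_from_0(1)[OF g_cont]]) auto
    show "(z i has_real_derivative G i t (\<lambda>k. z k t)) (at t)" if "t > 0" for i t
    proof (rule has_field_derivative_transform_within_open[where S = "{0<..}"])
      have "((\<lambda>x. integral {0..x} (g Y i)) has_real_derivative g Y i t) (at t)"
        by (rule integral_from_0(2)[OF g_cont that])
      then show "((\<lambda>x. a i + integral {0..x} (g Y i)) has_real_derivative G i t (\<lambda>k. z k t)) (at t)"
        using st_z[of t] that by (auto simp: g_def intro!: derivative_eq_intros)
    qed (use that in \<open>auto simp: z_def\<close>)
    show "\<exists>C. \<forall>c j. \<forall>t\<in>{0..T}. \<bar>z (c, j) t\<bar> \<le> C * (1 + \<bar>real_of_int j\<bar>)" for T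
      using z_growth by blast
  qed
  moreover have "z i 0 = a i" for i by (simp add: z_def)
  ultimately show thesis using that by blast
qed

section \<open>Uniform bounds of the field\<close>

lemma type_periodic_const: "G (c, j + l * int n) t (\<lambda>_. s) = G (c, j) t (\<lambda>_. s)"
proof (induction l rule: int_induct[where k = 0])
  case (step1 l)
  have "G (c, j + (l + 1) * int n) t (\<lambda>_. s) = G (c, (j + l * int n) + int n) t (\<lambda>_. s)"
    by (simp add: algebra_simps)
  then show ?case using step1 by (simp add: type_periodic case_prod_unfold)
next
  case (step2 l)
  have "G (c, j + l * int n) t (\<lambda>_. s) = G (c, (j + (l - 1) * int n) + int n) t (\<lambda>_. s)"
    by (simp add: algebra_simps)
  then show ?case using step2 by (simp add: type_periodic case_prod_unfold)
qed simp

text \<open>At a constant state, periodicity in time and in the index leaves one period of time and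
  the sites of one block, where compactness applies.\<close>

lemma field_bounded_zero: "\<exists>B. \<forall>i. \<forall>t\<ge>0. \<bar>G i t (\<lambda>_. 0)\<bar> \<le> B"
proof -
  have "\<exists>b. \<forall>t\<in>{0..1}. \<bar>G i t (\<lambda>_. 0)\<bar> \<le> b" for i
  proof -
    have "continuous_on {0..1} (\<lambda>t. G i t (\<lambda>_. 0))" by (rule continuous_field) simp
    then have "compact ((\<lambda>t. G i t (\<lambda>_. 0)) ` {0..1})" by (rule compact_continuous_image) simp
    then have "bounded ((\<lambda>t. G i t (\<lambda>_. 0)) ` {0..1})" by (rule compact_imp_bounded)
    then show ?thesis unfolding bounded_iff by auto
  qed
  then obtain b where b: "\<And>i t. t \<in> {0..1} \<Longrightarrow> \<bar>G i t (\<lambda>_. 0)\<bar> \<le> b i" by metis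
  define I where "I = (UNIV :: bool set) \<times> {0..<int n}"
  have "finite I" by (simp add: I_def)
  have "\<bar>G (c, j) t (\<lambda>_. 0)\<bar> \<le> (\<Sum>i\<in>I. \<bar>b i\<bar>)" if "t \<ge> 0" for c j t
  proof -
    have "t = frac t + real (nat \<lfloor>t\<rfloor>)" using that by (simp add: frac_def)
    then have "G (c, j) t (\<lambda>_. 0) = G (c, j) (frac t) (\<lambda>_. 0)" using time_periodic_nat by metis
    also have "\<dots> = G (c, j mod int n + (j div int n) * int n) (frac t) (\<lambda>_. 0)" by simp
    also have "\<dots> = G (c, j mod int n) (frac t) (\<lambda>_. 0)" by (rule type_periodic_const)
    finally have "\<bar>G (c, j) t (\<lambda>_. 0)\<bar> \<le> \<bar>b (c, j mod int n)\<bar>"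
      using b[of "frac t" "(c, j mod int n)"] frac_lt_1[of t] by (simp add: less_imp_le)
    also have "\<dots> \<le> (\<Sum>i\<in>I. \<bar>b i\<bar>)"
      using \<open>finite I\<close> n_pos by (intro member_le_sum) (auto simp: I_def)
    finally show ?thesis .
  qed
  then have "\<forall>i. \<forall>t\<ge>0. \<bar>G i t (\<lambda>_. 0)\<bar> \<le> (\<Sum>i\<in>I. \<bar>b i\<bar>)" by (metis surj_pair)
  then show ?thesis by blast
qed

text \<open>The state is compared with the constant state of its own value \<open>s\<close>, then
  \<open>s\<close> is replaced by its fractional part, which does not change the field, and finally
  by 0. Thus the size of the state drops out and only its spread over the \<open>m\<close>
  neighbours remains.\<close>

lemma field_bounded:
  obtains B where "B \<ge> 0" "\<And>i t z. t \<ge> 0 \<Longrightarrow> spread K z \<Longrightarrow> \<bar>G i t z\<bar> \<le> B"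
proof -
  obtain B\<^sub>0 where B\<^sub>0: "\<And>i t. t \<ge> 0 \<Longrightarrow> \<bar>G i t (\<lambda>_. 0)\<bar> \<le> B\<^sub>0" using field_bounded_zero by blast
  have "\<bar>G i t z\<bar> \<le> B\<^sub>0 + Lg + Lg * (\<bar>K\<bar> * (1 + real m))" if t: "t \<ge> 0" and z: "spread K z" for i t z
  proof (cases i)
    case (Pair c j)
    define s where "s = z (c, j)"
    have "\<bar>G (c, j) t z - G (c, j) t (\<lambda>_. s)\<bar> \<le> Lg * (\<bar>K\<bar> * (1 + real m))"
    proof (rule lip)
      fix c' k assume "\<bar>k - j\<bar> \<le> int m"
      then have "\<bar>real_of_int (k - j)\<bar> \<le> real m" by linarith
      then have "\<bar>K\<bar> * (1 + \<bar>real_of_int (k - j)\<bar>) \<le> \<bar>K\<bar> * (1 + real m)" by (intro mult_left_mono) auto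
      moreover have "K * (1 + \<bar>real_of_int (k - j)\<bar>) \<le> \<bar>K\<bar> * (1 + \<bar>real_of_int (k - j)\<bar>)"
        by (intro mult_right_mono) auto
      ultimately show "\<bar>z (c', k) - s\<bar> \<le> \<bar>K\<bar> * (1 + real m)"
        using spreadD[OF z, of c' k c j] by (simp add: s_def)
    qed
    moreover have "G (c, j) t (\<lambda>_. s) = G (c, j) t (\<lambda>_. frac s)"
      using value_periodic_int[of "(c, j)" t "\<lambda>_. frac s" "\<lfloor>s\<rfloor>"] by (simp add: frac_def)
    moreover have "\<bar>G (c, j) t (\<lambda>_. frac s) - G (c, j) t (\<lambda>_. 0)\<bar> \<le> Lg * 1"
      by (rule lip) (use frac_lt_1[of s] in \<open>simp add: less_imp_le\<close>)
    ultimately show ?thesis using B\<^sub>0[OF t, of "(c, j)"] unfolding Pair by linarith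
  qed
  moreover have "B\<^sub>0 + Lg + Lg * (\<bar>K\<bar> * (1 + real m)) \<ge> 0"
    using B\<^sub>0[of 0 undefined] Lg_nonneg by simp
  ultimately show thesis using that by blast
qed

end

text \<open>Fekete's argument in both directions: computing \<open>a (M * N)\<close> from
  \<open>a M\<close> and from \<open>a N\<close> shows that the intervals from
  \<open>(a N - C) / N\<close> to \<open>(a N + C) / N\<close> meet pairwise, and \<open>v\<close>
  is a point common to all of them.\<close>

lemma subadditive_limit:
  fixes a :: "nat \<Rightarrow> real"
  assumes a: "\<And>M N. \<bar>a (M + N) - a M - a N\<bar> \<le> C"
  obtains v where "\<And>N. \<bar>a N - v * real N\<bar> \<le> C"
proof -
  have mult: "\<bar>a (Suc k * N) - real (Suc k) * a N\<bar> \<le> real k * C" for k N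
  proof (induction k)
    case (Suc k)
    have "\<bar>a (N + Suc k * N) - a N - a (Suc k * N)\<bar> \<le> C" by (rule a)
    with Suc show ?case by (simp add: algebra_simps)
  qed simp
  have "C \<ge> 0" using a[of 0 0] by simp
  have le: "(a N - C) / real N \<le> (a M + C) / real M" if "N > 0" "M > 0" for M N
  proof -
    have "\<bar>a (M * N) - real M * a N\<bar> \<le> real (M - 1) * C" "\<bar>a (M * N) - real N * a M\<bar> \<le> real (N - 1) * C"
      using mult[of "M - 1" N] mult[of "N - 1" M] that by (simp_all add: mult.commute[of N M])
    moreover have "real (M - 1) * C \<le> real M * C" "real (N - 1) * C \<le> real N * C"
      using \<open>C \<ge> 0\<close> by (intro mult_right_mono; simp)+
    ultimately have "real M * (a N - C) \<le> real N * (a M + C)"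
      unfolding right_diff_distrib distrib_left by linarith
    then show ?thesis using that by (simp add: field_simps)
  qed
  define v where "v = Sup ((\<lambda>N. (a N - C) / real N) ` {0<..})"
  have bdd: "bdd_above ((\<lambda>N. (a N - C) / real N) ` {0<..})"
    using le[of _ 1] by (auto simp: bdd_above_def)
  have "\<bar>a N - v * real N\<bar> \<le> C" for N
  proof (cases "N = 0")
    case True
    then show ?thesis using a[of 0 0] by simp
  next
    case False
    then have "(a N - C) / real N \<le> v" unfolding v_def by (intro cSUP_upper bdd) auto
    moreover have "v \<le> (a N + C) / real N"
      unfolding v_def using le False by (intro cSUP_least) auto
    ultimately show ?thesis using False by (simp add: field_simps abs_le_iff)
  qed
  then show thesis using that by blast
qed

section \<open>Effective speed of a cooperative lattice system\<close>

context ordered_lattice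
begin

text \<open>Only integers may be added to a solution, so \<open>b\<close> is rounded up; this is the
  1 that recurs in the later constants.\<close>

lemma solution_le_add:
  assumes z: "solution z" and z': "solution z'" and "\<And>i. z i 0 \<le> z' i 0 + b" "t \<ge> 0"
  shows "z i t \<le> z' i t + b + 1"
proof -
  have "z i 0 \<le> z' i 0 + real_of_int \<lceil>b\<rceil>" for i using assms(3)[of i] by linarith
  from solution_mono[OF z solution_add_int[OF z'] this \<open>t \<ge> 0\<close>]
  have "z i t \<le> z' i t + real_of_int \<lceil>b\<rceil>" .
  then show ?thesis by linarith
qed

text \<open>The shift by \<open>q\<close> whole blocks is again a solution, and its data exceed
  those of \<open>z\<close> by at most \<open>K * (1 + q * n)\<close>. With \<open>q\<close> just
  large enough that \<open>j + q * n\<close> passes \<open>k\<close>, the order of the particles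
  carries the bound to \<open>k\<close>.\<close>

lemma solution_spread_same_type:
  assumes z: "solution z" and inc: "increasing (\<lambda>i. z i 0)" and sp: "spread K (\<lambda>i. z i 0)"
    and "K \<ge> 0" "t \<ge> 0" "j \<le> k"
  shows "\<bar>z (c, k) t - z (c, j) t\<bar> \<le> (K * (1 + real n) + 1) * (1 + \<bar>real_of_int (k - j)\<bar>)"
proof -
  have incr: "increasing (\<lambda>i. z i t)" by (rule solution_increasing[OF z inc \<open>t \<ge> 0\<close>])
  define q where "q = nat ((k - j) div int n) + 1"
  have "int q * int n = (k - j) div int n * int n + int n"
    using \<open>j \<le> k\<close> n_pos by (simp add: q_def distrib_right pos_imp_zdiv_nonneg_iff)
  then have q: "k - j \<le> int q * int n" "int q * int n \<le> k - j + int n"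
    using div_mult_mod_eq[of "k - j" "int n"] pos_mod_bound[of "int n" "k - j"]
      pos_mod_sign[of "int n" "k - j"] n_pos by linarith+
  have "(case i of (c, j) \<Rightarrow> z (c, j + int q * int n)) 0 \<le> z i 0 + K * (1 + real q * real n)" for i
    using spreadD[OF sp, of "fst i" "snd i + int q * int n" "fst i" "snd i"]
    by (cases i) simp
  from solution_le_add[OF solution_shift_type[OF z] z this \<open>t \<ge> 0\<close>, of "(c, j)"]
  have "z (c, j + int q * int n) t \<le> z (c, j) t + K * (1 + real q * real n) + 1" by simp
  moreover have "z (c, k) t \<le> z (c, j + int q * int n) t"
    using increasingD[OF incr] q by simp
  moreover have "real q * real n \<le> real_of_int (k - j) + real n"
  proof -
    have "real_of_int (int q * int n) \<le> real_of_int (k - j + int n)" using q(2) by (simp only: of_int_le_iff)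
    then show ?thesis by simp
  qed
  then have "K * (1 + real q * real n) \<le> K * (1 + (real_of_int (k - j) + real n))"
    using \<open>K \<ge> 0\<close> by (intro mult_left_mono) auto
  moreover have "K * (1 + (real_of_int (k - j) + real n)) + 1 \<le> (K * (1 + real n) + 1) * (1 + real_of_int (k - j))"
  proof -
    have "0 \<le> real_of_int (k - j)" "0 \<le> K * real n * real_of_int (k - j)" using \<open>K \<ge> 0\<close> \<open>j \<le> k\<close> by auto
    then show ?thesis unfolding distrib_left distrib_right by (simp add: mult_ac)
  qed
  moreover have "z (c, j) t \<le> z (c, k) t" using increasingD[OF incr \<open>j \<le> k\<close>] by simp
  ultimately show ?thesis using \<open>j \<le> k\<close> by simp
qed

text \<open>Sites of the same kind are handled by block shifts. For the two kinds the damped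
  equation of \<open>relax\<close> is used: its forcing sees only the \<open>u\<close> particles,
  whose spread \<open>K1\<close> is already known. Hence \<open>K2\<close> is the initial distance
  plus the equilibrium value \<open>B / (2 * \<alpha>)\<close>.\<close>

lemma solution_spread:
  assumes "K \<ge> 0"
  obtains K' where "K' \<ge> 0" "\<And>z t. solution z \<Longrightarrow> increasing (\<lambda>i. z i 0) \<Longrightarrow> spread K (\<lambda>i. z i 0) \<Longrightarrow>
    t \<ge> 0 \<Longrightarrow> spread K' (\<lambda>i. z i t)"
proof -
  define K1 where "K1 = K * (1 + real n) + 1"
  have "K1 \<ge> 0" using assms by (simp add: K1_def)
  obtain B where B: "B \<ge> 0" "\<And>i t z. t \<ge> 0 \<Longrightarrow> spread K1 z \<Longrightarrow> \<bar>G i t z\<bar> \<le> B"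
    by (rule field_bounded[of K1]) blast
  define K2 where "K2 = K + B / (2 * \<alpha>)"
  have "K2 \<ge> 0" using assms B \<alpha>_pos by (simp add: K2_def)
  show thesis
  proof (rule that)
    fix z and t :: real
    assume z: "solution z" and inc: "increasing (\<lambda>i. z i 0)" and sp: "spread K (\<lambda>i. z i 0)" and t: "t \<ge> 0"
    have same: "\<bar>z (c, k) t - z (c, j) t\<bar> \<le> K1 * (1 + \<bar>real_of_int (k - j)\<bar>)" if "t \<ge> 0" for c j k t
    proof (cases "j \<le> k")
      case True
      then show ?thesis using solution_spread_same_type[OF z inc sp assms that] unfolding K1_def by blast
    next
      case False
      then have "\<bar>z (c, j) t - z (c, k) t\<bar> \<le> K1 * (1 + \<bar>real_of_int (j - k)\<bar>)"
        using solution_spread_same_type[OF z inc sp assms that] unfolding K1_def by simp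
      then show ?thesis by (simp add: abs_minus_commute)
    qed
    have sp1: "spread K1 (\<lambda>(c, k). z (True, k) t)" if "t \<ge> 0" for t
      using same[OF that, of True] by (simp add: spread_def)
    have diff: "\<bar>z (False, j) t - z (True, j) t\<bar> \<le> K2" for j
    proof -
      define D where "D s = z (False, j) s - z (True, j) s" for s
      define g where "g s = G (False, j) s (\<lambda>(c, k). z (True, k) s)" for s
      have cont: "continuous_on {0..} D"
        unfolding D_def by (intro continuous_intros solution_continuous[OF z])
      have D: "(D has_real_derivative g s - 2 * \<alpha> * D s) (at s)" if "s > 0" for s
        unfolding D_def g_def
        using DERIV_diff[OF solution_deriv[OF z that, of "(False, j)"] solution_deriv[OF z that, of "(True, j)"]]
        by (simp add: relax[of j s "\<lambda>k. z k s"] case_prod_unfold)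
      have g: "\<bar>g s\<bar> \<le> B" if "s > 0" for s
        unfolding g_def using B(2)[OF _ sp1] that by simp
      have D0: "\<bar>D 0\<bar> \<le> K" using spreadD[OF sp, of False j True j] by (simp add: D_def)
      have "D t \<le> max (D 0) 0 + B / (2 * \<alpha>)"
        by (rule relaxation_bound[OF cont _ D]) (use g \<alpha>_pos t B in \<open>auto simp: abs_le_iff\<close>)
      moreover have "- D t \<le> max (- D 0) 0 + B / (2 * \<alpha>)"
      proof (rule relaxation_bound[where D = "\<lambda>s. - D s" and g = "\<lambda>s. - g s"])
        show "((\<lambda>s. - D s) has_real_derivative - g s - 2 * \<alpha> * - D s) (at s)" if "s > 0" for s
          using DERIV_minus[OF D[OF that]] by simp
        show "- g s \<le> B" if "s > 0" for s using g[OF that] by linarith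
      qed (use \<alpha>_pos t B cont in \<open>auto intro!: continuous_intros\<close>)
      ultimately show ?thesis using D0 assms by (auto simp: K2_def D_def[symmetric])
    qed
    show "spread (K1 + K2) (\<lambda>i. z i t)"
      unfolding spread_def
    proof (intro allI)
      fix c j c' k
      have "\<bar>z (c, k) t - z (c', k) t\<bar> \<le> K2"
        using diff[of k] \<open>K2 \<ge> 0\<close> by (cases c; cases c') (auto simp: abs_minus_commute)
      moreover have "\<bar>z (c, j) t - z (c, k) t\<bar> \<le> K1 * (1 + \<bar>real_of_int (j - k)\<bar>)" by (rule same[OF t])
      moreover have "K2 \<le> K2 * (1 + \<bar>real_of_int (j - k)\<bar>)"
        using mult_left_mono[OF _ \<open>K2 \<ge> 0\<close>, of 1 "1 + \<bar>real_of_int (j - k)\<bar>"] by simp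
      ultimately show "\<bar>z (c, j) t - z (c', k) t\<bar> \<le> (K1 + K2) * (1 + \<bar>real_of_int (j - k)\<bar>)"
        unfolding distrib_right by linarith
    qed
  qed (use \<open>K1 \<ge> 0\<close> \<open>K2 \<ge> 0\<close> in simp)
qed

text \<open>The spread bounds the field along the solution, so the constant depends on
  \<open>K\<close> alone and serves all solutions of that spread.\<close>

lemma solution_time_lipschitz:
  obtains B where "B \<ge> 0" "\<And>z i s t. solution z \<Longrightarrow> (\<And>t. t \<ge> 0 \<Longrightarrow> spread K (\<lambda>i. z i t)) \<Longrightarrow>
    s \<ge> 0 \<Longrightarrow> t \<ge> 0 \<Longrightarrow> \<bar>z i t - z i s\<bar> \<le> B * \<bar>t - s\<bar>"
proof -
  obtain B where B: "B \<ge> 0" "\<And>i t z. t \<ge> 0 \<Longrightarrow> spread K z \<Longrightarrow> \<bar>G i t z\<bar> \<le> B"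
    by (rule field_bounded[of K]) blast
  have *: "\<bar>z i t - z i s\<bar> \<le> B * \<bar>t - s\<bar>"
    if z: "solution z" and sp: "\<And>t. t \<ge> 0 \<Longrightarrow> spread K (\<lambda>i. z i t)" and st: "0 \<le> s" "s < t" for z i s t
  proof -
    have "\<exists>l x. s < x \<and> x < t \<and> (z i has_real_derivative l) (at x) \<and> z i t - z i s = (t - s) * l"
    proof (rule MVT[OF \<open>s < t\<close>])
      show "continuous_on {s..t} (z i)"
        by (rule continuous_on_subset[OF solution_continuous[OF z]]) (use st in auto)
      show "z i differentiable (at x)" if "s < x" "x < t" for x
        using solution_deriv[OF z, of x i] that st real_differentiable_def by force
    qed
    then obtain l x where x: "s < x" "(z i has_real_derivative l) (at x)" "z i t - z i s = (t - s) * l" by blast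
    have "l = G i x (\<lambda>k. z k x)" using DERIV_unique[OF x(2) solution_deriv[OF z]] x st by simp
    then have "\<bar>l\<bar> \<le> B" using B(2)[OF _ sp, of x x i] x st by simp
    then have "\<bar>(t - s) * l\<bar> \<le> \<bar>t - s\<bar> * B" unfolding abs_mult by (intro mult_left_mono) auto
    then show ?thesis using x(3) by (simp add: mult.commute)
  qed
  show thesis
  proof (rule that[OF B(1)])
    fix z i and s t :: real
    assume z: "solution z" and sp: "\<And>t. t \<ge> 0 \<Longrightarrow> spread K (\<lambda>i. z i t)" and "s \<ge> 0" "t \<ge> 0"
    then show "\<bar>z i t - z i s\<bar> \<le> B * \<bar>t - s\<bar>"
      using *[OF z sp, of s t i] *[OF z sp, of t s i]
      by (cases s t rule: linorder_cases) (simp_all add: abs_minus_commute)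
  qed
qed

lemma spread_solution_exists:
  assumes a: "spread K a"
  obtains z where "solution z" "\<And>i. z i 0 = a i"
proof -
  obtain B where B: "\<And>i t z. t \<ge> 0 \<Longrightarrow> spread K z \<Longrightarrow> \<bar>G i t z\<bar> \<le> B"
    by (rule field_bounded[of K]) blast
  have "\<bar>a (c, j)\<bar> \<le> (\<bar>K\<bar> + \<bar>a (True, 0)\<bar>) * (1 + \<bar>real_of_int j\<bar>)" for c j
  proof -
    have "\<bar>a (c, j)\<bar> \<le> K * (1 + \<bar>real_of_int j\<bar>) + \<bar>a (True, 0)\<bar>"
      using spreadD[OF a, of c j True 0] by simp
    also have "\<dots> \<le> \<bar>K\<bar> * (1 + \<bar>real_of_int j\<bar>) + \<bar>a (True, 0)\<bar> * (1 + \<bar>real_of_int j\<bar>)"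
      using mult_left_mono[of 1 "1 + \<bar>real_of_int j\<bar>" "\<bar>a (True, 0)\<bar>"] mult_right_mono[OF abs_ge_self[of K], of "1 + \<bar>real_of_int j\<bar>"]
      by simp
    finally show ?thesis by (simp add: distrib_right)
  qed
  from solution_exists[OF B[OF _ a] this] show thesis using that by blast
qed

text \<open>Division by \<open>n\<close> makes \<open>p\<close> the increment over one block of
  \<open>n\<close> indices, that is, over a distance \<open>\<epsilon>\<close> in the space variable
  of the system.\<close>

definition linear_state :: "real \<Rightarrow> site \<Rightarrow> real" where
  "linear_state p = (\<lambda>(c, j). p * real_of_int j / real n)"

lemma linear_state_increasing: "p \<ge> 0 \<Longrightarrow> increasing (linear_state p)"
  unfolding increasing_def linear_state_def by (intro allI) (simp add: divide_right_mono mult_left_mono)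

lemma linear_state_spread:
  assumes "p \<ge> 0" shows "spread p (linear_state p)"
  unfolding spread_def
proof (intro allI)
  fix c j c' k
  have "\<bar>linear_state p (c, j) - linear_state p (c', k)\<bar> = p * \<bar>real_of_int (j - k)\<bar> / real n"
    using assms by (simp add: linear_state_def abs_mult flip: diff_divide_distrib right_diff_distrib)
  also have "\<dots> \<le> p * \<bar>real_of_int (j - k)\<bar> / 1"
    using assms n_pos by (intro divide_left_mono) auto
  also have "\<dots> \<le> p * (1 + \<bar>real_of_int (j - k)\<bar>)" using assms by (simp add: distrib_left)
  finally show "\<bar>linear_state p (c, j) - linear_state p (c', k)\<bar> \<le> p * (1 + \<bar>real_of_int (j - k)\<bar>)" .
qed

definition travels_at :: "real \<Rightarrow> real \<Rightarrow> bool" where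
  "travels_at p v \<longleftrightarrow> (\<exists>\<zeta> C. solution \<zeta> \<and> (\<forall>i. \<zeta> i 0 = linear_state p i) \<and>
     (\<forall>i. \<forall>t\<ge>0. \<bar>\<zeta> i t - linear_state p i - v * t\<bar> \<le> C))"

text \<open>
  The solution issued from a linear state of slope \<open>p\<close> is shifted by \<open>p k\<close> up to an integer rounding
  when the index is shifted by \<open>k n\<close>, so it stays at bounded distance from a linear state. Its
  displacement is therefore almost additive in time.
\<close>

theorem travels_at_exists:
  assumes "p \<ge> 0" shows "\<exists>v. travels_at p v"
proof -
  obtain \<zeta> where \<zeta>: "solution \<zeta>" and \<zeta>0: "\<And>i. \<zeta> i 0 = linear_state p i"
    by (rule spread_solution_exists[OF linear_state_spread[OF assms]]) blast
  have inc: "increasing (\<lambda>i. \<zeta> i 0)" and sp: "spread p (\<lambda>i. \<zeta> i 0)"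
    unfolding \<zeta>0 using linear_state_increasing[OF assms] linear_state_spread[OF assms] by simp_all
  obtain K where "K \<ge> 0" and K: "\<And>t. t \<ge> 0 \<Longrightarrow> spread K (\<lambda>i. \<zeta> i t)"
    using solution_spread[OF assms] \<zeta> inc sp by metis
  obtain B where B: "\<And>i s t. s \<ge> 0 \<Longrightarrow> t \<ge> 0 \<Longrightarrow> \<bar>\<zeta> i t - \<zeta> i s\<bar> \<le> B * \<bar>t - s\<bar>"
    using solution_time_lipschitz[of K] \<zeta> K by metis
  define a where "a t = \<zeta> (True, 0) t" for t
  have shift: "\<bar>\<zeta> (c, j + int k * int n) t - \<zeta> (c, j) t - p * real k\<bar> \<le> 1" if "t \<ge> 0" for c j k t
  proof -
    have *: "(case i of (c, j) \<Rightarrow> \<zeta> (c, j + int k * int n)) 0 = \<zeta> i 0 + p * real k" for i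
      using n_pos by (cases i) (simp add: \<zeta>0 linear_state_def field_simps)
    have "(case (c, j) of (c, j) \<Rightarrow> \<zeta> (c, j + int k * int n)) t \<le> \<zeta> (c, j) t + p * real k + 1"
      by (rule solution_le_add[OF solution_shift_type[OF \<zeta>] \<zeta> _ that]) (simp only: * order_refl)
    moreover have "\<zeta> (c, j) t \<le> (case (c, j) of (c, j) \<Rightarrow> \<zeta> (c, j + int k * int n)) t + - (p * real k) + 1"
    proof (rule solution_le_add[OF \<zeta> solution_shift_type[OF \<zeta>] _ that])
      show "\<zeta> i 0 \<le> (case i of (c, j) \<Rightarrow> \<zeta> (c, j + int k * int n)) 0 + - (p * real k)" for i
        using *[of i] by linarith
    qed
    ultimately show ?thesis by simp
  qed
  \<comment> \<open>The summand 1 comes from the shift by whole blocks, \<open>K * (1 + n)\<close>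
    from the position inside a block and the change of kind, and \<open>p\<close> from the linear
    state inside a block.\<close>
  define C1 where "C1 = 1 + K * (1 + real n) + p"
  have near: "\<bar>\<zeta> i t - linear_state p i - a t\<bar> \<le> C1" if "t \<ge> 0" for i t
  proof (cases i)
    case (Pair c j)
    define q r where "q = j div int n" and "r = j mod int n"
    have r: "0 \<le> r" "r < int n" and j: "j = r + q * int n"
      using n_pos by (simp_all add: q_def r_def)
    have "\<bar>\<zeta> (c, j) t - \<zeta> (c, r) t - p * real_of_int q\<bar> \<le> 1"
    proof (cases "q \<ge> 0")
      case True
      then show ?thesis using shift[OF that, of c r "nat q"] by (simp add: j)
    next
      case False
      then have "r = j + int (nat (- q)) * int n" by (simp add: j)
      then show ?thesis using shift[OF that, of c j "nat (- q)"] False by simp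
    qed
    moreover have "\<bar>\<zeta> (c, r) t - \<zeta> (True, 0) t\<bar> \<le> K * (1 + real n)"
    proof (rule order_trans[OF spreadD[OF K[OF that]]])
      show "K * (1 + \<bar>real_of_int (r - 0)\<bar>) \<le> K * (1 + real n)"
        using r \<open>K \<ge> 0\<close> by (intro mult_left_mono) auto
    qed
    moreover have "linear_state p (c, j) = p * real_of_int q + p * (real_of_int r / real n)"
      using n_pos by (simp add: linear_state_def j field_simps)
    moreover have "0 \<le> p * (real_of_int r / real n)"
      using r assms by (intro mult_nonneg_nonneg divide_nonneg_nonneg) auto
    moreover have "p * (real_of_int r / real n) \<le> p * 1"
      using r n_pos assms by (intro mult_left_mono) (auto simp: field_simps)
    ultimately show ?thesis unfolding C1_def Pair a_def by linarith
  qed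
  \<comment> \<open>The solution restarted at an integer time is compared with the solution itself:
    by \<open>near\<close>, their initial states differ by \<open>a N\<close> up to
    \<open>C1\<close>.\<close>
  have add: "\<bar>a (real N + t) - a (real N) - a t\<bar> \<le> C1 + 1" if "t \<ge> 0" for N t
  proof -
    have "\<zeta> i (real N + 0) \<le> \<zeta> i 0 + (a (real N) + C1)" for i
      using near[of "real N" i] \<zeta>0[of i] by (simp add: abs_le_iff)
    from solution_le_add[OF solution_shift_time[OF \<zeta>] \<zeta> this that, of "(True, 0)"]
    have "a (real N + t) \<le> a t + (a (real N) + C1) + 1" by (simp add: a_def)
    moreover have "\<zeta> i 0 \<le> \<zeta> i (real N + 0) + (- a (real N) + C1)" for i
      using near[of "real N" i] \<zeta>0[of i] by (simp add: abs_le_iff)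
    from solution_le_add[OF \<zeta> solution_shift_time[OF \<zeta>] this that, of "(True, 0)"]
    have "a t \<le> a (real N + t) + (- a (real N) + C1) + 1" by (simp add: a_def)
    ultimately show ?thesis by (simp add: abs_le_iff)
  qed
  obtain v where v: "\<And>N. \<bar>a (real N) - v * real N\<bar> \<le> C1 + 1"
    using subadditive_limit[of "\<lambda>N. a (real N)" "C1 + 1"] add by (metis of_nat_0_le_iff of_nat_add)
  \<comment> \<open>From integer times to all times: within one unit the displacement changes by at
    most \<open>\<bar>B\<bar>\<close> and the linear motion by at most
    \<open>\<bar>v\<bar>\<close>.\<close>
  have "\<bar>\<zeta> i t - linear_state p i - v * t\<bar> \<le> C1 + \<bar>B\<bar> + (C1 + 1) + \<bar>v\<bar>" if "t \<ge> 0" for i t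
  proof -
    define N where "N = nat \<lfloor>t\<rfloor>"
    have N: "0 \<le> t - real N" "t - real N \<le> 1" using that by (simp_all add: N_def) linarith
    have "\<bar>a t - a (real N)\<bar> \<le> B * \<bar>t - real N\<bar>" unfolding a_def using B that by simp
    also have "\<dots> \<le> \<bar>B\<bar> * 1" using N by (intro mult_mono) auto
    finally have "\<bar>a t - a (real N)\<bar> \<le> \<bar>B\<bar>" by simp
    moreover have "\<bar>v * t - v * real N\<bar> = \<bar>v\<bar> * (t - real N)"
      using N by (simp add: abs_mult flip: right_diff_distrib)
    moreover have "\<bar>v\<bar> * (t - real N) \<le> \<bar>v\<bar> * 1" using N by (intro mult_left_mono) auto
    ultimately show ?thesis using near[OF that, of i] v[of N] by linarith
  qed
  then show ?thesis unfolding travels_at_def using \<zeta> \<zeta>0 by blast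
qed

definition speed :: "real \<Rightarrow> real" where
  "speed p = (SOME v. travels_at p v)"

lemma speed_solution:
  assumes "p \<ge> 0"
  obtains \<zeta> C where "solution \<zeta>" "\<And>i. \<zeta> i 0 = linear_state p i"
    "\<And>i t. t \<ge> 0 \<Longrightarrow> \<bar>\<zeta> i t - linear_state p i - speed p * t\<bar> \<le> C"
proof -
  have "travels_at p (speed p)"
    unfolding speed_def by (rule someI_ex[OF travels_at_exists[OF assms]])
  with that show thesis unfolding travels_at_def by blast
qed

text \<open>Beyond the radius \<open>R\<close>, linear growth is dominated by an exponential which
  is only \<open>R + 1\<close> at the edge.\<close>

lemma cone_estimate:
  fixes x R :: real
  assumes "x \<ge> R" "R \<ge> 0"
  shows "x \<le> (R + 1) * exp (x - R)"
proof -
  have "0 \<le> R * (x - R)" using assms by simp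
  then have "x \<le> (R + 1) * (1 + (x - R))" by (simp add: algebra_simps)
  also have "\<dots> \<le> (R + 1) * exp (x - R)" using assms by (intro mult_left_mono exp_ge_add_one_self) auto
  finally show ?thesis .
qed

text \<open>The barrier is the solution with linear data plus an integer plus
  \<open>b s * exp \<bar>j\<bar>\<close>. In the window
  \<open>\<bar>j\<bar> \<le> 2 * rate * s\<close> the hypothesis is used; outside it the last term
  dominates the spread. Since \<open>b s\<close> contains \<open>exp (- (2 * rate * s))\<close> and
  the time \<open>s\<close> amplifies it by \<open>exp (rate * s)\<close> only, the error at index 0
  stays bounded uniformly in \<open>s\<close>; hence the factor 2 in the width of the window. The
  starting time is an integer so that the solution can be restarted there.\<close>

lemma local_speed_bounds:
  assumes "p \<ge> 0" "K \<ge> 0"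
  obtains C where "C \<ge> 0"
    and "\<And>z N s c. solution z \<Longrightarrow> (\<And>t. t \<ge> 0 \<Longrightarrow> spread K (\<lambda>i. z i t)) \<Longrightarrow> s \<ge> 0 \<Longrightarrow>
      (\<And>j. \<bar>real_of_int j\<bar> \<le> 2 * rate * s \<Longrightarrow> z (True, j) (real N) \<le> c + p * real_of_int j / real n) \<Longrightarrow>
      z (True, 0) (real N + s) \<le> c + speed p * s + C"
    and "\<And>z N s c. solution z \<Longrightarrow> (\<And>t. t \<ge> 0 \<Longrightarrow> spread K (\<lambda>i. z i t)) \<Longrightarrow> s \<ge> 0 \<Longrightarrow>
      (\<And>j. \<bar>real_of_int j\<bar> \<le> 2 * rate * s \<Longrightarrow> c + p * real_of_int j / real n \<le> z (True, j) (real N)) \<Longrightarrow>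
      c + speed p * s - C \<le> z (True, 0) (real N + s)"
proof -
  obtain \<zeta> C\<^sub>0 where \<zeta>: "solution \<zeta>" and \<zeta>0: "\<And>i. \<zeta> i 0 = linear_state p i"
    and C\<^sub>0: "\<And>i t. t \<ge> 0 \<Longrightarrow> \<bar>\<zeta> i t - linear_state p i - speed p * t\<bar> \<le> C\<^sub>0"
    by (rule speed_solution[OF assms(1)]) blast
  have "C\<^sub>0 \<ge> 0" using C\<^sub>0[of 0 "(True, 0)"] by simp
  define b where "b s = (K + p) * (2 * rate * s + 1) * exp (- (2 * rate * s))" for s
  have b_nonneg: "b s \<ge> 0" if "s \<ge> 0" for s using assms rate_pos that by (simp add: b_def)
  have b_le: "b s * exp (rate * s) \<le> 2 * (K + p)" if "s \<ge> 0" for s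
  proof -
    have "b s * exp (rate * s) = (K + p) * ((2 * (rate * s) + 1) * exp (- (rate * s)))"
      using exp_add[of "- (2 * rate * s)" "rate * s"] by (simp add: b_def mult_ac)
    also have "\<dots> \<le> (K + p) * (2 * exp (rate * s) * exp (- (rate * s)))"
    proof -
      have "2 * (rate * s) + 1 \<le> 2 * exp (rate * s)"
        using exp_ge_add_one_self[of "rate * s"] rate_pos that mult_nonneg_nonneg[of rate s] by linarith
      then show ?thesis using assms by (intro mult_left_mono mult_right_mono) auto
    qed
    also have "\<dots> = (K + p) * (2 * (exp (rate * s) * exp (- (rate * s))))" by (simp only: mult.assoc)
    also have "exp (rate * s) * exp (- (rate * s)) = 1" by (simp flip: exp_add)
    finally show ?thesis by simp
  qed
  have b_outside: "(K + p) * \<bar>real_of_int j\<bar> \<le> b s * exp \<bar>real_of_int j\<bar>"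
    if "\<bar>real_of_int j\<bar> > 2 * rate * s" "s \<ge> 0" for j s
  proof -
    have "(K + p) * \<bar>real_of_int j\<bar> \<le> (K + p) * ((2 * rate * s + 1) * exp (\<bar>real_of_int j\<bar> - 2 * rate * s))"
      using that rate_pos assms by (intro mult_left_mono cone_estimate) auto
    also have "\<dots> = b s * exp \<bar>real_of_int j\<bar>" by (simp add: b_def exp_diff exp_minus field_simps)
    finally show ?thesis .
  qed
  have lin_le: "\<bar>linear_state p (c, j)\<bar> \<le> p * \<bar>real_of_int j\<bar>" for c j
  proof -
    have "\<bar>linear_state p (c, j)\<bar> = p * \<bar>real_of_int j\<bar> / real n"
      using assms(1) by (simp add: linear_state_def abs_mult)
    also have "\<dots> \<le> p * \<bar>real_of_int j\<bar> / 1" using assms(1) n_pos by (intro divide_left_mono) auto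
    finally show ?thesis by simp
  qed
  show thesis
  proof (rule that)
    show "C\<^sub>0 + K + 1 + 2 * (K + p) \<ge> 0" using assms \<open>C\<^sub>0 \<ge> 0\<close> by simp
  next
    fix z N s c
    assume z: "solution z" and sp: "\<And>t. t \<ge> 0 \<Longrightarrow> spread K (\<lambda>i. z i t)" and "s \<ge> 0"
      and le: "\<And>j. \<bar>real_of_int j\<bar> \<le> 2 * rate * s \<Longrightarrow> z (True, j) (real N) \<le> c + p * real_of_int j / real n"
    \<comment> \<open>Inside the window only the \<open>u\<close> particles are bounded by
      hypothesis, and \<open>K\<close> pays for the others; the ceiling makes the translation an
      integer.\<close>
    have "z (d, j) (real N + 0) \<le> \<zeta> (d, j) 0 + real_of_int \<lceil>c + K\<rceil> + b s * exp \<bar>real_of_int j\<bar>" for d j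
    proof (cases "\<bar>real_of_int j\<bar> \<le> 2 * rate * s")
      case True
      have "z (d, j) (real N) \<le> z (True, j) (real N) + K"
        using spreadD[OF sp[of "real N"], of d j True j] by simp
      with le[OF True] have "z (d, j) (real N) \<le> c + K + linear_state p (d, j)" by (simp add: linear_state_def)
      moreover have "0 \<le> b s * exp \<bar>real_of_int j\<bar>" using b_nonneg[OF \<open>s \<ge> 0\<close>] by simp
      ultimately show ?thesis unfolding \<zeta>0 by simp linarith
    next
      case False
      have "z (d, j) (real N) \<le> z (True, 0) (real N) + K * (1 + \<bar>real_of_int j\<bar>)"
        using spreadD[OF sp[of "real N"], of d j True 0] by simp
      moreover have "z (True, 0) (real N) \<le> c" using le[of 0] \<open>s \<ge> 0\<close> rate_pos by simp
      ultimately have "z (d, j) (real N) \<le> c + K + linear_state p (d, j) + (K + p) * \<bar>real_of_int j\<bar>"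
        using lin_le[of d j] by (simp add: algebra_simps abs_le_iff)
      with b_outside[of s j] False \<open>s \<ge> 0\<close> show ?thesis unfolding \<zeta>0 by simp linarith
    qed
    from solution_le_perturbed[OF solution_shift_time[OF z] solution_add_int[OF \<zeta>] b_nonneg \<open>s \<ge> 0\<close> this, of True 0]
    have "z (True, 0) (real N + s) \<le> \<zeta> (True, 0) s + real_of_int \<lceil>c + K\<rceil> + b s * exp (rate * s)"
      using \<open>s \<ge> 0\<close> by simp
    moreover have "\<zeta> (True, 0) s \<le> speed p * s + C\<^sub>0"
      using C\<^sub>0[OF \<open>s \<ge> 0\<close>, of "(True, 0)"] by (simp add: linear_state_def abs_le_iff)
    ultimately show "z (True, 0) (real N + s) \<le> c + speed p * s + (C\<^sub>0 + K + 1 + 2 * (K + p))"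
      using b_le[OF \<open>s \<ge> 0\<close>] by linarith
  next
    fix z N s c
    assume z: "solution z" and sp: "\<And>t. t \<ge> 0 \<Longrightarrow> spread K (\<lambda>i. z i t)" and "s \<ge> 0"
      and ge: "\<And>j. \<bar>real_of_int j\<bar> \<le> 2 * rate * s \<Longrightarrow> c + p * real_of_int j / real n \<le> z (True, j) (real N)"
    have "\<zeta> (d, j) 0 + real_of_int \<lfloor>c - K\<rfloor> \<le> z (d, j) (real N + 0) + b s * exp \<bar>real_of_int j\<bar>" for d j
    proof (cases "\<bar>real_of_int j\<bar> \<le> 2 * rate * s")
      case True
      have "z (d, j) (real N) \<ge> z (True, j) (real N) - K"
        using spreadD[OF sp[of "real N"], of d j True j] by simp
      with ge[OF True] have "z (d, j) (real N) \<ge> c - K + linear_state p (d, j)" by (simp add: linear_state_def)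
      moreover have "0 \<le> b s * exp \<bar>real_of_int j\<bar>" using b_nonneg[OF \<open>s \<ge> 0\<close>] by simp
      ultimately show ?thesis unfolding \<zeta>0 by simp linarith
    next
      case False
      have "z (d, j) (real N) \<ge> z (True, 0) (real N) - K * (1 + \<bar>real_of_int j\<bar>)"
        using spreadD[OF sp[of "real N"], of d j True 0] by simp
      moreover have "z (True, 0) (real N) \<ge> c" using ge[of 0] \<open>s \<ge> 0\<close> rate_pos by simp
      ultimately have "z (d, j) (real N) \<ge> c - K + linear_state p (d, j) - (K + p) * \<bar>real_of_int j\<bar>"
        using lin_le[of d j] by (simp add: algebra_simps abs_le_iff)
      with b_outside[of s j] False \<open>s \<ge> 0\<close> show ?thesis unfolding \<zeta>0 by simp linarith
    qed
    from solution_le_perturbed[OF solution_add_int[OF \<zeta>] solution_shift_time[OF z] b_nonneg \<open>s \<ge> 0\<close> this, of True 0]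
    have "\<zeta> (True, 0) s + real_of_int \<lfloor>c - K\<rfloor> \<le> z (True, 0) (real N + s) + b s * exp (rate * s)"
      using \<open>s \<ge> 0\<close> by simp
    moreover have "\<zeta> (True, 0) s \<ge> speed p * s - C\<^sub>0"
      using C\<^sub>0[OF \<open>s \<ge> 0\<close>, of "(True, 0)"] by (simp add: linear_state_def abs_le_iff)
    ultimately show "c + speed p * s - (C\<^sub>0 + K + 1 + 2 * (K + p)) \<le> z (True, 0) (real N + s)"
      using b_le[OF \<open>s \<ge> 0\<close>] by linarith
  qed
qed

text \<open>In the window of width \<open>2 * rate * s\<close> linear states of slopes
  \<open>p\<close> and \<open>q\<close> differ by at most
  \<open>\<bar>p - q\<bar> * (2 * rate * s) / n\<close>, which enters
  \<open>local_speed_bounds\<close> as the constant \<open>c\<close>. All other errors are bounded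
  and disappear after division by \<open>s\<close>.\<close>

theorem speed_lipschitz:
  assumes "p \<ge> 0" "q \<ge> 0"
  shows "\<bar>speed p - speed q\<bar> \<le> 2 * rate / real n * \<bar>p - q\<bar>"
proof -
  have *: "speed q - speed p \<le> 2 * rate / real n * \<bar>p - q\<bar>" if p: "p \<ge> 0" and q: "q \<ge> 0" for p q
  proof (rule ccontr)
    define e where "e = speed q - speed p - 2 * rate / real n * \<bar>p - q\<bar>"
    assume "\<not> speed q - speed p \<le> 2 * rate / real n * \<bar>p - q\<bar>"
    then have "e > 0" by (simp add: e_def)
    obtain \<zeta> C\<^sub>0 where \<zeta>: "solution \<zeta>" and \<zeta>0: "\<And>i. \<zeta> i 0 = linear_state q i"
      and C\<^sub>0: "\<And>i t. t \<ge> 0 \<Longrightarrow> \<bar>\<zeta> i t - linear_state q i - speed q * t\<bar> \<le> C\<^sub>0"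
      by (rule speed_solution[OF q]) blast
    obtain K where "K \<ge> 0" and K': "\<And>z t. solution z \<Longrightarrow> increasing (\<lambda>i. z i 0) \<Longrightarrow>
        spread q (\<lambda>i. z i 0) \<Longrightarrow> t \<ge> 0 \<Longrightarrow> spread K (\<lambda>i. z i t)"
      by (rule solution_spread[OF q]) blast
    have K: "spread K (\<lambda>i. \<zeta> i t)" if "t \<ge> 0" for t
      by (rule K'[OF \<zeta> _ _ that]) (simp_all add: \<zeta>0 linear_state_increasing[OF q] linear_state_spread[OF q])
    obtain C where C: "\<And>z N s c. solution z \<Longrightarrow> (\<And>t. t \<ge> 0 \<Longrightarrow> spread K (\<lambda>i. z i t)) \<Longrightarrow> s \<ge> 0 \<Longrightarrow>
      (\<And>j. \<bar>real_of_int j\<bar> \<le> 2 * rate * s \<Longrightarrow> z (True, j) (real N) \<le> c + p * real_of_int j / real n) \<Longrightarrow>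
      z (True, 0) (real N + s) \<le> c + speed p * s + C"
      by (rule local_speed_bounds[OF p \<open>K \<ge> 0\<close>]) blast
    \<comment> \<open>Long enough for the excess \<open>e * s\<close> to be larger than the two
      bounded errors \<open>C\<close> and \<open>C\<^sub>0\<close>.\<close>
    define s where "s = (\<bar>C\<bar> + \<bar>C\<^sub>0\<bar> + 1) / e"
    have "s > 0" using \<open>e > 0\<close> by (simp add: s_def)
    have "\<zeta> (True, 0) (real 0 + s) \<le> \<bar>p - q\<bar> * (2 * rate * s) / real n + speed p * s + C"
    proof (rule C[OF \<zeta> K])
      fix j assume j: "\<bar>real_of_int j\<bar> \<le> 2 * rate * s"
      have "(q - p) * real_of_int j \<le> \<bar>p - q\<bar> * \<bar>real_of_int j\<bar>"
        using abs_ge_self[of "(q - p) * real_of_int j"] by (simp add: abs_mult abs_minus_commute)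
      also have "\<dots> \<le> \<bar>p - q\<bar> * (2 * rate * s)" using j by (intro mult_left_mono) auto
      finally have "(q - p) * real_of_int j / real n \<le> \<bar>p - q\<bar> * (2 * rate * s) / real n"
        by (rule divide_right_mono) simp
      then show "\<zeta> (True, j) (real 0) \<le> \<bar>p - q\<bar> * (2 * rate * s) / real n + p * real_of_int j / real n"
        by (simp add: \<zeta>0 linear_state_def left_diff_distrib diff_divide_distrib)
    qed (use \<open>s > 0\<close> in auto)
    moreover have "\<zeta> (True, 0) s \<ge> speed q * s - C\<^sub>0"
      using C\<^sub>0[of s "(True, 0)"] \<open>s > 0\<close> by (simp add: linear_state_def abs_le_iff)
    ultimately have "e * s \<le> C + C\<^sub>0" by (simp add: e_def algebra_simps)
    moreover have "e * s = \<bar>C\<bar> + \<bar>C\<^sub>0\<bar> + 1" using \<open>e > 0\<close> by (simp add: s_def)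
    ultimately show False by linarith
  qed
  from *[OF assms] *[OF assms(2,1)] show ?thesis by (simp add: abs_minus_commute abs_le_iff)
qed

end

section \<open>The particle system of an admissible family\<close>

definition particle_field ::
    "nat \<Rightarrow> real \<Rightarrow> (int \<Rightarrow> real \<Rightarrow> (int \<Rightarrow> real) \<Rightarrow> real) \<Rightarrow> site \<Rightarrow> real \<Rightarrow> (site \<Rightarrow> real) \<Rightarrow> real" where
  "particle_field m \<alpha> F = (\<lambda>(c, j) t z.
     if c then \<alpha> * (z (False, j) - z (True, j))
     else 2 * F j t (\<lambda>i\<in>window m. z (True, j + i)) + \<alpha> * (z (True, j) - z (False, j)))"

lemma restrict_in_Rvec [simp]: "(\<lambda>i\<in>window m. V i) \<in> Rvec m"
  by (simp add: Rvec_def)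

lemma finite_window [simp]: "finite (window m)"
  by (simp add: window_def)

lemma zero_in_window [simp]: "0 \<in> window m"
  by (simp add: window_def)

text \<open>Admissibility allows one coordinate to change at a time, so the set \<open>A\<close> of
  coordinates already replaced grows by induction. At coordinate 0 the sum with
  \<open>\<alpha> * V 0\<close> is monotone; for every other coordinate that summand stays
  fixed.\<close>

lemma admissible_mono:
  assumes adm: "admissible n m \<alpha> F" and V: "V \<in> Rvec m" and W: "W \<in> Rvec m"
    and le: "\<And>i. i \<in> window m \<Longrightarrow> V i \<le> W i"
  shows "2 * F j t V + \<alpha> * V 0 \<le> 2 * F j t W + \<alpha> * W 0"
proof -
  have other: "\<And>V i. V \<in> Rvec m \<Longrightarrow> i \<in> window m - {0} \<Longrightarrow> mono (\<lambda>s. F j t (V(i := s)))"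
    and self: "\<And>V. V \<in> Rvec m \<Longrightarrow> mono (\<lambda>s. 2 * F j t (V(0 := s)) + \<alpha> * s)"
    using adm unfolding admissible_def by blast+
  define Y where "Y A i = (if i \<in> A then W i else V i)" for A i
  have Y: "Y A \<in> Rvec m" if "A \<subseteq> window m" for A
    using V W that by (auto simp: Y_def Rvec_def PiE_def extensional_def)
  have "A \<subseteq> window m \<Longrightarrow> 2 * F j t V + \<alpha> * V 0 \<le> 2 * F j t (Y A) + \<alpha> * Y A 0" if "finite A" for A
    using that
  proof (induction A)
    case empty
    have "Y {} = V" by (auto simp: Y_def)
    then show ?case by simp
  next
    case (insert a A)
    have Ya: "Y (insert a A) = (Y A)(a := W a)" "Y A = (Y A)(a := V a)"
      using insert.hyps by (auto simp: Y_def)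
    have a: "a \<in> window m" and YA: "Y A \<in> Rvec m" using insert.prems Y by auto
    show ?case
    proof (cases "a = 0")
      case True
      then have "2 * F j t ((Y A)(a := V a)) + \<alpha> * V a \<le> 2 * F j t ((Y A)(a := W a)) + \<alpha> * W a"
        using monoD[OF self[OF YA] le[OF a]] by simp
      then show ?thesis using insert.IH insert.prems Ya True by (metis fun_upd_same insert_subset order_trans)
    next
      case False
      then have "F j t ((Y A)(a := V a)) \<le> F j t ((Y A)(a := W a))"
        using monoD[OF other[OF YA] le[OF a]] a by simp
      then have "F j t (Y A) \<le> F j t (Y (insert a A))" by (simp only: Ya(1) flip: Ya(2))
      moreover have "Y (insert a A) 0 = Y A 0" using False by (simp add: Y_def)
      ultimately show ?thesis using insert.IH insert.prems by simp
    qed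
  qed
  moreover have "Y (window m) = W"
    using V W by (auto simp: Y_def Rvec_def PiE_def extensional_def)
  ultimately show ?thesis using finite_window by fastforce
qed

text \<open>The Euclidean norm in the Lipschitz condition is at most the number of window sites
  times the maximum, and each relaxation term adds \<open>2 * \<alpha>\<close>. For
  \<open>order\<close>, two coinciding \<open>\<xi>\<close> particles are compared by the last
  condition of \<open>admissible\<close>, and two coinciding \<open>u\<close> particles by the order
  of the \<open>\<xi>\<close> particles that drive them.\<close>

lemma particle_field_lattice:
  assumes "n \<ge> 1" "\<alpha> > 0" and adm: "admissible n m \<alpha> F"
  shows "\<exists>Lg. ordered_lattice (particle_field m \<alpha> F) m Lg n \<alpha>"
proof -
  obtain L where L: "\<And>j t V W. V \<in> Rvec m \<Longrightarrow> W \<in> Rvec m \<Longrightarrow>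
      \<bar>F j t V - F j t W\<bar> \<le> L * L2_set (\<lambda>i. V i - W i) (window m)"
  proof -
    have "\<exists>L. \<forall>j \<tau>. \<forall>V\<in>Rvec m. \<forall>W\<in>Rvec m. \<bar>F j \<tau> V - F j \<tau> W\<bar> \<le> L * L2_set (\<lambda>i. V i - W i) (window m)"
      using adm unfolding admissible_def by (elim conjE)
    then show thesis using that by blast
  qed
  have cont: "\<And>j. continuous_on (UNIV \<times> Rvec m) (\<lambda>(\<tau>, V). F j \<tau> V)"
    and per: "\<And>j t V. V \<in> Rvec m \<Longrightarrow> F j t (\<lambda>i\<in>window m. V i + 1) = F j t V \<and> F j (t + 1) V = F j t V"
    and type: "\<And>j t V. V \<in> Rvec m \<Longrightarrow> F (j + int n) t V = F j t V"
    and ord: "\<And>j t V. (\<And>i. i \<in> window m \<Longrightarrow> V i \<le> V (i + 1)) \<Longrightarrow>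
        2 * F j t (\<lambda>i\<in>window m. V i) + \<alpha> * V 0 \<le> 2 * F (j + 1) t (\<lambda>i\<in>window m. V (i + 1)) + \<alpha> * V 1"
    using adm unfolding admissible_def by (elim conjE; simp)+
  define M where "M = real (card (window m))"
  define Lg where "Lg = 2 * (\<bar>L\<bar> * M) + 2 * \<alpha>"
  have "Lg \<ge> 0" using \<open>\<alpha> > 0\<close> by (simp add: Lg_def M_def)
  have "ordered_lattice (particle_field m \<alpha> F) m Lg n \<alpha>"
  proof
    show "Lg \<ge> 0" by fact
    show "n \<ge> 1" "\<alpha> > 0" by fact+
  next
    fix c j t and z z' :: "site \<Rightarrow> real" and d
    assume d: "\<And>c' k. \<bar>k - j\<bar> \<le> int m \<Longrightarrow> \<bar>z (c', k) - z' (c', k)\<bar> \<le> d"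
    have "d \<ge> 0" using d[of j True] by simp
    have diff: "\<bar>\<alpha> * (z (c1, j) - z (c2, j)) - \<alpha> * (z' (c1, j) - z' (c2, j))\<bar> \<le> 2 * \<alpha> * d" for c1 c2
    proof -
      have "\<bar>(z (c1, j) - z (c2, j)) - (z' (c1, j) - z' (c2, j))\<bar> \<le> 2 * d"
        using d[of j c1] d[of j c2] by simp
      then have "\<alpha> * \<bar>(z (c1, j) - z (c2, j)) - (z' (c1, j) - z' (c2, j))\<bar> \<le> \<alpha> * (2 * d)"
        using \<open>\<alpha> > 0\<close> by (intro mult_left_mono) auto
      then show ?thesis using \<open>\<alpha> > 0\<close> by (simp add: abs_mult flip: right_diff_distrib)
    qed
    show "\<bar>particle_field m \<alpha> F (c, j) t z - particle_field m \<alpha> F (c, j) t z'\<bar> \<le> Lg * d"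
    proof (cases c)
      case True
      have "2 * \<alpha> * d \<le> Lg * d" using \<open>d \<ge> 0\<close> by (intro mult_right_mono) (auto simp: Lg_def M_def)
      then show ?thesis using diff[of False True] True by (simp add: particle_field_def)
    next
      case False
      define V V' where "V = (\<lambda>i\<in>window m. z (True, j + i))" and "V' = (\<lambda>i\<in>window m. z' (True, j + i))"
      have "L2_set (\<lambda>i. V i - V' i) (window m) \<le> (\<Sum>i\<in>window m. \<bar>V i - V' i\<bar>)"
        by (rule L2_set_le_sum_abs)
      also have "\<dots> \<le> (\<Sum>i\<in>window m. d)"
        by (rule sum_mono) (use d in \<open>auto simp: V_def V'_def window_def\<close>)
      finally have "L2_set (\<lambda>i. V i - V' i) (window m) \<le> M * d" by (simp add: M_def)
      then have "\<bar>L\<bar> * L2_set (\<lambda>i. V i - V' i) (window m) \<le> \<bar>L\<bar> * (M * d)"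
        by (rule mult_left_mono) simp
      moreover have "L * L2_set (\<lambda>i. V i - V' i) (window m) \<le> \<bar>L\<bar> * L2_set (\<lambda>i. V i - V' i) (window m)"
        by (intro mult_right_mono) auto
      moreover have "\<bar>F j t V - F j t V'\<bar> \<le> L * L2_set (\<lambda>i. V i - V' i) (window m)"
        by (rule L) (auto simp: V_def V'_def)
      ultimately have "\<bar>F j t V - F j t V'\<bar> \<le> \<bar>L\<bar> * M * d" by simp
      then show ?thesis using diff[of True False] False
        by (simp add: particle_field_def Lg_def distrib_right flip: V_def V'_def)
    qed
  next
    fix i :: site and t and z z' :: "site \<Rightarrow> real"
    assume le: "\<And>k. z k \<le> z' k" and eq: "z i = z' i"
    obtain c j where i: "i = (c, j)" by (cases i)
    show "particle_field m \<alpha> F i t z \<le> particle_field m \<alpha> F i t z'"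
    proof (cases c)
      case True
      then show ?thesis using le[of "(False, j)"] eq \<open>\<alpha> > 0\<close> by (simp add: particle_field_def i)
    next
      case False
      have "2 * F j t (\<lambda>i\<in>window m. z (True, j + i)) + \<alpha> * (\<lambda>i\<in>window m. z (True, j + i)) 0
          \<le> 2 * F j t (\<lambda>i\<in>window m. z' (True, j + i)) + \<alpha> * (\<lambda>i\<in>window m. z' (True, j + i)) 0"
        by (rule admissible_mono[OF adm]) (auto simp: le)
      then show ?thesis using False eq by (simp add: particle_field_def i right_diff_distrib)
    qed
  next
    fix S :: "real set" and i :: site and z :: "site \<Rightarrow> real \<Rightarrow> real"
    assume z: "\<And>k. continuous_on S (z k)"
    obtain c j where i: "i = (c, j)" by (cases i)
    have "continuous_on S (\<lambda>t. \<lambda>k\<in>window m. z (True, j + k) t)"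
    proof (rule continuous_on_coordinatewise_then_product)
      show "continuous_on S (\<lambda>t. (\<lambda>k\<in>window m. z (True, j + k) t) k)" for k
        by (cases "k \<in> window m") (auto intro: z)
    qed
    then have "continuous_on S (\<lambda>t. (t, \<lambda>k\<in>window m. z (True, j + k) t))"
      by (rule continuous_on_Pair[OF continuous_on_id])
    then have "continuous_on S (\<lambda>t. (\<lambda>(\<tau>, V). F j \<tau> V) (t, \<lambda>k\<in>window m. z (True, j + k) t))"
      by (rule continuous_on_compose2[OF cont]) auto
    then have "continuous_on S (\<lambda>t. F j t (\<lambda>k\<in>window m. z (True, j + k) t))" by simp
    then show "continuous_on S (\<lambda>t. particle_field m \<alpha> F i t (\<lambda>k. z k t))"
      using z by (cases c) (auto simp: particle_field_def i intro!: continuous_intros)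
  next
    fix i :: site and t and z :: "site \<Rightarrow> real"
    obtain c j where i: "i = (c, j)" by (cases i)
    show "particle_field m \<alpha> F i (t + 1) z = particle_field m \<alpha> F i t z"
      using per by (simp add: particle_field_def i)
    have "(\<lambda>k\<in>window m. (\<lambda>k\<in>window m. z (True, j + k)) k + 1) = (\<lambda>k\<in>window m. z (True, j + k) + 1)"
      by auto
    then show "particle_field m \<alpha> F i t (\<lambda>k. z k + 1) = particle_field m \<alpha> F i t z"
      using per[of "\<lambda>k\<in>window m. z (True, j + k)" j t] by (simp add: particle_field_def i)
  next
    fix c j t and z :: "site \<Rightarrow> real"
    show "particle_field m \<alpha> F (c, j + int n) t z = particle_field m \<alpha> F (c, j) t (\<lambda>(c, k). z (c, k + int n))"
      using type by (simp add: particle_field_def add_ac)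
  next
    fix c j t and z :: "site \<Rightarrow> real"
    assume inc: "\<And>c k. z (c, k) \<le> z (c, k + 1)" and eq: "z (c, j) = z (c, j + 1)"
    have "2 * F j t (\<lambda>i\<in>window m. z (True, j + i)) + \<alpha> * z (True, j + 0)
        \<le> 2 * F (j + 1) t (\<lambda>i\<in>window m. z (True, j + (i + 1))) + \<alpha> * z (True, j + 1)"
      by (rule ord[of "\<lambda>i. z (True, j + i)"]) (use inc in \<open>simp add: add.assoc[symmetric]\<close>)
    moreover have "\<alpha> * z (False, j) \<le> \<alpha> * z (False, j + 1)"
      using inc \<open>\<alpha> > 0\<close> by simp
    ultimately show "particle_field m \<alpha> F (c, j) t z \<le> particle_field m \<alpha> F (c, j + 1) t z"
      using eq by (cases c) (simp_all add: particle_field_def right_diff_distrib add_ac)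
  next
    fix j t and z :: "site \<Rightarrow> real"
    show "particle_field m \<alpha> F (False, j) t z - particle_field m \<alpha> F (True, j) t z =
      particle_field m \<alpha> F (False, j) t (\<lambda>(c, k). z (True, k)) - 2 * \<alpha> * (z (False, j) - z (True, j))"
      by (simp add: particle_field_def algebra_simps)
  qed
  then show ?thesis by blast
qed

lemma C1_test_sum:
  assumes a: "\<And>t. t > 0 \<Longrightarrow> (a has_real_derivative a' t) (at t)" "continuous_on {0<..} a'"
    and b: "\<And>x. (b has_real_derivative b' x) (at x)" "continuous_on UNIV b'"
  shows "C1_test (\<lambda>p. a (fst p) + b (snd p)) (\<lambda>p. a' (fst p)) (\<lambda>p. b' (snd p))"
  unfolding C1_test_def
proof (intro conjI ballI)
  show "continuous_on pos_time_space (\<lambda>p. a' (fst p))"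
    by (rule continuous_on_compose2[OF a(2) continuous_on_fst[OF continuous_on_id]]) auto
  show "continuous_on pos_time_space (\<lambda>p. b' (snd p))"
    by (rule continuous_on_compose2[OF b(2) continuous_on_snd[OF continuous_on_id]]) auto
  fix p :: "real \<times> real" assume p: "p \<in> pos_time_space"
  have "(a has_derivative (\<lambda>h. a' (fst p) * h)) (at (fst p))"
    using a(1)[of "fst p"] p by (auto simp: has_field_derivative_def)
  then have "((\<lambda>p. a (fst p)) has_derivative (\<lambda>h. a' (fst p) * fst h)) (at p)"
    by (rule has_derivative_compose[OF has_derivative_fst[OF has_derivative_ident], rotated])
  moreover have "(b has_derivative (\<lambda>h. b' (snd p) * h)) (at (snd p))"
    using b(1)[of "snd p"] by (simp add: has_field_derivative_def)
  then have "((\<lambda>p. b (snd p)) has_derivative (\<lambda>h. b' (snd p) * snd h)) (at p)"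
    by (rule has_derivative_compose[OF has_derivative_snd[OF has_derivative_ident], rotated])
  ultimately show "((\<lambda>p. a (fst p) + b (snd p)) has_derivative (\<lambda>(s, y). a' (fst p) * s + b' (snd p) * y)) (at p)"
    unfolding case_prod_unfold by (rule has_derivative_add)
qed

text \<open>
  The system contains no space derivative, so the steep test functions \<open>\<psi>(t) + k (y - x)\<^sup>2\<close> reduce
  it to ordinary differential inequalities at each fixed \<open>x\<close>.
\<close>

lemma (in cooperative) freeze_space:
  fixes W :: "site \<Rightarrow> real \<times> real \<Rightarrow> real"
  assumes "\<epsilon> > 0" and usc: "\<And>i. usc_on time_space (W i)"
    and cont: "\<And>i z. continuous_on UNIV (\<lambda>t. G i t z)"
    and sub: "\<And>i \<phi> \<phi>\<^sub>t \<phi>\<^sub>x p. C1_test \<phi> \<phi>\<^sub>t \<phi>\<^sub>x \<Longrightarrow> p \<in> pos_time_space \<Longrightarrow>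
      local_max_at (\<lambda>q. W i q - \<phi> q) p \<Longrightarrow> \<phi>\<^sub>t p \<le> G i (fst p / \<epsilon>) (\<lambda>k. W k p / \<epsilon>)"
  shows "visc_sub G (\<lambda>i s. W i (\<epsilon> * s, x) / \<epsilon>)"
  unfolding visc_sub_def
proof (intro conjI allI impI)
  fix i
  have "usc_on {0..} (\<lambda>s. W i (\<epsilon> * s, x) * (1 / \<epsilon>))"
    by (intro usc_on_mult_pos usc_on_compose[OF usc] continuous_intros) (use \<open>\<epsilon> > 0\<close> in auto)
  then show "usc_on {0..} (\<lambda>s. W i (\<epsilon> * s, x) / \<epsilon>)" by simp
next
  fix i \<psi> \<psi>' and t :: real
  assume \<psi>: "\<forall>s>0. (\<psi> has_real_derivative \<psi>' s) (at s)" and \<psi>'_cont: "continuous_on {0<..} \<psi>'"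
    and "t > 0" and max: "\<forall>\<^sub>F s in nhds t. W i (\<epsilon> * s, x) / \<epsilon> - \<psi> s \<le> W i (\<epsilon> * t, x) / \<epsilon> - \<psi> t"
  obtain c j where i: "i = (c, j)" by (cases i)
  define T where "T = \<epsilon> * t"
  have "T > 0" using \<open>\<epsilon> > 0\<close> \<open>t > 0\<close> by (simp add: T_def)
  define A where "A s = \<epsilon> * \<psi> (s / \<epsilon>)" for s
  have A_deriv: "(A has_real_derivative \<psi>' (s / \<epsilon>)) (at s)" if "s > 0" for s
  proof -
    have "(\<psi> has_real_derivative \<psi>' (s / \<epsilon>)) (at (s / \<epsilon>))" using \<psi> that \<open>\<epsilon> > 0\<close> by simp
    moreover have "((\<lambda>s. s / \<epsilon>) has_real_derivative 1 / \<epsilon>) (at s)"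
      using DERIV_cmult_right[OF DERIV_ident, of "1 / \<epsilon>"] by simp
    ultimately have "((\<lambda>s. \<psi> (s / \<epsilon>)) has_real_derivative \<psi>' (s / \<epsilon>) * (1 / \<epsilon>)) (at s)"
      by (rule DERIV_chain2)
    from DERIV_cmult[OF this, of \<epsilon>] show ?thesis using \<open>\<epsilon> > 0\<close> by (simp add: A_def[abs_def])
  qed
  define c0 where "c0 = W i (T, x) - A T"
  obtain d where "d > 0" and d: "\<And>s. \<bar>s - t\<bar> < d \<Longrightarrow> W i (\<epsilon> * s, x) / \<epsilon> - \<psi> s \<le> W i (\<epsilon> * t, x) / \<epsilon> - \<psi> t"
    using max unfolding eventually_nhds_metric by (auto simp: dist_real_def)
  \<comment> \<open>Halving keeps the closed box at positive times and inside the interval where the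
    given local maximum holds.\<close>
  define r where "r = min (T / 2) (\<epsilon> * d / 2)"
  have "r > 0" using \<open>T > 0\<close> \<open>\<epsilon> > 0\<close> \<open>d > 0\<close> by (simp add: r_def)
  have r_le: "r \<le> T / 2" "r \<le> \<epsilon> * d / 2" by (simp_all add: r_def)
  have "0 < \<epsilon> * d" using \<open>\<epsilon> > 0\<close> \<open>d > 0\<close> by simp
  have max': "W i (s, x) - A s \<le> c0" if "\<bar>s - T\<bar> \<le> r" for s
  proof -
    have "\<epsilon> * \<bar>s / \<epsilon> - t\<bar> = \<bar>s - T\<bar>"
      using \<open>\<epsilon> > 0\<close> abs_mult[of \<epsilon> "s / \<epsilon> - t"] by (simp add: T_def right_diff_distrib)
    also have "\<dots> < \<epsilon> * d" using that r_le \<open>0 < \<epsilon> * d\<close> by linarith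
    finally have "\<bar>s / \<epsilon> - t\<bar> < d" using \<open>\<epsilon> > 0\<close> by simp
    from d[OF this] \<open>\<epsilon> > 0\<close> have "\<epsilon> * (W i (s, x) / \<epsilon> - \<psi> (s / \<epsilon>)) \<le> \<epsilon> * (W i (T, x) / \<epsilon> - \<psi> t)"
      by (simp add: T_def)
    then show ?thesis using \<open>\<epsilon> > 0\<close> by (simp add: c0_def A_def T_def right_diff_distrib)
  qed
  define B where "B = {T - r..T + r} \<times> {x - r..x + r}"
  have "compact B" unfolding B_def by (intro compact_Times compact_Icc)
  have "(T, x) \<in> B" using \<open>r > 0\<close> by (simp add: B_def)
  have Bpos: "B \<subseteq> pos_time_space" using \<open>T > 0\<close> r_le by (auto simp: B_def)
  have A_cont: "continuous_on {T - r..T + r} A"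
    by (intro continuous_at_imp_continuous_on ballI DERIV_isCont[OF A_deriv]) (use \<open>T > 0\<close> r_le in auto)
  \<comment> \<open>The term \<open>(fst q - T)\<^sup>2\<close> makes the maximum in time strict,
    which brings the maximisers back to \<open>T\<close>. Its derivative vanishes at
    \<open>T\<close>, so the limiting inequality is not affected.\<close>
  define \<phi> where "\<phi> k q = A (fst q) + (fst q - T)\<^sup>2 + real k * (snd q - x)\<^sup>2" for k q
  define \<phi>\<^sub>t where "\<phi>\<^sub>t q = \<psi>' (fst q / \<epsilon>) + 2 * (fst q - T)" for q :: "real \<times> real"
  define \<phi>\<^sub>x where "\<phi>\<^sub>x k q = real k * (2 * (snd q - x))" for k and q :: "real \<times> real"
  have C1: "C1_test (\<phi> k) \<phi>\<^sub>t (\<phi>\<^sub>x k)" for k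
    unfolding \<phi>_def \<phi>\<^sub>t_def \<phi>\<^sub>x_def
  proof (rule C1_test_sum[where a = "\<lambda>s. A s + (s - T)\<^sup>2" and a' = "\<lambda>s. \<psi>' (s / \<epsilon>) + 2 * (s - T)"
        and b = "\<lambda>y. real k * (y - x)\<^sup>2" and b' = "\<lambda>y. real k * (2 * (y - x))"])
    show "((\<lambda>s. A s + (s - T)\<^sup>2) has_real_derivative \<psi>' (s / \<epsilon>) + 2 * (s - T)) (at s)" if "s > 0" for s
      using A_deriv[OF that] by (auto intro!: derivative_eq_intros)
    show "continuous_on {0<..} (\<lambda>s. \<psi>' (s / \<epsilon>) + 2 * (s - T))"
      by (intro continuous_intros continuous_on_compose2[OF \<psi>'_cont]) (use \<open>\<epsilon> > 0\<close> in auto)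
    show "((\<lambda>y. real k * (y - x)\<^sup>2) has_real_derivative real k * (2 * (y - x))) (at y)" for y
      by (auto intro!: derivative_eq_intros)
  qed (intro continuous_intros)
  define f where "f k q = W i q + - \<phi> k q" for k q
  have f_usc: "usc_on B (f k)" for k
  proof -
    have "continuous_on B (\<phi> k)"
      unfolding \<phi>_def by (intro continuous_intros continuous_on_compose2[OF A_cont]) (auto simp: B_def)
    moreover have "B \<subseteq> time_space" using Bpos by auto
    ultimately show ?thesis unfolding f_def
      by (intro usc_on_add usc_on_subset[OF usc] continuous_on_imp_usc_on continuous_intros)
  qed
  have "B \<noteq> {}" using \<open>(T, x) \<in> B\<close> by auto
  have "\<forall>k. \<exists>q. q \<in> B \<and> (\<forall>q'\<in>B. f k q' \<le> f k q)"
  proof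
    fix k show "\<exists>q. q \<in> B \<and> (\<forall>q'\<in>B. f k q' \<le> f k q)"
      by (rule usc_on_attains_sup[OF \<open>compact B\<close> \<open>B \<noteq> {}\<close> f_usc[of k]]) blast
  qed
  from choice[OF this] obtain q where q: "\<And>k. q k \<in> B" "\<And>k q'. q' \<in> B \<Longrightarrow> f k q' \<le> f k (q k)" by blast
  have f_ge: "c0 \<le> f k (q k)" for k
    using q(2)[OF \<open>(T, x) \<in> B\<close>, of k] by (simp add: f_def \<phi>_def c0_def)
  obtain qm where "qm \<in> B" and qm: "\<And>q. q \<in> B \<Longrightarrow> f 0 q \<le> f 0 qm"
    by (rule usc_on_attains_sup[OF \<open>compact B\<close> \<open>B \<noteq> {}\<close> f_usc[of 0]]) blast
  \<comment> \<open>Comparison with the maximum for \<open>k = 0\<close> bounds the penalty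
    uniformly in \<open>k\<close>; this drives the space coordinates to \<open>x\<close>.\<close>
  have pen: "real k * (snd (q k) - x)\<^sup>2 \<le> f 0 qm - c0" for k
    using f_ge[of k] qm[OF q(1)[of k]] by (simp add: f_def \<phi>_def)
  obtain l \<sigma> where "l \<in> B" and \<sigma>: "strict_mono (\<sigma> :: nat \<Rightarrow> nat)" and lim: "(q \<circ> \<sigma>) \<longlonglongrightarrow> l"
    by (rule seq_compactE[OF compact_imp_seq_compact[OF \<open>compact B\<close>], of q]) (use q(1) in auto)
  have lim1: "(\<lambda>k. fst (q (\<sigma> k))) \<longlonglongrightarrow> fst l" and lim2: "(\<lambda>k. snd (q (\<sigma> k))) \<longlonglongrightarrow> snd l"
    using tendsto_fst[OF lim] tendsto_snd[OF lim] by (simp_all add: o_def)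
  have "snd l = x"
  proof -
    have "(\<lambda>k. (f 0 qm - c0) / real (\<sigma> k)) \<longlonglongrightarrow> 0"
      by (intro tendsto_divide_0[OF tendsto_const] filterlim_at_top_imp_at_infinity
        filterlim_compose[OF filterlim_real_sequentially filterlim_subseq[OF \<sigma>]])
    moreover have "\<forall>\<^sub>F k in sequentially. norm ((snd (q (\<sigma> k)) - x)\<^sup>2) \<le> (f 0 qm - c0) / real (\<sigma> k)"
      using eventually_gt_at_top[of 0]
    proof eventually_elim
      case (elim k)
      then have "\<sigma> k > 0" using seq_suble[OF \<sigma>, of k] by linarith
      with pen[of "\<sigma> k"] show ?case by (simp add: field_simps)
    qed
    ultimately have "(\<lambda>k. (snd (q (\<sigma> k)) - x)\<^sup>2) \<longlonglongrightarrow> 0" by (rule Lim_null_comparison[rotated])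
    moreover have "(\<lambda>k. (snd (q (\<sigma> k)) - x)\<^sup>2) \<longlonglongrightarrow> (snd l - x)\<^sup>2"
      by (intro tendsto_intros lim2)
    ultimately have "(snd l - x)\<^sup>2 = 0" by (rule LIMSEQ_unique[rotated])
    then show ?thesis by simp
  qed
  have A_lim: "(\<lambda>k. A (fst (q (\<sigma> k)))) \<longlonglongrightarrow> A (fst l)"
    by (rule continuous_on_tendsto_compose[OF A_cont lim1]) (use q(1) \<open>l \<in> B\<close> in \<open>auto simp: B_def mem_Times_iff\<close>)
  have eventually_less: "\<forall>\<^sub>F k in sequentially. W i' (q (\<sigma> k)) < a" if less: "W i' l < a" for i' a
  proof -
    have "l \<in> time_space" using \<open>l \<in> B\<close> Bpos by auto
    then obtain O' where O': "open O'" "l \<in> O'" "\<And>q. q \<in> O' \<Longrightarrow> q \<in> time_space \<Longrightarrow> W i' q < a"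
      by (rule usc_onD[OF usc _ less]) (rule that)
    have "\<forall>\<^sub>F k in sequentially. (q \<circ> \<sigma>) k \<in> O'" by (rule topological_tendstoD[OF lim O'(1,2)])
    then show ?thesis
    proof eventually_elim
      case (elim k)
      then show ?case using O'(3) q(1)[of "\<sigma> k"] Bpos by fastforce
    qed
  qed
  have f_le: "c0 \<le> W i (q (\<sigma> k)) - A (fst (q (\<sigma> k))) - (fst (q (\<sigma> k)) - T)\<^sup>2" for k
  proof -
    have "0 \<le> real (\<sigma> k) * (snd (q (\<sigma> k)) - x)\<^sup>2" by simp
    with f_ge[of "\<sigma> k"] show ?thesis unfolding f_def \<phi>_def by linarith
  qed
  \<comment> \<open>Upper semicontinuity preserves this lower bound in the limit. Together with
    \<open>max'\<close> it forces the limit point to be \<open>(T, x)\<close>.\<close>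
  have "c0 \<le> W i l - A (fst l) - (fst l - T)\<^sup>2"
  proof (rule field_le_epsilon)
    fix e :: real assume "e > 0"
    have "(\<lambda>k. (W i l + e) - A (fst (q (\<sigma> k))) - (fst (q (\<sigma> k)) - T)\<^sup>2) \<longlonglongrightarrow> (W i l + e) - A (fst l) - (fst l - T)\<^sup>2"
      by (intro tendsto_intros A_lim lim1)
    moreover have "\<forall>\<^sub>F k in sequentially. c0 \<le> (W i l + e) - A (fst (q (\<sigma> k))) - (fst (q (\<sigma> k)) - T)\<^sup>2"
      using eventually_less[of i "W i l + e", simplified, OF \<open>e > 0\<close>]
    proof eventually_elim
      case (elim k)
      then show ?case using f_le[of k] by linarith
    qed
    ultimately have "c0 \<le> (W i l + e) - A (fst l) - (fst l - T)\<^sup>2"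
      by (intro tendsto_lowerbound) auto
    then show "c0 \<le> W i l - A (fst l) - (fst l - T)\<^sup>2 + e" by simp
  qed
  moreover have "W i l - A (fst l) \<le> c0"
    using max'[of "fst l"] \<open>l \<in> B\<close> \<open>snd l = x\<close> by (cases l) (auto simp: B_def abs_le_iff)
  ultimately have "(fst l - T)\<^sup>2 \<le> 0" by linarith
  then have l: "l = (T, x)" using \<open>snd l = x\<close> by (cases l) simp
  define z0 where "z0 k = W k (T, x) / \<epsilon>" for k
  have "\<psi>' t \<le> G i t z0 + Lg * \<eta>" if "\<eta> > 0" for \<eta>
  proof -
    define I where "I = (UNIV :: bool set) \<times> {j - int m..j + int m}"
    have "\<forall>\<^sub>F k in sequentially. \<forall>i'\<in>I. W i' (q (\<sigma> k)) < W i' l + \<epsilon> * \<eta>"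
      using \<open>\<epsilon> > 0\<close> \<open>\<eta> > 0\<close> by (intro eventually_ball_finite ballI eventually_less) (auto simp: I_def)
    moreover have "\<forall>\<^sub>F k in sequentially. A (fst (q (\<sigma> k))) > A T - \<epsilon> * \<eta>"
      using order_tendstoD(1)[OF A_lim, of "A T - \<epsilon> * \<eta>"] l \<open>\<epsilon> > 0\<close> \<open>\<eta> > 0\<close> by simp
    moreover have "\<forall>\<^sub>F k in sequentially. (q \<circ> \<sigma>) k \<in> {T - r<..<T + r} \<times> {x - r<..<x + r}"
      by (rule topological_tendstoD[OF lim]) (use l \<open>r > 0\<close> in \<open>auto intro: open_Times\<close>)
    ultimately have "\<forall>\<^sub>F k in sequentially. \<phi>\<^sub>t (q (\<sigma> k)) \<le> G i (fst (q (\<sigma> k)) / \<epsilon>) z0 + Lg * \<eta>"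
    proof eventually_elim
      case (elim k)
      define p where "p = q (\<sigma> k)"
      have ge: "c0 \<le> W i p - A (fst p)"
        using f_le[of k] zero_le_power2[of "fst (q (\<sigma> k)) - T"] unfolding p_def by linarith
      have p_in: "p \<in> {T - r<..<T + r} \<times> {x - r<..<x + r}" using elim(3) by (simp add: p_def)
      have "\<forall>\<^sub>F q' in nhds p. q' \<in> {T - r<..<T + r} \<times> {x - r<..<x + r}"
        by (rule eventually_nhds_in_open[OF _ p_in]) (auto intro: open_Times)
      then have "local_max_at (\<lambda>q. W i q - \<phi> (\<sigma> k) q) p"
        unfolding local_max_at_def
      proof eventually_elim
        case (elim q')
        then have "q' \<in> B" by (auto simp: B_def)
        from q(2)[OF this, of "\<sigma> k"] show ?case by (simp add: f_def p_def)
      qed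
      from sub[OF C1 _ this] have "\<phi>\<^sub>t p \<le> G i (fst p / \<epsilon>) (\<lambda>k. W k p / \<epsilon>)"
        using q(1) Bpos by (auto simp: p_def)
      \<comment> \<open>At the other sites semicontinuity gives only upper bounds, so these unknowns
        are raised to at least \<open>z0 k + \<eta>\<close>, which quasimonotonicity permits. The
        unknown at \<open>i\<close> itself is also bounded below, by \<open>ge\<close>. Thus the new
        state is within \<open>\<eta>\<close> of \<open>z0\<close> on the whole neighbourhood
        \<open>I\<close>.\<close>
      also have "\<dots> \<le> G i (fst p / \<epsilon>) (\<lambda>k. if k = i then W k p / \<epsilon> else max (W k p / \<epsilon>) (z0 k + \<eta>))"
        by (rule quasimono) auto
      also have "\<dots> \<le> G i (fst p / \<epsilon>) z0 + Lg * \<eta>"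
      proof -
        have near: "\<bar>(if k = i then W k p / \<epsilon> else max (W k p / \<epsilon>) (z0 k + \<eta>)) - z0 k\<bar> \<le> \<eta>" if "k \<in> I" for k
        proof -
          have up: "W k p / \<epsilon> < z0 k + \<eta>"
            using elim(1) that \<open>\<epsilon> > 0\<close> by (auto simp: p_def z0_def l field_simps)
          have "W i p > W i (T, x) - \<epsilon> * \<eta>" using elim(2) ge by (simp add: c0_def p_def)
          then have "(W i (T, x) - \<epsilon> * \<eta>) / \<epsilon> < W i p / \<epsilon>"
            using \<open>\<epsilon> > 0\<close> by (rule divide_strict_right_mono)
          then have "W i p / \<epsilon> > z0 i - \<eta>" using \<open>\<epsilon> > 0\<close> by (simp add: z0_def diff_divide_distrib)
          with up show ?thesis using \<open>\<eta> > 0\<close> by (auto simp: max_def)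
        qed
        have "\<bar>G (c, j) (fst p / \<epsilon>) (\<lambda>k. if k = i then W k p / \<epsilon> else max (W k p / \<epsilon>) (z0 k + \<eta>))
            - G (c, j) (fst p / \<epsilon>) z0\<bar> \<le> Lg * \<eta>"
          by (rule lip) (rule near, auto simp: I_def)
        then show ?thesis unfolding i by linarith
      qed
      finally show ?case by (simp add: p_def)
    qed
    moreover have "(\<lambda>k. fst (q (\<sigma> k)) / \<epsilon>) \<longlonglongrightarrow> t"
      using tendsto_divide[OF lim1 tendsto_const, of \<epsilon>] \<open>\<epsilon> > 0\<close> by (simp add: l T_def)
    moreover from this have "(\<lambda>k. G i (fst (q (\<sigma> k)) / \<epsilon>) z0 + Lg * \<eta>) \<longlonglongrightarrow> G i t z0 + Lg * \<eta>"
      by (intro tendsto_intros continuous_on_tendsto_compose[OF cont]) auto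
    moreover have "(\<lambda>k. \<phi>\<^sub>t (q (\<sigma> k))) \<longlonglongrightarrow> \<psi>' t + 2 * (T - T)"
      unfolding \<phi>\<^sub>t_def
    proof (intro tendsto_intros continuous_on_tendsto_compose[OF \<psi>'_cont])
      show "\<forall>\<^sub>F k in sequentially. fst (q (\<sigma> k)) / \<epsilon> \<in> {0<..}"
        using q(1) Bpos \<open>\<epsilon> > 0\<close> by (auto simp: mem_Times_iff subset_iff)
    qed (use \<open>t > 0\<close> lim1 l calculation in auto)
    ultimately show ?thesis
      by (intro tendsto_le[of sequentially "\<lambda>k. G i (fst (q (\<sigma> k)) / \<epsilon>) z0 + Lg * \<eta>" _ "\<lambda>k. \<phi>\<^sub>t (q (\<sigma> k))"]) auto
  qed
  then have eps: "\<psi>' t \<le> G i t z0 + Lg * \<eta>" if "\<eta> > 0" for \<eta> using that .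
  have "\<psi>' t \<le> G i t z0 + e" if "e > 0" for e
  proof -
    have "Lg * (e / (Lg + 1)) \<le> e" using Lg_nonneg that by (simp add: field_simps)
    moreover have "e / (Lg + 1) > 0" using Lg_nonneg that by simp
    ultimately show ?thesis using eps[of "e / (Lg + 1)"] by linarith
  qed
  then have "\<psi>' t \<le> G i t z0" by (rule field_le_epsilon)
  then show "\<psi>' t \<le> G i t (\<lambda>k. W k (\<epsilon> * t, x) / \<epsilon>)" by (simp add: z0_def[abs_def] T_def)
qed

section \<open>Semicontinuous envelopes\<close>

lemma locally_bddE:
  assumes "locally_bdd f" "p \<in> time_space"
  obtains B where "\<forall>\<^sub>F q in inf (nhds p) (principal time_space). \<bar>f q\<bar> \<le> B"
proof -
  obtain r where "r > 0" "bounded (f ` (ball p r \<inter> time_space))"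
    using assms unfolding locally_bdd_def by blast
  then obtain B where bound: "\<forall>y\<in>f ` (ball p r \<inter> time_space). norm y \<le> B"
    unfolding bounded_iff by blast
  then have B: "\<bar>f q\<bar> \<le> B" if "q \<in> ball p r \<inter> time_space" for q
    using bspec[OF bound imageI[OF that]] by simp
  have "\<forall>\<^sub>F q in nhds p. q \<in> ball p r"
    using \<open>r > 0\<close> by (intro eventually_nhds_in_open) auto
  then have "\<forall>\<^sub>F q in inf (nhds p) (principal time_space). \<bar>f q\<bar> \<le> B"
    unfolding eventually_inf_principal by eventually_elim (use B in auto)
  with that show thesis by blast
qed

text \<open>Local boundedness keeps the limit superior finite, so that the conversion from extended
  reals is faithful. The value at \<open>p\<close> enters because the filter does not exclude
  \<open>p\<close>.\<close>

lemma Limsup_envelope: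
  assumes "locally_bdd f" "p \<in> time_space"
  shows "Limsup (inf (nhds p) (principal time_space)) (\<lambda>q. ereal (f q)) = ereal (usc_envelope f p)"
    and "f p \<le> usc_envelope f p"
proof -
  define X where "X = Limsup (inf (nhds p) (principal time_space)) (\<lambda>q. ereal (f q))"
  obtain B where B: "\<forall>\<^sub>F q in inf (nhds p) (principal time_space). \<bar>f q\<bar> \<le> B"
    by (rule locally_bddE[OF assms])
  have "X \<le> ereal B"
    unfolding X_def by (rule Limsup_bounded) (use B in \<open>auto elim: eventually_mono\<close>)
  moreover have "ereal (f p) \<le> X"
    unfolding X_def Limsup_def
  proof (rule INF_greatest)
    fix P assume "P \<in> {P. eventually P (inf (nhds p) (principal time_space))}"
    then have "P p" using assms(2) unfolding mem_Collect_eq eventually_inf_principal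
      by (auto dest: eventually_nhds_x_imp_x)
    then show "ereal (f p) \<le> (SUP q\<in>Collect P. ereal (f q))" by (intro SUP_upper) simp
  qed
  moreover have "usc_envelope f p = real_of_ereal X" by (simp add: usc_envelope_def X_def)
  ultimately have "X = ereal (usc_envelope f p) \<and> f p \<le> usc_envelope f p" by (cases X) auto
  then show "Limsup (inf (nhds p) (principal time_space)) (\<lambda>q. ereal (f q)) = ereal (usc_envelope f p)"
    "f p \<le> usc_envelope f p" by (simp_all add: X_def)
qed

lemma usc_envelope_le:
  assumes "locally_bdd f" "p \<in> time_space" "\<forall>\<^sub>F q in inf (nhds p) (principal time_space). f q \<le> b"
  shows "usc_envelope f p \<le> b"
proof -
  have "Limsup (inf (nhds p) (principal time_space)) (\<lambda>q. ereal (f q)) \<le> ereal b"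
    by (rule Limsup_bounded) (use assms(3) in \<open>auto elim: eventually_mono\<close>)
  then show ?thesis using Limsup_envelope(1)[OF assms(1,2)] by simp
qed

lemma lsc_envelope_eq: "lsc_envelope f p = - usc_envelope (\<lambda>q. - f q) p"
  using ereal_Liminf_uminus[of "inf (nhds p) (principal time_space)" "\<lambda>q. ereal (- f q)"]
  by (simp add: lsc_envelope_def usc_envelope_def)

lemma locally_bdd_uminus:
  assumes "locally_bdd f" shows "locally_bdd (\<lambda>q. - f q)"
  unfolding locally_bdd_def
proof
  fix p assume "p \<in> time_space"
  then obtain r where "r > 0" "bounded (f ` (ball p r \<inter> time_space))"
    using assms unfolding locally_bdd_def by blast
  then have "bounded (uminus ` f ` (ball p r \<inter> time_space))" by (simp add: bounded_uminus)
  then show "\<exists>r>0. bounded ((\<lambda>q. - f q) ` (ball p r \<inter> time_space))"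
    using \<open>r > 0\<close> by (auto simp: image_image)
qed

lemma lsc_envelope_le:
  assumes "locally_bdd f" "p \<in> time_space" shows "lsc_envelope f p \<le> f p"
  using Limsup_envelope(2)[OF locally_bdd_uminus[OF assms(1)] assms(2)] by (simp add: lsc_envelope_eq)

lemma envelope_continuous:
  assumes f: "continuous_on time_space f" and p: "p \<in> time_space"
  shows "locally_bdd f" and "usc_envelope f p = f p" and "lsc_envelope f p = f p"
proof -
  have ev: "\<forall>\<^sub>F q in inf (nhds p) (principal time_space). g q < g p + e"
    if "continuous_on time_space g" "e > 0" "p \<in> time_space" for g :: "real \<times> real \<Rightarrow> real" and e p
  proof -
    have "(g \<longlongrightarrow> g p) (at p within time_space)" using that unfolding continuous_on_def by blast
    from order_tendstoD(2)[OF this, of "g p + e"] \<open>e > 0\<close>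
    have "\<forall>\<^sub>F q in at p within time_space. g q < g p + e" by simp
    then show ?thesis
      unfolding eventually_inf_principal at_within_def
      using \<open>e > 0\<close> by (auto simp: eventually_inf_principal elim!: eventually_mono)
  qed
  have bdd: "locally_bdd g" if g: "continuous_on time_space g" for g
    unfolding locally_bdd_def
  proof
    fix p assume p: "p \<in> time_space"
    have "\<forall>\<^sub>F q in inf (nhds p) (principal time_space). g q < g p + 1" by (rule ev[OF g _ p]) simp
    moreover have "\<forall>\<^sub>F q in inf (nhds p) (principal time_space). - g q < - g p + 1"
      by (rule ev[OF continuous_on_minus[OF g] _ p]) simp
    ultimately have "\<forall>\<^sub>F q in inf (nhds p) (principal time_space). \<bar>g q\<bar> \<le> \<bar>g p\<bar> + 1"
      by eventually_elim linarith
    then obtain r where "r > 0" "\<And>q. dist q p < r \<Longrightarrow> q \<in> time_space \<Longrightarrow> \<bar>g q\<bar> \<le> \<bar>g p\<bar> + 1"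
      unfolding eventually_inf_principal eventually_nhds_metric by blast
    then show "\<exists>r>0. bounded (g ` (ball p r \<inter> time_space))"
      by (intro exI[of _ r]) (auto simp: bounded_iff dist_commute intro!: exI[of _ "\<bar>g p\<bar> + 1"])
  qed
  show "locally_bdd f" by (rule bdd[OF f])
  have eq: "usc_envelope g p = g p" if g: "continuous_on time_space g" for g
  proof (rule antisym)
    show "usc_envelope g p \<le> g p"
    proof (rule field_le_epsilon)
      fix e :: real assume "e > 0"
      show "usc_envelope g p \<le> g p + e"
        by (rule usc_envelope_le[OF bdd[OF g] p]) (use ev[OF g \<open>e > 0\<close> p] in \<open>auto elim: eventually_mono\<close>)
    qed
  qed (rule Limsup_envelope(2)[OF bdd[OF g] p])
  show "usc_envelope f p = f p" by (rule eq[OF f])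
  show "lsc_envelope f p = f p"
    using eq[OF continuous_on_minus[OF f]] by (simp add: lsc_envelope_eq)
qed

section \<open>Viscosity solutions of the system solve the particle system at each point\<close>

lemma local_max_at_uminus: "local_max_at (\<lambda>q. - f q - \<phi> q) p \<longleftrightarrow> local_min_at (\<lambda>q. f q - (- \<phi> q)) p"
proof -
  have "(- f q - \<phi> q \<le> - f p - \<phi> p) = (f p - (- \<phi> p) \<le> f q - (- \<phi> q))" for q by linarith
  then show ?thesis unfolding local_max_at_def local_min_at_def by simp
qed

lemma C1_test_uminus:
  assumes "C1_test \<phi> \<phi>\<^sub>t \<phi>\<^sub>x"
  shows "C1_test (\<lambda>q. - \<phi> q) (\<lambda>q. - \<phi>\<^sub>t q) (\<lambda>q. - \<phi>\<^sub>x q)"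
  unfolding C1_test_def
proof (intro conjI ballI)
  fix p assume "p \<in> pos_time_space"
  then have "(\<phi> has_derivative (\<lambda>(s, y). \<phi>\<^sub>t p * s + \<phi>\<^sub>x p * y)) (at p)"
    using assms unfolding C1_test_def by blast
  from has_derivative_minus[OF this]
  show "((\<lambda>q. - \<phi> q) has_derivative (\<lambda>(s, y). - \<phi>\<^sub>t p * s + - \<phi>\<^sub>x p * y)) (at p)"
    by (simp add: case_prod_unfold)
qed (use assms in \<open>auto simp: C1_test_def intro!: continuous_intros\<close>)

lemma lower_semicont_iff_usc_on: "lower_semicont f \<longleftrightarrow> usc_on time_space (\<lambda>q. - f q)"
proof -
  have "(\<forall>a. a < f p \<longrightarrow> (\<forall>\<^sub>F q in at p within time_space. a < f q)) \<longleftrightarrow>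
      (\<forall>a. - f p < a \<longrightarrow> (\<forall>\<^sub>F q in at p within time_space. - f q < a))" for p
  proof (intro iffI allI impI)
    fix a assume *: "\<forall>a. a < f p \<longrightarrow> (\<forall>\<^sub>F q in at p within time_space. a < f q)" and "- f p < a"
    then have "\<forall>\<^sub>F q in at p within time_space. - a < f q" by (intro *[rule_format]) simp
    then show "\<forall>\<^sub>F q in at p within time_space. - f q < a" by eventually_elim simp
  next
    fix a assume *: "\<forall>a. - f p < a \<longrightarrow> (\<forall>\<^sub>F q in at p within time_space. - f q < a)" and "a < f p"
    then have "\<forall>\<^sub>F q in at p within time_space. - f q < - a" by (intro *[rule_format]) simp
    then show "\<forall>\<^sub>F q in at p within time_space. a < f q" by eventually_elim simp
  qed
  then show ?thesis unfolding lower_semicont_def usc_on_def by simp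
qed

text \<open>A bound is given for each \<open>j\<close> separately, but uniformly in
  \<open>x\<close>. Every index is a translate in \<open>x\<close> of one of \<open>n\<close>
  representatives, so the sum of their constants serves all \<open>j\<close>; comparison over
  infinitely many sites requires this uniformity.\<close>

lemma near_initial_uniform:
  assumes "n \<ge> 1" and u: "shift_periodic n \<epsilon> u"
    and ini: "\<And>j x. u_ini (j + int n) x = u_ini j (x + \<epsilon>)"
    and near: "\<And>j. locally_bdd (u j) \<and> continuous_on UNIV (u_ini j) \<and> near_initial (u_ini j) (u j)" and "T > 0"
  shows "\<exists>C. \<forall>j. \<forall>t\<in>{0..T}. \<forall>x. \<bar>u j (t, x) - u_ini j x\<bar> \<le> C"
proof -
  have shift: "u (r + q * int n) (t, x) = u r (t, x + of_int q * \<epsilon>) \<and> u_ini (r + q * int n) x = u_ini r (x + of_int q * \<epsilon>)"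
    if "t \<ge> 0" for r q t x
  proof (induction q arbitrary: x rule: int_induct[where k = 0])
    case (step1 q)
    have *: "r + (q + 1) * int n = (r + q * int n) + int n" by (simp add: algebra_simps)
    have "u (r + (q + 1) * int n) (t, x) = u (r + q * int n) (t, x + \<epsilon>)"
      "u_ini (r + (q + 1) * int n) x = u_ini (r + q * int n) (x + \<epsilon>)"
      unfolding * using u ini that by (simp_all add: shift_periodic_def)
    then show ?case using step1(2)[of "x + \<epsilon>"] by (simp add: algebra_simps)
  next
    case (step2 q)
    have *: "r + q * int n = (r + (q - 1) * int n) + int n" by (simp add: algebra_simps)
    have "u (r + (q - 1) * int n) (t, x) = u (r + q * int n) (t, x - \<epsilon>)"
      "u_ini (r + (q - 1) * int n) x = u_ini (r + q * int n) (x - \<epsilon>)"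
      unfolding * using u ini that by (simp_all add: shift_periodic_def)
    then show ?case using step2(2)[of "x - \<epsilon>"] by (simp add: algebra_simps)
  qed simp
  have "\<forall>j. \<exists>C. \<forall>t\<in>{0..T}. \<forall>x. \<bar>u j (t, x) - u_ini j x\<bar> \<le> C"
    using near \<open>T > 0\<close> unfolding near_initial_def by blast
  from choice[OF this] obtain C where C: "\<And>j t x. t \<in> {0..T} \<Longrightarrow> \<bar>u j (t, x) - u_ini j x\<bar> \<le> C j" by blast
  have "\<bar>u j (t, x) - u_ini j x\<bar> \<le> (\<Sum>r\<in>{0..<int n}. \<bar>C r\<bar>)" if t: "t \<in> {0..T}" for j t x
  proof -
    define r where "r = j mod int n"
    have r: "r \<in> {0..<int n}" using \<open>n \<ge> 1\<close> by (simp add: r_def)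
    have "j = r + (j div int n) * int n" by (simp add: r_def)
    then have "u j (t, x) = u r (t, x + of_int (j div int n) * \<epsilon>)" "u_ini j x = u_ini r (x + of_int (j div int n) * \<epsilon>)"
      using shift[of t r "j div int n" x] t by auto
    then have "\<bar>u j (t, x) - u_ini j x\<bar> \<le> \<bar>C r\<bar>" using C[OF t, of r "x + of_int (j div int n) * \<epsilon>"] by simp
    also have "\<dots> \<le> (\<Sum>r\<in>{0..<int n}. \<bar>C r\<bar>)" using r by (intro member_le_sum) auto
    finally show ?thesis .
  qed
  then show ?thesis by blast
qed

text \<open>The final time is excluded because the envelope at \<open>t\<close> also sees slightly
  later times, where the bound on \<open>f\<close> must still hold.\<close>

lemma envelope_uniform_bounds:
  assumes f: "locally_bdd f" and g: "continuous_on UNIV g" and "t \<in> {0..<T}"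
    and C: "\<And>t x. t \<in> {0..T} \<Longrightarrow> \<bar>f (t, x) - g x\<bar> \<le> C"
  shows "usc_envelope f (t, x) \<le> g x + C" and "g x - C \<le> lsc_envelope f (t, x)"
proof -
  have *: "usc_envelope f (t, x) \<le> g x + C"
    if f: "locally_bdd f" and g: "continuous_on UNIV g" and C: "\<And>t x. t \<in> {0..T} \<Longrightarrow> \<bar>f (t, x) - g x\<bar> \<le> C" for f g
  proof (rule field_le_epsilon)
    fix e :: real assume "e > 0"
    have "open {q::real \<times> real. g (snd q) < g x + e}"
      by (intro open_Collect_less continuous_intros continuous_on_compose2[OF g]) auto
    then have "\<forall>\<^sub>F q in nhds (t, x). q \<in> {q. g (snd q) < g x + e}"
      by (rule eventually_nhds_in_open) (use \<open>e > 0\<close> in simp)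
    moreover have "\<forall>\<^sub>F q in nhds (t, x). q \<in> {..<T} \<times> UNIV"
      using \<open>t \<in> {0..<T}\<close> by (intro eventually_nhds_in_open open_Times) auto
    ultimately have ev: "\<forall>\<^sub>F q in inf (nhds (t, x)) (principal time_space). f q \<le> g x + C + e"
      unfolding eventually_inf_principal
    proof eventually_elim
      case (elim q)
      show ?case
      proof
        assume "q \<in> time_space"
        then have "\<bar>f q - g (snd q)\<bar> \<le> C" using C[of "fst q" "snd q"] elim by (cases q) auto
        then show "f q \<le> g x + C + e" using elim by auto
      qed
    qed
    show "usc_envelope f (t, x) \<le> g x + C + e"
      by (rule usc_envelope_le[OF f _ ev]) (use \<open>t \<in> {0..<T}\<close> in auto)
  qed
  show "usc_envelope f (t, x) \<le> g x + C" by (rule *[OF f g C])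
  have "usc_envelope (\<lambda>q. - f q) (t, x) \<le> - g x + C"
    by (rule *[OF locally_bdd_uminus[OF f] continuous_on_minus[OF g]]) (use C in \<open>simp add: abs_minus_commute\<close>)
  then show "g x - C \<le> lsc_envelope f (t, x)" by (simp add: lsc_envelope_eq)
qed


text \<open>Frozen at \<open>x\<close> and rescaled, the upper envelopes form a subsolution of the
  particle system and the negated lower envelopes one of the dual system. Comparison with the
  classical solution \<open>z\<close> puts the upper envelope below it and the lower envelope above
  it, and the given functions lie in between.\<close>

theorem system_solution_eq_particles:
  assumes lattice: "ordered_lattice (particle_field m \<alpha> F) m Lg n \<alpha>" and "\<epsilon> > 0"
    and sys: "is_system_solution n m \<alpha> F \<epsilon> u_ini \<xi>_ini u \<xi>"
    and cont: "\<And>j. continuous_on UNIV (u_ini j)" "\<And>j. continuous_on UNIV (\<xi>_ini j)"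
    and shift: "\<And>j x. u_ini (j + int n) x = u_ini j (x + \<epsilon>)" "\<And>j x. \<xi>_ini (j + int n) x = \<xi>_ini j (x + \<epsilon>)"
    and z: "ordered_lattice.solution (particle_field m \<alpha> F) z"
    and z0: "\<And>j. z (True, j) 0 = u_ini j x / \<epsilon>" "\<And>j. z (False, j) 0 = \<xi>_ini j x / \<epsilon>"
    and "t \<ge> 0"
  shows "u j (\<epsilon> * t, x) = \<epsilon> * z (True, j) t" "\<xi> j (\<epsilon> * t, x) = \<epsilon> * z (False, j) t"
proof -
  interpret ordered_lattice "particle_field m \<alpha> F" m Lg n \<alpha> by (rule lattice)
  interpret dual: cooperative dual_field m Lg by (rule cooperative_dual)
  define W where "W = (\<lambda>(c, j). if c then u j else \<xi> j)"
  define ini where "ini = (\<lambda>(c, j). if c then u_ini j else \<xi>_ini j)"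
  have W_simps: "W (True, j) = u j" "W (False, j) = \<xi> j" for j by (simp_all add: W_def)
  have visc: "system_viscosity_solution n m \<alpha> F \<epsilon> u_ini \<xi>_ini u \<xi>"
    and near: "\<And>j. near_initial (u_ini j) (u j)" "\<And>j. near_initial (\<xi>_ini j) (\<xi> j)"
    using sys unfolding is_system_solution_def by blast+
  have sub: "system_subsolution n m \<alpha> F \<epsilon> u_ini \<xi>_ini (\<lambda>j. usc_envelope (u j)) (\<lambda>j. usc_envelope (\<xi> j))"
    and super: "system_supersolution n m \<alpha> F \<epsilon> u_ini \<xi>_ini (\<lambda>j. lsc_envelope (u j)) (\<lambda>j. lsc_envelope (\<xi> j))"
    and bdd: "\<And>j. locally_bdd (u j)" "\<And>j. locally_bdd (\<xi> j)"
    and per: "shift_periodic n \<epsilon> u" "shift_periodic n \<epsilon> \<xi>"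
    using visc unfolding system_viscosity_solution_def by blast+
  have W_bdd: "locally_bdd (W i)" for i using bdd by (cases i) (simp add: W_def)
  have ini_cont: "continuous_on UNIV (ini i)" for i using cont by (cases i) (simp add: ini_def)
  have ini_z: "ini i x = \<epsilon> * z i 0" for i
    using z0 \<open>\<epsilon> > 0\<close> by (cases i) (simp add: ini_def)
  have W_near: "\<exists>C. \<forall>i. \<forall>t\<in>{0..T}. \<forall>x. \<bar>W i (t, x) - ini i x\<bar> \<le> C" if T: "T > 0" for T
  proof -
    obtain C1 where C1: "\<And>j t x. t \<in> {0..T} \<Longrightarrow> \<bar>u j (t, x) - u_ini j x\<bar> \<le> C1"
      using near_initial_uniform[of n \<epsilon> u u_ini, OF n_pos per(1) shift(1) _ T] bdd(1) cont(1) near(1) by blast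
    obtain C2 where C2: "\<And>j t x. t \<in> {0..T} \<Longrightarrow> \<bar>\<xi> j (t, x) - \<xi>_ini j x\<bar> \<le> C2"
      using near_initial_uniform[of n \<epsilon> \<xi> \<xi>_ini, OF n_pos per(2) shift(2) _ T] bdd(2) cont(2) near(2) by blast
    have "\<bar>W i (t, x) - ini i x\<bar> \<le> max C1 C2" if "t \<in> {0..T}" for i t x
      using C1[OF that] C2[OF that] by (cases i) (auto simp: W_def ini_def le_max_iff_disj)
    then show ?thesis by blast
  qed
  have growth: "\<exists>C. \<forall>i. \<forall>t\<in>{0..T}. usc_envelope (W i) (\<epsilon> * t, x) \<le> ini i x + C \<and> ini i x - C \<le> lsc_envelope (W i) (\<epsilon> * t, x)" for T
  proof -
    \<comment> \<open>The sign of \<open>T\<close> is arbitrary, hence the absolute value; the added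
      unit provides the strictly later final time that \<open>envelope_uniform_bounds\<close>
      requires.\<close>
    have "\<epsilon> * \<bar>T\<bar> + 1 > 0" using \<open>\<epsilon> > 0\<close> by (simp add: add_nonneg_pos)
    from W_near[OF this] obtain C where C: "\<And>i t x. t \<in> {0..\<epsilon> * \<bar>T\<bar> + 1} \<Longrightarrow> \<bar>W i (t, x) - ini i x\<bar> \<le> C" by blast
    have "usc_envelope (W i) (\<epsilon> * t, x) \<le> ini i x + C \<and> ini i x - C \<le> lsc_envelope (W i) (\<epsilon> * t, x)"
      if t: "t \<in> {0..T}" for i t
    proof -
      have "\<epsilon> * t \<le> \<epsilon> * \<bar>T\<bar>" using t \<open>\<epsilon> > 0\<close> by (intro mult_left_mono) auto
      then have "\<epsilon> * t < \<epsilon> * \<bar>T\<bar> + 1" by linarith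
      moreover have "0 \<le> \<epsilon> * t" using t \<open>\<epsilon> > 0\<close> by simp
      ultimately have "\<epsilon> * t \<in> {0..<\<epsilon> * \<bar>T\<bar> + 1}" unfolding atLeastLessThan_iff by blast
      from envelope_uniform_bounds[OF W_bdd ini_cont this C] show ?thesis by simp
    qed
    then show ?thesis by blast
  qed
  have z_growth: "\<exists>C. \<forall>c j. \<forall>t\<in>{0..T}. \<bar>ini (c, j) x\<bar> / \<epsilon> + \<bar>z (c, j) t\<bar> + B / \<epsilon> \<le> C * (1 + \<bar>real_of_int j\<bar>)" for T B
  proof -
    obtain C where C: "\<And>c j t. t \<in> {0..\<bar>T\<bar>} \<Longrightarrow> \<bar>z (c, j) t\<bar> \<le> C * (1 + \<bar>real_of_int j\<bar>)"
      by (rule solution_growth[OF z]) blast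
    have "\<bar>ini (c, j) x\<bar> / \<epsilon> + \<bar>z (c, j) t\<bar> + B / \<epsilon> \<le> (2 * C + \<bar>B\<bar> / \<epsilon>) * (1 + \<bar>real_of_int j\<bar>)" if "t \<in> {0..T}" for c j t
    proof -
      have "\<bar>ini (c, j) x\<bar> / \<epsilon> = \<bar>z (c, j) 0\<bar>" using \<open>\<epsilon> > 0\<close> by (simp add: ini_z abs_mult)
      then have "\<bar>ini (c, j) x\<bar> / \<epsilon> \<le> C * (1 + \<bar>real_of_int j\<bar>)" using C[of 0 c j] by simp
      moreover have "\<bar>z (c, j) t\<bar> \<le> C * (1 + \<bar>real_of_int j\<bar>)" using C[of t c j] that by simp
      moreover have "B / \<epsilon> \<le> (\<bar>B\<bar> / \<epsilon>) * 1" using \<open>\<epsilon> > 0\<close> by (simp add: divide_right_mono)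
      moreover have "(\<bar>B\<bar> / \<epsilon>) * 1 \<le> (\<bar>B\<bar> / \<epsilon>) * (1 + \<bar>real_of_int j\<bar>)"
        using \<open>\<epsilon> > 0\<close> by (intro mult_left_mono) auto
      ultimately show ?thesis unfolding distrib_right by linarith
    qed
    then show ?thesis by blast
  qed
  have field_cont: "continuous_on UNIV (\<lambda>t. particle_field m \<alpha> F i t z)" for i z
    by (rule continuous_field) simp
  have field_eq: "u_rhs \<alpha> \<epsilon> v \<eta> j p = particle_field m \<alpha> F (True, j) (fst p / \<epsilon>) (\<lambda>(c, j). (if c then v j p else \<eta> j p) / \<epsilon>)"
    "\<xi>_rhs m \<alpha> F \<epsilon> v \<eta> j p = particle_field m \<alpha> F (False, j) (fst p / \<epsilon>) (\<lambda>(c, j). (if c then v j p else \<eta> j p) / \<epsilon>)"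
    for v \<eta> j p
    by (simp_all add: u_rhs_def \<xi>_rhs_def particle_field_def stencil_def case_prod_unfold flip: diff_divide_distrib)
  have sub_test: "\<phi>\<^sub>t p \<le> u_rhs \<alpha> \<epsilon> (\<lambda>j. usc_envelope (u j)) (\<lambda>j. usc_envelope (\<xi> j)) j p"
    if "C1_test \<phi> \<phi>\<^sub>t \<phi>\<^sub>x" "p \<in> pos_time_space" "local_max_at (\<lambda>q. usc_envelope (u j) q - \<phi> q) p" for \<phi> \<phi>\<^sub>t \<phi>\<^sub>x p j
    using sub that unfolding system_subsolution_def by blast
  have sub_test': "\<phi>\<^sub>t p \<le> \<xi>_rhs m \<alpha> F \<epsilon> (\<lambda>j. usc_envelope (u j)) (\<lambda>j. usc_envelope (\<xi> j)) j p"
    if "C1_test \<phi> \<phi>\<^sub>t \<phi>\<^sub>x" "p \<in> pos_time_space" "local_max_at (\<lambda>q. usc_envelope (\<xi> j) q - \<phi> q) p" for \<phi> \<phi>\<^sub>t \<phi>\<^sub>x p j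
    using sub that unfolding system_subsolution_def by blast
  have super_test: "u_rhs \<alpha> \<epsilon> (\<lambda>j. lsc_envelope (u j)) (\<lambda>j. lsc_envelope (\<xi> j)) j p \<le> \<phi>\<^sub>t p"
    if "C1_test \<phi> \<phi>\<^sub>t \<phi>\<^sub>x" "p \<in> pos_time_space" "local_min_at (\<lambda>q. lsc_envelope (u j) q - \<phi> q) p" for \<phi> \<phi>\<^sub>t \<phi>\<^sub>x p j
    using super that unfolding system_supersolution_def by blast
  have super_test': "\<xi>_rhs m \<alpha> F \<epsilon> (\<lambda>j. lsc_envelope (u j)) (\<lambda>j. lsc_envelope (\<xi> j)) j p \<le> \<phi>\<^sub>t p"
    if "C1_test \<phi> \<phi>\<^sub>t \<phi>\<^sub>x" "p \<in> pos_time_space" "local_min_at (\<lambda>q. lsc_envelope (\<xi> j) q - \<phi> q) p" for \<phi> \<phi>\<^sub>t \<phi>\<^sub>x p j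
    using super that unfolding system_supersolution_def by blast
  have upper: "usc_envelope (W i) (\<epsilon> * t, x) / \<epsilon> \<le> z i t" for i
  proof (rule comparison[OF _ solution_classical_super[OF z], where w = "\<lambda>i s. usc_envelope (W i) (\<epsilon> * s, x) / \<epsilon>"])
    show "visc_sub (particle_field m \<alpha> F) (\<lambda>i s. usc_envelope (W i) (\<epsilon> * s, x) / \<epsilon>)"
    proof (rule freeze_space[OF \<open>\<epsilon> > 0\<close> _ field_cont])
      show "usc_on time_space (usc_envelope (W i))" for i
        using sub unfolding system_subsolution_def upper_semicont_iff_usc_on by (cases i) (simp add: W_def)
      fix i \<phi> \<phi>\<^sub>t \<phi>\<^sub>x p
      assume test: "C1_test \<phi> \<phi>\<^sub>t \<phi>\<^sub>x" "p \<in> pos_time_space" "local_max_at (\<lambda>q. usc_envelope (W i) q - \<phi> q) p"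
      have eq: "(\<lambda>k. usc_envelope (W k) p / \<epsilon>) = (\<lambda>(c, j). (if c then usc_envelope (u j) p else usc_envelope (\<xi> j) p) / \<epsilon>)"
        by (auto simp: W_def fun_eq_iff)
      obtain c j where i: "i = (c, j)" by (cases i)
      show "\<phi>\<^sub>t p \<le> particle_field m \<alpha> F i (fst p / \<epsilon>) (\<lambda>k. usc_envelope (W k) p / \<epsilon>)"
      proof (cases c)
        case True
        with test(3) have "local_max_at (\<lambda>q. usc_envelope (u j) q - \<phi> q) p" by (simp add: i W_def)
        from sub_test[OF test(1,2) this] show ?thesis unfolding eq i field_eq by (simp only: True)
      next
        case False
        with test(3) have "local_max_at (\<lambda>q. usc_envelope (\<xi> j) q - \<phi> q) p" by (simp add: i W_def)
        from sub_test'[OF test(1,2) this] show ?thesis unfolding eq i field_eq by (simp only: False)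
      qed
    qed
    show "usc_envelope (W i) (\<epsilon> * 0, x) / \<epsilon> \<le> z i 0" for i
    proof -
      have "usc_envelope (W i) (0, x) \<le> ini i x"
        using sub unfolding system_subsolution_def by (cases i) (simp add: W_def ini_def)
      then show ?thesis using \<open>\<epsilon> > 0\<close> by (simp add: ini_z field_simps)
    qed
    fix T
    obtain B where B: "\<And>i t. t \<in> {0..T} \<Longrightarrow> usc_envelope (W i) (\<epsilon> * t, x) \<le> ini i x + B" using growth by blast
    obtain C where C: "\<And>c j t. t \<in> {0..T} \<Longrightarrow> \<bar>ini (c, j) x\<bar> / \<epsilon> + \<bar>z (c, j) t\<bar> + B / \<epsilon> \<le> C * (1 + \<bar>real_of_int j\<bar>)"
      using z_growth[of T B] by blast
    have "usc_envelope (W (c, j)) (\<epsilon> * t, x) / \<epsilon> - z (c, j) t \<le> C * (1 + \<bar>real_of_int j\<bar>)" if "t \<in> {0..T}" for c j t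
    proof -
      have "usc_envelope (W (c, j)) (\<epsilon> * t, x) / \<epsilon> \<le> (\<bar>ini (c, j) x\<bar> + B) / \<epsilon>"
        using B[OF that, of "(c, j)"] \<open>\<epsilon> > 0\<close> by (intro divide_right_mono) auto
      then show ?thesis using C[OF that, of c j] unfolding add_divide_distrib by linarith
    qed
    then show "\<exists>C. \<forall>c j. \<forall>t\<in>{0..T}. usc_envelope (W (c, j)) (\<epsilon> * t, x) / \<epsilon> - z (c, j) t \<le> C * (1 + \<bar>real_of_int j\<bar>)"
      by blast
  qed (rule \<open>t \<ge> 0\<close>)
  have lower: "- lsc_envelope (W i) (\<epsilon> * t, x) / \<epsilon> \<le> - z i t" for i
  proof (rule dual.comparison[where w = "\<lambda>i s. - lsc_envelope (W i) (\<epsilon> * s, x) / \<epsilon>" and V = "\<lambda>i s. - z i s"])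
    show "classical_super dual_field (\<lambda>i s. - z i s)"
      unfolding classical_super_def
    proof (intro conjI allI exI[of _ "\<lambda>i t. - particle_field m \<alpha> F i t (\<lambda>k. z k t)"])
      fix i
      show "continuous_on {0..} (\<lambda>s. - z i s)" by (intro continuous_intros solution_continuous[OF z])
      show "continuous_on {0<..} (\<lambda>t. - particle_field m \<alpha> F i t (\<lambda>k. z k t))"
        by (intro continuous_on_minus continuous_field_solution[OF z]) auto
      fix s :: real
      show "0 < s \<longrightarrow> ((\<lambda>s. - z i s) has_real_derivative - particle_field m \<alpha> F i s (\<lambda>k. z k s)) (at s) \<and>
          dual_field i s (\<lambda>k. - z k s) \<le> - particle_field m \<alpha> F i s (\<lambda>k. z k s)"
        using DERIV_minus[OF solution_deriv[OF z]] by (simp add: dual_field_def)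
    qed
    show "visc_sub dual_field (\<lambda>i s. - lsc_envelope (W i) (\<epsilon> * s, x) / \<epsilon>)"
    proof (rule dual.freeze_space[OF \<open>\<epsilon> > 0\<close>, where W = "\<lambda>i q. - lsc_envelope (W i) q"])
      show "usc_on time_space (\<lambda>q. - lsc_envelope (W i) q)" for i
        using super unfolding system_supersolution_def lower_semicont_iff_usc_on by (cases i) (simp add: W_def)
      show "continuous_on UNIV (\<lambda>t. dual_field i t z)" for i z
        unfolding dual_field_def by (intro continuous_on_minus field_cont)
      fix i \<phi> \<phi>\<^sub>t \<phi>\<^sub>x p
      assume test: "C1_test \<phi> \<phi>\<^sub>t \<phi>\<^sub>x" "p \<in> pos_time_space" "local_max_at (\<lambda>q. - lsc_envelope (W i) q - \<phi> q) p"
      have eq: "(\<lambda>k. - (- lsc_envelope (W k) p / \<epsilon>)) = (\<lambda>(c, j). (if c then lsc_envelope (u j) p else lsc_envelope (\<xi> j) p) / \<epsilon>)"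
        by (auto simp: W_def fun_eq_iff)
      obtain c j where i: "i = (c, j)" by (cases i)
      have "particle_field m \<alpha> F i (fst p / \<epsilon>) (\<lambda>(c, j). (if c then lsc_envelope (u j) p else lsc_envelope (\<xi> j) p) / \<epsilon>) \<le> - \<phi>\<^sub>t p"
      proof (cases c)
        case True
        from test(3) True have "local_min_at (\<lambda>q. lsc_envelope (u j) q - - \<phi> q) p"
          unfolding i W_def local_max_at_uminus by simp
        from super_test[OF C1_test_uminus[OF test(1)] test(2) this] show ?thesis
          unfolding i field_eq by (simp only: True)
      next
        case False
        from test(3) False have "local_min_at (\<lambda>q. lsc_envelope (\<xi> j) q - - \<phi> q) p"
          unfolding i W_def local_max_at_uminus by simp
        from super_test'[OF C1_test_uminus[OF test(1)] test(2) this] show ?thesis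
          unfolding i field_eq by (simp only: False)
      qed
      then show "\<phi>\<^sub>t p \<le> dual_field i (fst p / \<epsilon>) (\<lambda>k. - lsc_envelope (W k) p / \<epsilon>)"
        unfolding dual_field_def eq by simp
    qed
    show "- lsc_envelope (W i) (\<epsilon> * 0, x) / \<epsilon> \<le> - z i 0" for i
    proof -
      have "ini i x \<le> lsc_envelope (W i) (0, x)"
        using super unfolding system_supersolution_def by (cases i) (simp add: W_def ini_def)
      then show ?thesis using \<open>\<epsilon> > 0\<close> by (simp add: ini_z field_simps)
    qed
    fix T
    obtain B where B: "\<And>i t. t \<in> {0..T} \<Longrightarrow> ini i x - B \<le> lsc_envelope (W i) (\<epsilon> * t, x)" using growth by blast
    obtain C where C: "\<And>c j t. t \<in> {0..T} \<Longrightarrow> \<bar>ini (c, j) x\<bar> / \<epsilon> + \<bar>z (c, j) t\<bar> + B / \<epsilon> \<le> C * (1 + \<bar>real_of_int j\<bar>)"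
      using z_growth[of T B] by blast
    have "- lsc_envelope (W (c, j)) (\<epsilon> * t, x) / \<epsilon> - - z (c, j) t \<le> C * (1 + \<bar>real_of_int j\<bar>)" if "t \<in> {0..T}" for c j t
    proof -
      have "- lsc_envelope (W (c, j)) (\<epsilon> * t, x) / \<epsilon> \<le> (\<bar>ini (c, j) x\<bar> + B) / \<epsilon>"
        using B[OF that, of "(c, j)"] \<open>\<epsilon> > 0\<close> by (intro divide_right_mono) auto
      then show ?thesis using C[OF that, of c j] unfolding add_divide_distrib by linarith
    qed
    then show "\<exists>C. \<forall>c j. \<forall>t\<in>{0..T}. - lsc_envelope (W (c, j)) (\<epsilon> * t, x) / \<epsilon> - - z (c, j) t \<le> C * (1 + \<bar>real_of_int j\<bar>)"
      by blast
  qed (rule \<open>t \<ge> 0\<close>)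
  have "W i (\<epsilon> * t, x) = \<epsilon> * z i t" for i
  proof (rule antisym)
    have p: "(\<epsilon> * t, x) \<in> time_space" using \<open>\<epsilon> > 0\<close> \<open>t \<ge> 0\<close> by simp
    show "W i (\<epsilon> * t, x) \<le> \<epsilon> * z i t"
      using Limsup_envelope(2)[OF W_bdd p, of i] upper[of i] \<open>\<epsilon> > 0\<close> by (simp add: field_simps)
    show "\<epsilon> * z i t \<le> W i (\<epsilon> * t, x)"
      using lsc_envelope_le[OF W_bdd p, of i] lower[of i] \<open>\<epsilon> > 0\<close> by (simp add: field_simps)
  qed
  from this[of "(True, j)"] this[of "(False, j)"]
  show "u j (\<epsilon> * t, x) = \<epsilon> * z (True, j) t" "\<xi> j (\<epsilon> * t, x) = \<epsilon> * z (False, j) t" by (simp_all add: W_simps)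
qed

section \<open>Comparison for Hamilton-Jacobi equations with a Lipschitz Hamiltonian\<close>

text \<open>A differentiable substitute for the absolute value: coercive, with slope at most
  1.\<close>

lemma sqrt_one_plus_square:
  fixes x :: real
  shows "((\<lambda>x. sqrt (1 + x\<^sup>2)) has_real_derivative x / sqrt (1 + x\<^sup>2)) (at x)"
    and "\<bar>x / sqrt (1 + x\<^sup>2)\<bar> \<le> 1" and "\<bar>x\<bar> \<le> sqrt (1 + x\<^sup>2)"
proof -
  have pos: "1 + x\<^sup>2 > 0" by (simp add: add_pos_nonneg)
  show "((\<lambda>x. sqrt (1 + x\<^sup>2)) has_real_derivative x / sqrt (1 + x\<^sup>2)) (at x)"
    using pos by (auto intro!: derivative_eq_intros simp: field_simps)
  show le: "\<bar>x\<bar> \<le> sqrt (1 + x\<^sup>2)" by (rule real_le_rsqrt) simp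
  show "\<bar>x / sqrt (1 + x\<^sup>2)\<bar> \<le> 1" using le pos by (simp add: abs_divide divide_le_eq_1_pos)
qed

lemma HJ_subsolutionD:
  "HJ_subsolution H g w \<Longrightarrow> C1_test \<phi> \<phi>\<^sub>t \<phi>\<^sub>x \<Longrightarrow> p \<in> pos_time_space \<Longrightarrow>
    local_max_at (\<lambda>q. w q - \<phi> q) p \<Longrightarrow> \<phi>\<^sub>t p \<le> H (\<phi>\<^sub>x p)"
  unfolding HJ_subsolution_def by blast

lemma HJ_supersolutionD:
  "HJ_supersolution H g w \<Longrightarrow> C1_test \<phi> \<phi>\<^sub>t \<phi>\<^sub>x \<Longrightarrow> p \<in> pos_time_space \<Longrightarrow>
    local_min_at (\<lambda>q. w q - \<phi> q) p \<Longrightarrow> H (\<phi>\<^sub>x p) \<le> \<phi>\<^sub>t p"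
  unfolding HJ_supersolution_def by blast

text \<open>
  Doubling of variables. Since \<open>H\<close> is Lipschitz, the penalisation
  \<open>\<delta> (sqrt (1 + x\<^sup>2) + (L + 1) t)\<close> is a strict supersolution of the linearised equation and stays fixed
  while the doubling parameter \<open>k\<close> tends to infinity; the term \<open>A (max 0 (t - t\<^sub>1))\<^sup>2\<close> keeps the maximum
  away from the end of the time interval.
\<close>

theorem HJ_comparison:
  assumes H: "\<And>p q. \<bar>H p - H q\<bar> \<le> L * \<bar>p - q\<bar>" and "L \<ge> 0"
    and sub: "HJ_subsolution H g w\<^sub>1" and super: "HJ_supersolution H g w\<^sub>2"
    and g: "\<And>x y. \<bar>g x - g y\<bar> \<le> K * \<bar>x - y\<bar>" and "K \<ge> 0"
    and bound1: "\<And>T. T > 0 \<Longrightarrow> \<exists>C. \<forall>t\<in>{0..T}. \<forall>x. w\<^sub>1 (t, x) \<le> g x + C"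
    and bound2: "\<And>T. T > 0 \<Longrightarrow> \<exists>C. \<forall>t\<in>{0..T}. \<forall>x. g x - C \<le> w\<^sub>2 (t, x)"
    and "t\<^sub>1 \<ge> 0"
  shows "w\<^sub>1 (t\<^sub>1, x\<^sub>1) \<le> w\<^sub>2 (t\<^sub>1, x\<^sub>1)"
proof (rule ccontr)
  assume contra: "\<not> w\<^sub>1 (t\<^sub>1, x\<^sub>1) \<le> w\<^sub>2 (t\<^sub>1, x\<^sub>1)"
  have init: "w\<^sub>1 (0, x) \<le> w\<^sub>2 (0, x)" for x
    using sub super unfolding HJ_subsolution_def HJ_supersolution_def by (meson order_trans)
  with contra \<open>t\<^sub>1 \<ge> 0\<close> have "t\<^sub>1 > 0" by (cases "t\<^sub>1 = 0") auto
  define \<sigma> where "\<sigma> = w\<^sub>1 (t\<^sub>1, x\<^sub>1) - w\<^sub>2 (t\<^sub>1, x\<^sub>1)"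
  have "\<sigma> > 0" using contra by (simp add: \<sigma>_def)
  define T where "T = t\<^sub>1 + 1"
  have "T > 0" using \<open>t\<^sub>1 > 0\<close> by (simp add: T_def)
  obtain C1 where C1: "\<And>t x. t \<in> {0..T} \<Longrightarrow> w\<^sub>1 (t, x) \<le> g x + C1" using bound1[OF \<open>T > 0\<close>] by blast
  obtain C2 where C2: "\<And>t x. t \<in> {0..T} \<Longrightarrow> g x - C2 \<le> w\<^sub>2 (t, x)" using bound2[OF \<open>T > 0\<close>] by blast
  define C where "C = \<bar>C1\<bar> + \<bar>C2\<bar>"
  have "C \<ge> 0" by (simp add: C_def)
  have diff: "w\<^sub>1 (t, x) - w\<^sub>2 (s, y) \<le> C + K * \<bar>x - y\<bar>" if "t \<in> {0..T}" "s \<in> {0..T}" for t s x y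
    using C1[OF that(1), of x] C2[OF that(2), of y] g[of x y] unfolding C_def by linarith
  \<comment> \<open>By \<open>young\<close>, \<open>D\<close> bounds
    \<open>C + K * d - d\<^sup>2\<close> for every distance \<open>d\<close>, and hence the doubled
    function before the penalisation, for all \<open>k \<ge> 1\<close>.\<close>
  define D where "D = C + K\<^sup>2"
  have "D \<ge> 0" using \<open>C \<ge> 0\<close> by (simp add: D_def)
  have young: "K * d - d\<^sup>2 \<le> K\<^sup>2" for d
  proof -
    have "0 \<le> (K - d / 2)\<^sup>2" "0 \<le> d\<^sup>2" by simp_all
    moreover have "(K - d / 2)\<^sup>2 = K\<^sup>2 - K * d + d\<^sup>2 / 4" by (simp add: power2_eq_square field_simps)
    ultimately show ?thesis by linarith
  qed
  \<comment> \<open>\<open>M\<close> is the size of the penalisation at the point of contradiction;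
    with \<open>\<delta> * M = \<sigma> / 2\<close> half of the gap survives it.\<close>
  define M where "M = sqrt (1 + x\<^sub>1\<^sup>2) + (L + 1) * t\<^sub>1"
  have "M > 0" using \<open>L \<ge> 0\<close> \<open>t\<^sub>1 > 0\<close> by (simp add: M_def add_nonneg_pos)
  define \<delta> where "\<delta> = \<sigma> / (2 * M)"
  have "\<delta> > 0" using \<open>\<sigma> > 0\<close> \<open>M > 0\<close> by (simp add: \<delta>_def)
  \<comment> \<open>Half a unit after \<open>t\<^sub>1\<close> the cut-off in time reaches
    \<open>D + 1\<close>, above the bound \<open>D\<close>.\<close>
  define A where "A = 4 * (D + 1)"
  have "A > 0" using \<open>D \<ge> 0\<close> by (simp add: A_def)
  define a where "a t = \<delta> * ((L + 1) * t) + A * (max 0 (t - t\<^sub>1))\<^sup>2" for t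
  define b where "b x = \<delta> * sqrt (1 + x\<^sup>2)" for x
  have a_nonneg: "a t \<ge> 0" if "t \<ge> 0" for t
    using that \<open>\<delta> > 0\<close> \<open>L \<ge> 0\<close> \<open>A > 0\<close> by (simp add: a_def)
  have b_ge: "b x \<ge> \<delta> * \<bar>x\<bar>" for x
    unfolding b_def using \<open>\<delta> > 0\<close> sqrt_one_plus_square(3)[of x] by (intro mult_left_mono) auto
  have b_nonneg: "b x \<ge> 0" for x unfolding b_def using \<open>\<delta> > 0\<close> by simp
  have ab_cont: "continuous_on S a" "continuous_on S' b" for S S'
    unfolding a_def b_def by (intro continuous_intros)+
  define f\<^sub>0 where "f\<^sub>0 q = (w\<^sub>1 (fst q) + - w\<^sub>2 (snd q)) + - (a (fst (fst q)) + b (snd (fst q)))" for q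
  define pen where "pen q = (snd (fst q) - snd (snd q))\<^sup>2 + (fst (fst q) - fst (snd q))\<^sup>2" for q :: "(real \<times> real) \<times> (real \<times> real)"
  define f where "f k q = f\<^sub>0 q + - (real k * pen q)" for k q
  define R where "R = D / \<delta>"
  \<comment> \<open>The penalisation confines \<open>x\<close> to radius \<open>R\<close>, whereas
    \<open>y\<close> is confined only through its distance \<open>K + C + 1\<close> from
    \<open>x\<close>. The extra unit leaves room around every maximum inside the box.\<close>
  define R' where "R' = R + 1 + (K + C + 1)"
  have "R \<ge> 0" using \<open>D \<ge> 0\<close> \<open>\<delta> > 0\<close> by (simp add: R_def)
  define B where "B = ({0..T} \<times> {- (R + 1 + \<bar>x\<^sub>1\<bar>)..R + 1 + \<bar>x\<^sub>1\<bar>}) \<times> ({0..T} \<times> {- (R' + \<bar>x\<^sub>1\<bar>)..R' + \<bar>x\<^sub>1\<bar>})"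
  define q\<^sub>1 where "q\<^sub>1 = ((t\<^sub>1, x\<^sub>1), (t\<^sub>1, x\<^sub>1))"
  have f_q1: "f k q\<^sub>1 = \<sigma> / 2" for k
  proof -
    have "a t\<^sub>1 + b x\<^sub>1 = \<delta> * M" by (simp add: a_def b_def M_def algebra_simps)
    also have "\<dots> = \<sigma> / 2" using \<open>M > 0\<close> by (simp add: \<delta>_def)
    finally show ?thesis by (simp add: f_def f\<^sub>0_def pen_def q\<^sub>1_def \<sigma>_def)
  qed
  have pos_imp: "\<bar>x\<bar> \<le> R \<and> \<bar>x - y\<bar> \<le> K + C + 1 \<and> t < t\<^sub>1 + 1/2"
    if pos: "f k ((t, x), (s, y)) > 0" and ts: "t \<in> {0..T}" "s \<in> {0..T}" and "k \<ge> 1" for k t x s y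
  proof -
    define d where "d = \<bar>x - y\<bar>"
    have "d \<ge> 0" by (simp add: d_def)
    have "(x - y)\<^sup>2 = d\<^sup>2" by (simp add: d_def)
    have "1 * (d\<^sup>2 + (t - s)\<^sup>2) \<le> real k * (d\<^sup>2 + (t - s)\<^sup>2)"
      using \<open>k \<ge> 1\<close> by (intro mult_right_mono) auto
    moreover have "pen ((t, x), (s, y)) = d\<^sup>2 + (t - s)\<^sup>2"
      using \<open>(x - y)\<^sup>2 = d\<^sup>2\<close> by (simp add: pen_def)
    ultimately have "d\<^sup>2 + (t - s)\<^sup>2 \<le> real k * pen ((t, x), (s, y))" by simp
    then have "real k * pen ((t, x), (s, y)) \<ge> d\<^sup>2"
      using zero_le_power2[of "t - s"] by linarith
    with pos diff[OF ts, of x y] have main: "a t + b x < C + K * d - d\<^sup>2"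
      unfolding f_def f\<^sub>0_def d_def[symmetric] by simp
    have "a t \<ge> 0" using a_nonneg ts by simp
    have "a t + b x < D" using main young[of d] by (simp add: D_def)
    then have "\<delta> * \<bar>x\<bar> \<le> D" using b_ge[of x] \<open>a t \<ge> 0\<close> by simp
    then have "\<bar>x\<bar> \<le> R" using \<open>\<delta> > 0\<close> by (simp add: R_def field_simps)
    moreover have "d \<le> K + C + 1"
    proof (rule ccontr)
      assume "\<not> d \<le> K + C + 1"
      then have "d \<ge> 1" "d - K \<ge> C" using \<open>K \<ge> 0\<close> \<open>C \<ge> 0\<close> by auto
      then have "1 * C \<le> d * (d - K)" using \<open>C \<ge> 0\<close> by (intro mult_mono) auto
      then have "C + K * d - d\<^sup>2 \<le> 0" by (simp add: power2_eq_square algebra_simps)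
      with main \<open>a t \<ge> 0\<close> b_nonneg[of x] show False by simp
    qed
    moreover have "t < t\<^sub>1 + 1/2"
    proof (rule ccontr)
      assume "\<not> t < t\<^sub>1 + 1/2"
      then have "(1/2)\<^sup>2 \<le> (max 0 (t - t\<^sub>1))\<^sup>2" by (intro power_mono) auto
      then have "A * (1/2)\<^sup>2 \<le> A * (max 0 (t - t\<^sub>1))\<^sup>2" by (rule mult_left_mono) (use \<open>A > 0\<close> in simp)
      moreover have "A * (1/2)\<^sup>2 = D + 1" by (simp add: A_def power2_eq_square)
      moreover have "0 \<le> \<delta> * ((L + 1) * t)" using ts \<open>\<delta> > 0\<close> \<open>L \<ge> 0\<close> by simp
      ultimately have "a t \<ge> D + 1" unfolding a_def by linarith
      with \<open>a t + b x < D\<close> b_nonneg[of x] show False by simp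
    qed
    ultimately show ?thesis by (simp add: d_def)
  qed
  have "compact B" unfolding B_def by (intro compact_Times compact_Icc)
  have q1_B: "q\<^sub>1 \<in> B"
    using \<open>t\<^sub>1 > 0\<close> \<open>R \<ge> 0\<close> \<open>K \<ge> 0\<close> \<open>C \<ge> 0\<close> by (auto simp: q\<^sub>1_def B_def T_def R'_def)
  have q1_pos: "f k q\<^sub>1 > 0" for k using f_q1[of k] \<open>\<sigma> > 0\<close> by simp
  have B_time: "fst q \<in> time_space" "snd q \<in> time_space" if "q \<in> B" for q
    using that by (auto simp: B_def)
  have usc1: "usc_on time_space w\<^sub>1" using sub by (simp add: HJ_subsolution_def upper_semicont_iff_usc_on)
  have usc2: "usc_on time_space (\<lambda>p. - w\<^sub>2 p)"
    using super by (simp add: HJ_supersolution_def lower_semicont_iff_usc_on)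
  have f0_usc: "usc_on B f\<^sub>0"
    unfolding f\<^sub>0_def
  proof (intro usc_on_add)
    show "usc_on B (\<lambda>q. w\<^sub>1 (fst q))"
      by (rule usc_on_compose[OF usc1]) (use B_time in \<open>auto intro!: continuous_intros\<close>)
    show "usc_on B (\<lambda>q. - w\<^sub>2 (snd q))"
      by (rule usc_on_compose[OF usc2]) (use B_time in \<open>auto intro!: continuous_intros\<close>)
    show "usc_on B (\<lambda>q. - (a (fst (fst q)) + b (snd (fst q))))"
      by (intro continuous_on_imp_usc_on continuous_intros continuous_on_compose2[OF ab_cont(1)[of UNIV]]
          continuous_on_compose2[OF ab_cont(2)[of UNIV]]) auto
  qed
  have f_usc: "usc_on B (f k)" for k
    unfolding f_def pen_def
    by (intro usc_on_add f0_usc continuous_on_imp_usc_on continuous_intros)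
  have "B \<noteq> {}" using q1_B by auto
  have "\<forall>k. \<exists>q. q \<in> B \<and> (\<forall>q'\<in>B. f k q' \<le> f k q)"
  proof
    fix k show "\<exists>q. q \<in> B \<and> (\<forall>q'\<in>B. f k q' \<le> f k q)"
      by (rule usc_on_attains_sup[OF \<open>compact B\<close> \<open>B \<noteq> {}\<close> f_usc[of k]]) blast
  qed
  from choice[OF this] obtain q where q: "\<And>k. q k \<in> B" "\<And>k q'. q' \<in> B \<Longrightarrow> f k q' \<le> f k (q k)" by blast
  have f_ge: "f k (q k) \<ge> \<sigma> / 2" for k using q(2)[OF q1_B, of k] f_q1[of k] by simp
  obtain l r where "l \<in> B" and r: "strict_mono (r :: nat \<Rightarrow> nat)" and lim: "(q \<circ> r) \<longlonglongrightarrow> l"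
    by (rule seq_compactE[OF compact_imp_seq_compact[OF \<open>compact B\<close>], of q]) (use q(1) in auto)
  obtain qm where "qm \<in> B" and qm: "\<And>q. q \<in> B \<Longrightarrow> f\<^sub>0 q \<le> f\<^sub>0 qm"
    by (rule usc_on_attains_sup[OF \<open>compact B\<close> \<open>B \<noteq> {}\<close> f0_usc]) blast
  have pen_nonneg: "pen q \<ge> 0" for q by (simp add: pen_def)
  have pen_le: "real k * pen (q k) \<le> f\<^sub>0 qm" for k
    using f_ge[of k] qm[OF q(1)[of k]] \<open>\<sigma> > 0\<close> by (simp add: f_def)
  have "pen l = 0"
  proof -
    have "(\<lambda>k. f\<^sub>0 qm / real (r k)) \<longlonglongrightarrow> 0"
      by (intro tendsto_divide_0[OF tendsto_const] filterlim_at_top_imp_at_infinity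
        filterlim_compose[OF filterlim_real_sequentially filterlim_subseq[OF r]])
    moreover have "\<forall>\<^sub>F k in sequentially. norm (pen (q (r k))) \<le> f\<^sub>0 qm / real (r k)"
      using eventually_gt_at_top[of 0]
    proof eventually_elim
      case (elim k)
      then have "r k > 0" using seq_suble[OF r, of k] by linarith
      with pen_le[of "r k"] pen_nonneg[of "q (r k)"] show ?case by (simp add: field_simps)
    qed
    ultimately have "(\<lambda>k. pen (q (r k))) \<longlonglongrightarrow> 0" by (rule Lim_null_comparison[rotated])
    moreover have "continuous_on UNIV pen" unfolding pen_def by (intro continuous_intros)
    then have "(\<lambda>k. pen ((q \<circ> r) k)) \<longlonglongrightarrow> pen l"
      by (rule continuous_on_tendsto_compose[OF _ lim]) auto
    ultimately show ?thesis by (simp add: LIMSEQ_unique o_def)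
  qed
  then have "(snd (fst l) - snd (snd l))\<^sup>2 = 0 \<and> (fst (fst l) - fst (snd l))\<^sup>2 = 0"
    unfolding pen_def by (simp add: add_nonneg_eq_0_iff)
  then obtain t\<^sub>0 x\<^sub>0 where l: "l = ((t\<^sub>0, x\<^sub>0), (t\<^sub>0, x\<^sub>0))"
    by (cases l) (auto simp: prod_eq_iff)
  have "f\<^sub>0 l \<ge> \<sigma> / 2"
  proof (rule ccontr)
    assume "\<not> f\<^sub>0 l \<ge> \<sigma> / 2"
    then have less: "f\<^sub>0 l < \<sigma> / 2" by simp
    obtain O' where O': "open O'" "l \<in> O'" "\<And>q. q \<in> O' \<Longrightarrow> q \<in> B \<Longrightarrow> f\<^sub>0 q < \<sigma> / 2"
      by (rule usc_onD[OF f0_usc \<open>l \<in> B\<close> less]) (rule that)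
    have "\<forall>\<^sub>F k in sequentially. (q \<circ> r) k \<in> O'" by (rule topological_tendstoD[OF lim O'(1,2)])
    then obtain k where "q (r k) \<in> O'" by (auto dest: eventually_happens)
    then have "f\<^sub>0 (q (r k)) < \<sigma> / 2" using O'(3) q(1) by blast
    moreover have "0 \<le> real (r k) * pen (q (r k))" using pen_nonneg by simp
    ultimately show False using f_ge[of "r k"] unfolding f_def by linarith
  qed
  have t0: "t\<^sub>0 \<ge> 0" using \<open>l \<in> B\<close> by (simp add: l B_def)
  have "t\<^sub>0 \<noteq> 0"
  proof
    assume "t\<^sub>0 = 0"
    then have "f\<^sub>0 l \<le> 0" using init[of x\<^sub>0] a_nonneg[of 0] b_nonneg[of x\<^sub>0] by (simp add: f\<^sub>0_def l)
    with \<open>f\<^sub>0 l \<ge> \<sigma> / 2\<close> \<open>\<sigma> > 0\<close> show False by simp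
  qed
  with t0 have "t\<^sub>0 > 0" by simp
  have "t\<^sub>0 < T"
  proof -
    have "f 1 l = f\<^sub>0 l" using \<open>pen l = 0\<close> by (simp add: f_def)
    then have "f 1 l > 0" using \<open>f\<^sub>0 l \<ge> \<sigma> / 2\<close> \<open>\<sigma> > 0\<close> by simp
    then have "t\<^sub>0 < t\<^sub>1 + 1/2" using pos_imp[of 1 t\<^sub>0 x\<^sub>0 t\<^sub>0 x\<^sub>0] \<open>l \<in> B\<close> by (simp add: l B_def)
    then show ?thesis by (simp add: T_def)
  qed
  have "\<forall>\<^sub>F k in sequentially. (q \<circ> r) k \<in> ({0<..<T} \<times> UNIV) \<times> ({0<..<T} \<times> UNIV)"
    by (rule topological_tendstoD[OF lim]) (use \<open>t\<^sub>0 > 0\<close> \<open>t\<^sub>0 < T\<close> l in \<open>auto intro!: open_Times\<close>)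
  then have "\<forall>\<^sub>F k in sequentially. (q \<circ> r) k \<in> ({0<..<T} \<times> UNIV) \<times> ({0<..<T} \<times> UNIV) \<and> k \<ge> 1"
    using eventually_ge_at_top[of 1] by eventually_elim simp
  from eventually_happens'[OF sequentially_bot this]
  \<comment> \<open>One index with both times in the interior is enough: the two viscosity
    inequalities share the same \<open>p\<close> and \<open>\<tau>\<close>, and the Lipschitz bound
    for \<open>H\<close> is insensitive to their size.\<close>
  obtain k' where k': "q (r k') \<in> ({0<..<T} \<times> UNIV) \<times> ({0<..<T} \<times> UNIV)" "k' \<ge> 1"
    unfolding o_def by (elim exE conjE) (rule that)
  define k where "k = r k'"
  have "k \<ge> 1" using seq_suble[OF r, of k'] k' by (simp add: k_def)
  obtain t x s y where qk: "q k = ((t, x), (s, y))" by (metis surj_pair)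
  have t: "0 < t" "t < T" and s: "0 < s" "s < T" using k' by (auto simp: qk k_def[symmetric])
  have "f k ((t, x), (s, y)) > 0" using f_ge[of k] \<open>\<sigma> > 0\<close> by (simp add: qk)
  from pos_imp[OF this _ _ \<open>k \<ge> 1\<close>] t s have xy: "\<bar>x\<bar> \<le> R" "\<bar>x - y\<bar> \<le> K + C + 1" by auto
  define p where "p = real k * (2 * (x - y))"
  define \<tau> where "\<tau> = real k * (2 * (t - s))"
  have "\<delta> * (L + 1) + A * (2 * max 0 (t - t\<^sub>1)) + \<tau> \<le> H (\<delta> * (x / sqrt (1 + x\<^sup>2)) + p)"
  proof -
    have C1: "C1_test (\<lambda>p. (a (fst p) + real k * (fst p - s)\<^sup>2) + (b (snd p) + real k * (snd p - y)\<^sup>2))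
      (\<lambda>p. \<delta> * (L + 1) + A * (2 * max 0 (fst p - t\<^sub>1)) + real k * (2 * (fst p - s)))
      (\<lambda>p. \<delta> * (snd p / sqrt (1 + (snd p)\<^sup>2)) + real k * (2 * (snd p - y)))"
    proof (rule C1_test_sum[where a = "\<lambda>t. a t + real k * (t - s)\<^sup>2" and b = "\<lambda>x. b x + real k * (x - y)\<^sup>2"])
      fix t :: real
      show "((\<lambda>t. a t + real k * (t - s)\<^sup>2) has_real_derivative
          \<delta> * (L + 1) + A * (2 * max 0 (t - t\<^sub>1)) + real k * (2 * (t - s))) (at t)"
        unfolding a_def by (rule derivative_eq_intros DERIV_max_0_power2 refl | simp)+
    next
      fix x :: real
      show "((\<lambda>x. b x + real k * (x - y)\<^sup>2) has_real_derivative
          \<delta> * (x / sqrt (1 + x\<^sup>2)) + real k * (2 * (x - y))) (at x)"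
        unfolding b_def by (rule derivative_eq_intros sqrt_one_plus_square(1) refl | simp)+
    next
      have "1 + x\<^sup>2 \<noteq> 0" for x :: real using zero_le_power2[of x] by linarith
      then show "continuous_on UNIV (\<lambda>x. \<delta> * (x / sqrt (1 + x\<^sup>2)) + real k * (2 * (x - y)))"
        by (intro continuous_intros) auto
    qed (intro continuous_intros)
    have "\<forall>\<^sub>F p in nhds (t, x). p \<in> {0<..<T} \<times> {- (R + 1)<..<R + 1}"
      using t xy by (intro eventually_nhds_in_open open_Times) auto
    then have "local_max_at (\<lambda>p. w\<^sub>1 p - ((a (fst p) + real k * (fst p - s)\<^sup>2) + (b (snd p) + real k * (snd p - y)\<^sup>2))) (t, x)"
      unfolding local_max_at_def
    proof eventually_elim
      case (elim p)
      have "(p, (s, y)) \<in> B" using elim s q(1)[of k] by (auto simp: B_def qk mem_Times_iff)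
      from q(2)[OF this, of k] show ?case
        by (simp add: f_def f\<^sub>0_def pen_def qk algebra_simps)
    qed
    from HJ_subsolutionD[OF sub C1 _ this] t show ?thesis by (simp add: p_def \<tau>_def)
  qed
  moreover have "H p \<le> \<tau>"
  proof -
    have C1: "C1_test (\<lambda>p. - (real k * (t - fst p)\<^sup>2) + - (real k * (x - snd p)\<^sup>2))
      (\<lambda>p. real k * (2 * (t - fst p))) (\<lambda>p. real k * (2 * (x - snd p)))"
    proof (rule C1_test_sum[where a = "\<lambda>s. - (real k * (t - s)\<^sup>2)" and b = "\<lambda>y. - (real k * (x - y)\<^sup>2)"])
      show "((\<lambda>s. - (real k * (t - s)\<^sup>2)) has_real_derivative real k * (2 * (t - s))) (at s)" for s
        by (auto intro!: derivative_eq_intros simp: algebra_simps)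
      show "((\<lambda>y. - (real k * (x - y)\<^sup>2)) has_real_derivative real k * (2 * (x - y))) (at y)" for y
        by (auto intro!: derivative_eq_intros simp: algebra_simps)
    qed (intro continuous_intros)+
    have "\<forall>\<^sub>F p in nhds (s, y). p \<in> {0<..<T} \<times> {- R'<..<R'}"
      using s xy by (intro eventually_nhds_in_open open_Times) (auto simp: R'_def)
    then have "local_min_at (\<lambda>p. w\<^sub>2 p - (- (real k * (t - fst p)\<^sup>2) + - (real k * (x - snd p)\<^sup>2))) (s, y)"
      unfolding local_min_at_def
    proof eventually_elim
      case (elim p)
      have "((t, x), p) \<in> B" using elim q(1)[of k] by (auto simp: B_def qk mem_Times_iff)
      from q(2)[OF this, of k] show ?case
        by (simp add: f_def f\<^sub>0_def pen_def qk algebra_simps)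
    qed
    from HJ_supersolutionD[OF super C1 _ this] s show ?thesis by (simp add: p_def \<tau>_def)
  qed
  moreover have "0 \<le> A * (2 * max 0 (t - t\<^sub>1))" using \<open>A > 0\<close> by simp
  ultimately have "\<delta> * (L + 1) \<le> H (\<delta> * (x / sqrt (1 + x\<^sup>2)) + p) - H p" by linarith
  also have "\<dots> \<le> L * \<bar>\<delta> * (x / sqrt (1 + x\<^sup>2))\<bar>"
    using H[of "\<delta> * (x / sqrt (1 + x\<^sup>2)) + p" p] by simp
  also have "\<dots> \<le> L * (\<delta> * 1)"
    using sqrt_one_plus_square(2)[of x] \<open>L \<ge> 0\<close> \<open>\<delta> > 0\<close>
    unfolding abs_mult by (intro mult_left_mono mult_mono) auto
  finally show False using \<open>\<delta> > 0\<close> by (simp add: distrib_left mult.commute)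
qed

section \<open>Passing to the limit\<close>

text \<open>\<open>l\<close> is the upper limit at 0 from the right, obtained as the infimum of all
  eventual upper bounds; the two conclusions characterise it.\<close>

lemma eventual_supremum_exists:
  fixes f :: "real \<Rightarrow> real"
  assumes "\<forall>\<^sub>F \<epsilon> in at_right 0. \<bar>f \<epsilon>\<bar> \<le> B"
  obtains l where "\<And>e. e > 0 \<Longrightarrow> \<forall>\<^sub>F \<epsilon> in at_right 0. f \<epsilon> < l + e"
    and "\<And>a. \<forall>\<^sub>F \<epsilon> in at_right 0. f \<epsilon> \<le> a \<Longrightarrow> l \<le> a"
proof
  define A where "A = {a. \<forall>\<^sub>F \<epsilon> in at_right 0. f \<epsilon> \<le> a}"
  have "B \<in> A" using assms by (auto simp: A_def elim: eventually_mono)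
  have low: "- B \<le> a" if "a \<in> A" for a
  proof -
    have "\<forall>\<^sub>F \<epsilon> in at_right (0::real). - B \<le> a"
      using that[unfolded A_def mem_Collect_eq] assms by eventually_elim linarith
    then show ?thesis by (simp add: eventually_const_iff trivial_limit_at_right_real)
  qed
  then have bdd: "bdd_below A" by (auto simp: bdd_below_def)
  show "\<forall>\<^sub>F \<epsilon> in at_right 0. f \<epsilon> < Inf A + e" if "e > 0" for e
  proof -
    have "Inf A < Inf A + e" using that by simp
    then obtain a where "a \<in> A" "a < Inf A + e"
      using cInf_less_iff[OF _ bdd] \<open>B \<in> A\<close> by blast
    then show ?thesis by (auto simp: A_def elim: eventually_mono)
  qed
  show "Inf A \<le> a" if "\<forall>\<^sub>F \<epsilon> in at_right 0. f \<epsilon> \<le> a" for a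
    by (rule cInf_lower[OF _ bdd]) (use that in \<open>simp add: A_def\<close>)
qed

text \<open>
  \<open>v \<epsilon> t x\<close> stands for \<open>u\<^sub>0\<^sup>\<epsilon>(t, x)\<close>. The properties \<open>step_up\<close> and \<open>step_down\<close> express that a state which
  is locally affine of slope \<open>p\<close> moves with speed \<open>H p\<close>, information travelling at most at speed \<open>R\<close>.
\<close>

locale scaling_limit =
  fixes v :: "real \<Rightarrow> real \<Rightarrow> real \<Rightarrow> real" and g H :: "real \<Rightarrow> real" and C K R L :: real
  assumes nonneg: "C \<ge> 0" "K \<ge> 0" "R \<ge> 0" "L \<ge> 0"
    and time: "\<And>\<epsilon> s t x. \<epsilon> > 0 \<Longrightarrow> s \<ge> 0 \<Longrightarrow> t \<ge> 0 \<Longrightarrow> \<bar>v \<epsilon> t x - v \<epsilon> s x\<bar> \<le> C * \<bar>t - s\<bar>"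
    and mono: "\<And>\<epsilon> t x y. \<epsilon> > 0 \<Longrightarrow> t \<ge> 0 \<Longrightarrow> x \<le> y \<Longrightarrow> v \<epsilon> t x \<le> v \<epsilon> t y"
    and space: "\<And>\<epsilon> t x y. \<epsilon> > 0 \<Longrightarrow> t \<ge> 0 \<Longrightarrow> x \<le> y \<Longrightarrow> v \<epsilon> t y \<le> v \<epsilon> t x + K * (y - x) + C * \<epsilon>"
    and init: "\<And>\<epsilon> x. \<epsilon> > 0 \<Longrightarrow> v \<epsilon> 0 x = g x"
    and H_lipschitz: "\<And>p q. \<bar>H p - H q\<bar> \<le> L * \<bar>p - q\<bar>"
    and step_up: "\<And>p. p \<ge> 0 \<Longrightarrow> \<exists>C'. \<forall>\<epsilon>>0. \<forall>t\<ge>0. \<forall>h>0. \<forall>x c.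
      (\<forall>y. \<bar>y - x\<bar> \<le> R * (h + \<epsilon>) \<longrightarrow> v \<epsilon> t y \<le> c + p * (y - x)) \<longrightarrow> v \<epsilon> (t + h) x \<le> c + h * H p + C' * \<epsilon>"
    and step_down: "\<And>p. p \<ge> 0 \<Longrightarrow> \<exists>C'. \<forall>\<epsilon>>0. \<forall>t\<ge>0. \<forall>h>0. \<forall>x c.
      (\<forall>y. \<bar>y - x\<bar> \<le> R * (h + \<epsilon>) \<longrightarrow> c + p * (y - x) \<le> v \<epsilon> t y) \<longrightarrow> c + h * H p - C' * \<epsilon> \<le> v \<epsilon> (t + h) x"
begin

lemma near_zero: "a > 0 \<Longrightarrow> \<forall>\<^sub>F \<epsilon> in at_right (0::real). \<epsilon> > 0 \<and> \<epsilon> < a"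
  unfolding eventually_at_right_field by (intro exI[of _ a]) auto

lemma small: "e > 0 \<Longrightarrow> \<forall>\<^sub>F \<epsilon> in at_right (0::real). \<epsilon> > 0 \<and> c * \<epsilon> < e"
proof -
  assume "e > 0"
  then have "e / (\<bar>c\<bar> + 1) > 0" by simp
  from near_zero[OF this] show ?thesis
  proof eventually_elim
    case (elim \<epsilon>)
    then have "(\<bar>c\<bar> + 1) * \<epsilon> < e" by (simp add: field_simps)
    moreover have "c * \<epsilon> \<le> (\<bar>c\<bar> + 1) * \<epsilon>" using elim by (intro mult_right_mono) auto
    ultimately have "c * \<epsilon> < e" by linarith
    with elim show ?case by blast
  qed
qed

lemma v_lipschitz:
  assumes "\<epsilon> > 0" "s \<ge> 0" "t \<ge> 0"
  shows "\<bar>v \<epsilon> t x - v \<epsilon> s y\<bar> \<le> C * \<bar>t - s\<bar> + K * \<bar>x - y\<bar> + C * \<epsilon>"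
proof -
  have "\<bar>v \<epsilon> s x - v \<epsilon> s y\<bar> \<le> K * \<bar>x - y\<bar> + C * \<epsilon>"
    using mono[OF assms(1,2), of x y] mono[OF assms(1,2), of y x]
      space[OF assms(1,2), of x y] space[OF assms(1,2), of y x] nonneg assms(1)
    by (cases "x \<le> y") (auto simp: abs_if)
  then show ?thesis using time[OF assms, of x] by linarith
qed

text \<open>\<open>w\<close> is the upper limit of \<open>v\<close> for \<open>\<sigma> = 1\<close> and the lower limit for \<open>\<sigma> = -1\<close>.\<close>

definition relaxed_limit :: "real \<Rightarrow> (real \<times> real \<Rightarrow> real) \<Rightarrow> bool" where
  "relaxed_limit \<sigma> w \<longleftrightarrow> (\<forall>t\<ge>0. \<forall>x.
     (\<forall>e>0. \<forall>\<^sub>F \<epsilon> in at_right 0. \<sigma> * v \<epsilon> t x < \<sigma> * w (t, x) + e) \<and>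
     (\<forall>a. (\<forall>\<^sub>F \<epsilon> in at_right 0. \<sigma> * v \<epsilon> t x \<le> a) \<longrightarrow> \<sigma> * w (t, x) \<le> a))"

text \<open>Limits at a fixed point suffice because \<open>v\<close> is Lipschitz up to
  \<open>C * \<epsilon>\<close>, with constants independent of \<open>\<epsilon>\<close>. The
  estimate in time bounds \<open>v\<close> by \<open>\<bar>g x\<bar> + C * t\<close>, so these
  limits are finite.\<close>

lemma relaxed_limit_exists:
  assumes \<sigma>: "\<sigma> = 1 \<or> \<sigma> = - 1"
  shows "\<exists>w. relaxed_limit \<sigma> w"
proof -
  have "\<exists>l. t \<ge> 0 \<longrightarrow> (\<forall>e>0. \<forall>\<^sub>F \<epsilon> in at_right 0. \<sigma> * v \<epsilon> t x < \<sigma> * l + e) \<and>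
     (\<forall>a. (\<forall>\<^sub>F \<epsilon> in at_right 0. \<sigma> * v \<epsilon> t x \<le> a) \<longrightarrow> \<sigma> * l \<le> a)" for t x
  proof (cases "t \<ge> 0")
    case True
    have "\<forall>\<^sub>F \<epsilon> in at_right (0::real). \<bar>\<sigma> * v \<epsilon> t x\<bar> \<le> \<bar>g x\<bar> + C * t"
      using near_zero[OF zero_less_one]
    proof eventually_elim
      case (elim \<epsilon>)
      then show ?case using time[of \<epsilon> 0 t x] init[of \<epsilon> x] True \<sigma> by (auto simp: abs_mult)
    qed
    then obtain l where l: "\<And>e. e > 0 \<Longrightarrow> \<forall>\<^sub>F \<epsilon> in at_right 0. \<sigma> * v \<epsilon> t x < l + e"
      "\<And>a. \<forall>\<^sub>F \<epsilon> in at_right 0. \<sigma> * v \<epsilon> t x \<le> a \<Longrightarrow> l \<le> a"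
      by (rule eventual_supremum_exists) blast
    have ll: "\<sigma> * (\<sigma> * l) = l" using \<sigma> by auto
    show ?thesis
      by (rule exI[of _ "\<sigma> * l"], unfold ll) (use l in blast)
  qed auto
  then obtain w where "\<And>t x. t \<ge> 0 \<longrightarrow> (\<forall>e>0. \<forall>\<^sub>F \<epsilon> in at_right 0. \<sigma> * v \<epsilon> t x < \<sigma> * w t x + e) \<and>
     (\<forall>a. (\<forall>\<^sub>F \<epsilon> in at_right 0. \<sigma> * v \<epsilon> t x \<le> a) \<longrightarrow> \<sigma> * w t x \<le> a)" by metis
  then have "relaxed_limit \<sigma> (\<lambda>(t, x). w t x)" by (auto simp: relaxed_limit_def)
  then show ?thesis by blast
qed

lemma relaxed_limit_less:
  "relaxed_limit \<sigma> w \<Longrightarrow> t \<ge> 0 \<Longrightarrow> e > 0 \<Longrightarrow> \<forall>\<^sub>F \<epsilon> in at_right 0. \<sigma> * v \<epsilon> t x < \<sigma> * w (t, x) + e"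
  by (simp add: relaxed_limit_def)

lemma relaxed_limit_le:
  assumes w: "relaxed_limit \<sigma> w" and "t \<ge> 0"
    and ev: "\<And>e. e > 0 \<Longrightarrow> \<forall>\<^sub>F \<epsilon> in at_right 0. \<sigma> * v \<epsilon> t x \<le> a + e"
  shows "\<sigma> * w (t, x) \<le> a"
proof (rule field_le_epsilon)
  fix e :: real assume "e > 0"
  then show "\<sigma> * w (t, x) \<le> a + e" using w \<open>t \<ge> 0\<close> ev[of e] unfolding relaxed_limit_def by blast
qed

text \<open>The defect \<open>C * \<epsilon>\<close> in the estimates for \<open>v\<close>
  disappears in the limit, so the relaxed limits are genuinely Lipschitz and monotone.\<close>

lemma relaxed_limit_transfer:
  assumes \<sigma>: "\<sigma> = 1 \<or> \<sigma> = - 1" and w: "relaxed_limit \<sigma> w" and "s \<ge> 0" "t \<ge> 0"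
    and le: "\<And>\<epsilon>. \<epsilon> > 0 \<Longrightarrow> \<sigma> * v \<epsilon> t x \<le> \<sigma> * v \<epsilon> s y + b + C * \<epsilon>"
  shows "\<sigma> * w (t, x) \<le> \<sigma> * w (s, y) + b"
proof (rule relaxed_limit_le[OF w \<open>t \<ge> 0\<close>])
  fix e :: real assume "e > 0"
  then have "e / 2 > 0" by simp
  from relaxed_limit_less[OF w \<open>s \<ge> 0\<close> this, of y] small[OF this, of C]
  show "\<forall>\<^sub>F \<epsilon> in at_right 0. \<sigma> * v \<epsilon> t x \<le> \<sigma> * w (s, y) + b + e"
  proof eventually_elim
    case (elim \<epsilon>)
    then show ?case using le[of \<epsilon>] by linarith
  qed
qed

lemma relaxed_limit_lipschitz:
  assumes \<sigma>: "\<sigma> = 1 \<or> \<sigma> = - 1" and w: "relaxed_limit \<sigma> w" and "s \<ge> 0" "t \<ge> 0"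
  shows "\<bar>w (t, x) - w (s, y)\<bar> \<le> C * \<bar>t - s\<bar> + K * \<bar>x - y\<bar>"
proof -
  have "\<sigma> * w (t, x) \<le> \<sigma> * w (s, y) + (C * \<bar>t - s\<bar> + K * \<bar>x - y\<bar>)" if "s \<ge> 0" "t \<ge> 0" for s t x y
    by (rule relaxed_limit_transfer[OF \<sigma> w that])
      (use v_lipschitz[OF _ that, of _ x y] \<sigma> in \<open>force simp: abs_le_iff\<close>)
  from this[OF assms(3,4), of x y] this[OF assms(4,3), of y x] show ?thesis
    using \<sigma> by (auto simp: abs_minus_commute abs_le_iff)
qed

lemma relaxed_limit_mono:
  assumes \<sigma>: "\<sigma> = 1 \<or> \<sigma> = - 1" and w: "relaxed_limit \<sigma> w" and "t \<ge> 0" "x \<le> y"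
  shows "w (t, x) \<le> w (t, y)"
proof -
  have m: "v \<epsilon> t x \<le> v \<epsilon> t y + 0 + C * \<epsilon>" "- v \<epsilon> t y \<le> - v \<epsilon> t x + 0 + C * \<epsilon>" if "\<epsilon> > 0" for \<epsilon>
    using mono[OF that assms(3,4)] mult_nonneg_nonneg[OF nonneg(1), of \<epsilon>] that by simp_all
  from \<sigma> show ?thesis
  proof
    assume "\<sigma> = 1"
    then show ?thesis using relaxed_limit_transfer[OF \<sigma> w assms(3,3), of x y 0] m(1) by simp
  next
    assume "\<sigma> = - 1"
    then show ?thesis using relaxed_limit_transfer[OF \<sigma> w assms(3,3), of y x 0] m(2) by simp
  qed
qed

lemma relaxed_limit_init:
  assumes \<sigma>: "\<sigma> = 1 \<or> \<sigma> = - 1" and w: "relaxed_limit \<sigma> w"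
  shows "w (0, x) = g x"
proof (rule antisym)
  have ev: "\<forall>\<^sub>F \<epsilon> in at_right 0. v \<epsilon> 0 x = g x"
    using near_zero[OF zero_less_one] by eventually_elim (simp add: init)
  have le: "\<sigma> * w (0, x) \<le> \<sigma> * g x"
    by (rule relaxed_limit_le[OF w]) (use ev in \<open>auto elim: eventually_mono\<close>)
  have ge: "\<sigma> * g x \<le> \<sigma> * w (0, x)"
  proof (rule field_le_epsilon)
    fix e :: real assume "e > 0"
    have "\<forall>\<^sub>F \<epsilon> in at_right (0::real). \<sigma> * g x \<le> \<sigma> * w (0, x) + e"
      using relaxed_limit_less[OF w order_refl \<open>e > 0\<close>, of x] ev by eventually_elim simp
    then show "\<sigma> * g x \<le> \<sigma> * w (0, x) + e"
      by (simp add: eventually_const_iff trivial_limit_at_right_real)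
  qed
  show "w (0, x) \<le> g x" "g x \<le> w (0, x)" using le ge \<sigma> by auto
qed

text \<open>The eventual inequality holds simultaneously at the points of a finite
  \<open>d\<close>-net, and the Lipschitz bounds for \<open>v\<close> and \<open>w\<close> carry it
  to all of \<open>S\<close>. Since \<open>P * d = e / 8\<close>, the errors \<open>e / 8\<close>
  (twice) and \<open>e / 4\<close> (twice) stay below \<open>e\<close>.\<close>

lemma relaxed_limit_uniform:
  assumes \<sigma>: "\<sigma> = 1 \<or> \<sigma> = - 1" and w: "relaxed_limit \<sigma> w"
    and S: "compact S" "S \<subseteq> time_space" and "e > 0"
  shows "\<forall>\<^sub>F \<epsilon> in at_right 0. \<forall>q\<in>S. \<sigma> * v \<epsilon> (fst q) (snd q) \<le> \<sigma> * w q + e"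
proof -
  define P where "P = C + K + 1"
  define d where "d = e / (8 * P)"
  have pos: "P > 0" using nonneg by (simp add: P_def)
  have "d > 0" using \<open>e > 0\<close> pos by (simp add: d_def)
  have "S \<subseteq> (\<Union>c\<in>S. ball c d)" using \<open>d > 0\<close> by auto
  then obtain N where N: "N \<subseteq> S" "finite N" "S \<subseteq> (\<Union>c\<in>N. ball c d)"
    using compactE_image[OF S(1), of S "\<lambda>c. ball c d"] by blast
  have "\<forall>\<^sub>F \<epsilon> in at_right 0. \<forall>c\<in>N. \<sigma> * v \<epsilon> (fst c) (snd c) < \<sigma> * w (fst c, snd c) + e / 4"
    using N S(2) \<open>e > 0\<close> by (intro eventually_ball_finite ballI relaxed_limit_less[OF w]) auto
  moreover have "\<forall>\<^sub>F \<epsilon> in at_right 0. \<epsilon> > 0 \<and> C * \<epsilon> < e / 4" using \<open>e > 0\<close> by (intro small) simp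
  ultimately show ?thesis
  proof eventually_elim
    case (elim \<epsilon>)
    show ?case
    proof
      fix q assume "q \<in> S"
      then obtain c where c: "c \<in> N" "dist c q < d" using N(3) by auto
      have q0: "fst q \<ge> 0" "fst c \<ge> 0" using \<open>q \<in> S\<close> c N(1) S(2) by auto
      have f: "\<bar>fst q - fst c\<bar> \<le> d" using dist_fst_le[of c q] c by (simp add: dist_real_def)
      have s: "\<bar>snd q - snd c\<bar> \<le> d" using dist_snd_le[of c q] c by (simp add: dist_real_def)
      define E where "E = C * \<bar>fst q - fst c\<bar> + K * \<bar>snd q - snd c\<bar>"
      have "E \<le> C * d + K * d" unfolding E_def using f s nonneg by (intro add_mono mult_left_mono) auto
      also have "\<dots> \<le> P * d" using \<open>d > 0\<close> by (simp add: P_def distrib_right)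
      also have "\<dots> = e / 8" using pos by (simp add: d_def)
      finally have E: "E \<le> e / 8" .
      have "\<bar>v \<epsilon> (fst q) (snd q) - v \<epsilon> (fst c) (snd c)\<bar> \<le> E + C * \<epsilon>"
        using v_lipschitz[of \<epsilon> "fst c" "fst q" "snd q" "snd c"] elim q0 by (simp add: E_def)
      then have "\<sigma> * v \<epsilon> (fst q) (snd q) \<le> \<sigma> * v \<epsilon> (fst c) (snd c) + E + C * \<epsilon>"
        using \<sigma> by (auto simp: abs_le_iff)
      moreover have "\<bar>w (fst q, snd q) - w (fst c, snd c)\<bar> \<le> E"
        using relaxed_limit_lipschitz[OF \<sigma> w q0(2,1), of "snd q" "snd c"] by (simp add: E_def)
      then have "\<sigma> * w (fst c, snd c) \<le> \<sigma> * w q + E" using \<sigma> by (auto simp: abs_le_iff)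
      moreover have "\<sigma> * v \<epsilon> (fst c) (snd c) < \<sigma> * w (fst c, snd c) + e / 4" using elim(1) c(1) by blast
      ultimately show "\<sigma> * v \<epsilon> (fst q) (snd q) \<le> \<sigma> * w q + e"
        using elim(2) E \<open>e > 0\<close> by linarith
    qed
  qed
qed

lemma step:
  assumes \<sigma>: "\<sigma> = 1 \<or> \<sigma> = - 1" and "p \<ge> 0"
  obtains C' where "\<And>\<epsilon> t h x c. \<epsilon> > 0 \<Longrightarrow> t \<ge> 0 \<Longrightarrow> h > 0 \<Longrightarrow>
      (\<And>y. \<bar>y - x\<bar> \<le> R * (h + \<epsilon>) \<Longrightarrow> \<sigma> * v \<epsilon> t y \<le> \<sigma> * (c + p * (y - x))) \<Longrightarrow>
      \<sigma> * v \<epsilon> (t + h) x \<le> \<sigma> * (c + h * H p) + C' * \<epsilon>"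
  using \<sigma>
proof
  assume "\<sigma> = 1"
  obtain C' where "\<forall>\<epsilon>>0. \<forall>t\<ge>0. \<forall>h>0. \<forall>x c.
      (\<forall>y. \<bar>y - x\<bar> \<le> R * (h + \<epsilon>) \<longrightarrow> v \<epsilon> t y \<le> c + p * (y - x)) \<longrightarrow> v \<epsilon> (t + h) x \<le> c + h * H p + C' * \<epsilon>"
    using step_up[OF \<open>p \<ge> 0\<close>] by blast
  then show ?thesis using that[of C'] \<open>\<sigma> = 1\<close> by simp
next
  assume "\<sigma> = - 1"
  obtain C' where C': "\<forall>\<epsilon>>0. \<forall>t\<ge>0. \<forall>h>0. \<forall>x c.
      (\<forall>y. \<bar>y - x\<bar> \<le> R * (h + \<epsilon>) \<longrightarrow> c + p * (y - x) \<le> v \<epsilon> t y) \<longrightarrow> c + h * H p - C' * \<epsilon> \<le> v \<epsilon> (t + h) x"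
    using step_down[OF \<open>p \<ge> 0\<close>] by blast
  show ?thesis
  proof (rule that[of C'])
    fix \<epsilon> t h x c
    assume "\<epsilon> > 0" "t \<ge> 0" "h > 0"
      and *: "\<And>y. \<bar>y - x\<bar> \<le> R * (h + \<epsilon>) \<Longrightarrow> \<sigma> * v \<epsilon> t y \<le> \<sigma> * (c + p * (y - x))"
    have "c + p * (y - x) \<le> v \<epsilon> t y" if "\<bar>y - x\<bar> \<le> R * (h + \<epsilon>)" for y
      using *[OF that] \<open>\<sigma> = - 1\<close> by simp
    then have "c + h * H p - C' * \<epsilon> \<le> v \<epsilon> (t + h) x"
      using C' \<open>\<epsilon> > 0\<close> \<open>t \<ge> 0\<close> \<open>h > 0\<close> by blast
    then show "\<sigma> * v \<epsilon> (t + h) x \<le> \<sigma> * (c + h * H p) + C' * \<epsilon>" using \<open>\<sigma> = - 1\<close> by simp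
  qed
qed

text \<open>At time \<open>t - h\<close> the first order expansion of the test function puts
  \<open>w\<close>, and for small \<open>\<epsilon>\<close> also \<open>v\<close>, on one side of an
  affine profile of slope \<open>p\<close>, up to a small multiple of \<open>h\<close>. The step
  property moves this profile to time \<open>t\<close> at speed \<open>H p\<close>; comparing with
  the value of \<open>w\<close> there and dividing by \<open>h\<close> gives the inequality.\<close>

lemma touching_inequality:
  assumes \<sigma>: "\<sigma> = 1 \<or> \<sigma> = - 1" and w: "relaxed_limit \<sigma> w" and "t > 0"
    and \<phi>: "(\<phi> has_derivative (\<lambda>(s, y). a * s + p * y)) (at (t, x))"
    and touch: "\<forall>\<^sub>F q in nhds (t, x). \<sigma> * (w q - \<phi> q) \<le> \<sigma> * (w (t, x) - \<phi> (t, x))"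
  shows "\<sigma> * a \<le> \<sigma> * H p"
proof -
  have expand: "\<exists>d>0. \<forall>s y. \<bar>s\<bar> + \<bar>y\<bar> < d \<longrightarrow>
      \<sigma> * (w (t + s, x + y) - w (t, x)) \<le> \<sigma> * (a * s + p * y) + \<theta> * (\<bar>s\<bar> + \<bar>y\<bar>)" if "\<theta> > 0" for \<theta>
  proof -
    obtain d1 where d1: "d1 > 0" "\<And>q. dist q (t, x) < d1 \<Longrightarrow> \<sigma> * (w q - \<phi> q) \<le> \<sigma> * (w (t, x) - \<phi> (t, x))"
      using touch unfolding eventually_nhds_metric by blast
    obtain d2 where d2: "d2 > 0" "\<And>q. norm (q - (t, x)) < d2 \<Longrightarrow>
        norm (\<phi> q - \<phi> (t, x) - (case q - (t, x) of (s, y) \<Rightarrow> a * s + p * y)) \<le> \<theta> * norm (q - (t, x))"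
      using \<phi> \<open>\<theta> > 0\<close> unfolding has_derivative_at_alt by blast
    have "\<sigma> * (w (t + s, x + y) - w (t, x)) \<le> \<sigma> * (a * s + p * y) + \<theta> * (\<bar>s\<bar> + \<bar>y\<bar>)"
      if sy: "\<bar>s\<bar> + \<bar>y\<bar> < min d1 d2" for s y
    proof -
      have nrm: "norm (s, y) \<le> \<bar>s\<bar> + \<bar>y\<bar>" using norm_Pair_le[of s y] by simp
      then have "\<sigma> * (w (t + s, x + y) - \<phi> (t + s, x + y)) \<le> \<sigma> * (w (t, x) - \<phi> (t, x))"
        using sy by (intro d1(2)) (simp add: dist_norm)
      moreover have "\<bar>\<phi> (t + s, x + y) - \<phi> (t, x) - (a * s + p * y)\<bar> \<le> \<theta> * norm (s, y)"
        using d2(2)[of "(t + s, x + y)"] nrm sy by simp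
      moreover have "\<theta> * norm (s, y) \<le> \<theta> * (\<bar>s\<bar> + \<bar>y\<bar>)" using nrm \<open>\<theta> > 0\<close> by simp
      ultimately show ?thesis using \<sigma> by (auto simp: abs_le_iff algebra_simps)
    qed
    then show ?thesis using d1(1) d2(1) by (intro exI[of _ "min d1 d2"]) auto
  qed
  \<comment> \<open>A negative slope would make \<open>w\<close> decrease in \<open>x\<close> near
    the touching point, to first order. The error rate \<open>- p / 2\<close> absorbs only half of
    that slope.\<close>
  have "p \<ge> 0"
  proof (rule ccontr)
    assume "\<not> p \<ge> 0"
    then have "- p / 2 > 0" by simp
    from expand[OF this] obtain d where d: "d > 0" "\<And>s y. \<bar>s\<bar> + \<bar>y\<bar> < d \<Longrightarrow>
      \<sigma> * (w (t + s, x + y) - w (t, x)) \<le> \<sigma> * (a * s + p * y) + (- p / 2) * (\<bar>s\<bar> + \<bar>y\<bar>)" by blast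
    define y where "y = \<sigma> * (d / 2)"
    have "\<bar>y\<bar> = d / 2" "\<sigma> * y = d / 2" using \<sigma> \<open>d > 0\<close> by (auto simp: y_def abs_mult)
    have "0 \<le> \<sigma> * (w (t, x + y) - w (t, x))"
      using \<sigma> relaxed_limit_mono[OF \<sigma> w, of t x "x + y"] relaxed_limit_mono[OF \<sigma> w, of t "x + y" x] \<open>t > 0\<close> \<open>d > 0\<close>
      by (auto simp: y_def)
    also have "\<dots> \<le> \<sigma> * (a * 0 + p * y) + (- p / 2) * (\<bar>0\<bar> + \<bar>y\<bar>)"
    proof -
      have "\<bar>0\<bar> + \<bar>y\<bar> < d" using \<open>\<bar>y\<bar> = d / 2\<close> \<open>d > 0\<close> by simp
      from d(2)[OF this] show ?thesis by (simp only: add_0_right)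
    qed
    also have "\<dots> = p * (\<sigma> * y) + (- p / 2) * \<bar>y\<bar>" by simp
    also have "\<dots> = p * d / 4" unfolding \<open>\<bar>y\<bar> = d / 2\<close> \<open>\<sigma> * y = d / 2\<close> by simp
    also have "\<dots> < 0" using \<open>\<not> p \<ge> 0\<close> \<open>d > 0\<close> by (simp add: mult_neg_pos)
    finally show False by simp
  qed
  obtain C' where C': "\<And>\<epsilon> t h x c. \<epsilon> > 0 \<Longrightarrow> t \<ge> 0 \<Longrightarrow> h > 0 \<Longrightarrow>
      (\<And>y. \<bar>y - x\<bar> \<le> R * (h + \<epsilon>) \<Longrightarrow> \<sigma> * v \<epsilon> t y \<le> \<sigma> * (c + p * (y - x))) \<Longrightarrow>
      \<sigma> * v \<epsilon> (t + h) x \<le> \<sigma> * (c + h * H p) + C' * \<epsilon>"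
    by (rule step[OF \<sigma> \<open>p \<ge> 0\<close>]) blast
  have \<sigma>\<sigma>: "\<sigma> * (\<sigma> * b) = b" for b using \<sigma> by auto
  have main: "\<sigma> * a \<le> \<sigma> * H p + (2 * R + 3) * \<theta>" if "\<theta> > 0" for \<theta>
  proof -
    from expand[OF \<open>\<theta> > 0\<close>] obtain d where d: "d > 0" "\<And>s y. \<bar>s\<bar> + \<bar>y\<bar> < d \<Longrightarrow>
      \<sigma> * (w (t + s, x + y) - w (t, x)) \<le> \<sigma> * (a * s + p * y) + \<theta> * (\<bar>s\<bar> + \<bar>y\<bar>)" by blast
    \<comment> \<open>The base of the cone, of radius \<open>2 * R * h\<close>, has to lie at a
      nonnegative time and where the expansion holds.\<close>
    define h where "h = min (t / 2) (d / (2 * (2 * R + 1)))"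
    have R1: "2 * R + 1 > 0" using nonneg by simp
    have "h > 0" using \<open>t > 0\<close> \<open>d > 0\<close> R1 by (simp add: h_def)
    have "h \<le> d / (2 * (2 * R + 1))" "t - h \<ge> 0" using \<open>t > 0\<close> by (auto simp: h_def)
    then have hd: "(2 * R + 1) * h < d" using R1 \<open>d > 0\<close> by (simp add: field_simps)
    have w_le: "\<sigma> * w (t - h, y) \<le> \<sigma> * (w (t, x) - a * h + p * (y - x)) + \<theta> * ((2 * R + 1) * h)"
      if y: "\<bar>y - x\<bar> \<le> 2 * R * h" for y
    proof -
      have le: "\<bar>- h\<bar> + \<bar>y - x\<bar> \<le> (2 * R + 1) * h" using y \<open>h > 0\<close> by (simp add: algebra_simps)
      then have "\<sigma> * (w (t + - h, x + (y - x)) - w (t, x)) \<le> \<sigma> * (a * - h + p * (y - x)) + \<theta> * (\<bar>- h\<bar> + \<bar>y - x\<bar>)"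
        using hd by (intro d(2)) simp
      moreover have "\<theta> * (\<bar>- h\<bar> + \<bar>y - x\<bar>) \<le> \<theta> * ((2 * R + 1) * h)"
        using le \<open>\<theta> > 0\<close> by simp
      ultimately show ?thesis by (simp add: algebra_simps)
    qed
    define S where "S = {t - h} \<times> {x - 2 * R * h..x + 2 * R * h}"
    have S: "compact S" "S \<subseteq> time_space"
      using \<open>t - h \<ge> 0\<close> by (auto simp: S_def intro!: compact_Times)
    \<comment> \<open>The added terms are the errors of the expansion and of the uniform
      convergence; the factor \<sigma> gives them the right sign, its square being 1. One more
      \<open>\<theta> * h\<close> absorbs \<open>C' * \<epsilon>\<close>, whence the total
      \<open>2 * R + 3\<close>.\<close>
    define c where "c = w (t, x) - a * h + \<sigma> * (\<theta> * ((2 * R + 1) * h) + \<theta> * h)"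
    have "\<sigma> * w (t, x) \<le> \<sigma> * (c + h * H p) + \<theta> * h"
    proof (rule relaxed_limit_le[OF w])
      fix e :: real assume "e > 0"
      have "\<theta> * h > 0" using \<open>\<theta> > 0\<close> \<open>h > 0\<close> by simp
      from relaxed_limit_uniform[OF \<sigma> w S this] near_zero[OF \<open>h > 0\<close>] small[OF this, of C']
      show "\<forall>\<^sub>F \<epsilon> in at_right 0. \<sigma> * v \<epsilon> t x \<le> \<sigma> * (c + h * H p) + \<theta> * h + e"
      proof eventually_elim
        case (elim \<epsilon>)
        have "\<sigma> * v \<epsilon> (t - h + h) x \<le> \<sigma> * (c + h * H p) + C' * \<epsilon>"
        proof (rule C')
          fix y assume y: "\<bar>y - x\<bar> \<le> R * (h + \<epsilon>)"
          also have "\<dots> \<le> R * (h + h)" using elim nonneg by (intro mult_left_mono) auto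
          finally have y': "\<bar>y - x\<bar> \<le> 2 * R * h" by simp
          then have "(t - h, y) \<in> S" by (auto simp: S_def abs_le_iff)
          then have "\<sigma> * v \<epsilon> (t - h) y \<le> \<sigma> * w (t - h, y) + \<theta> * h" using elim(1) by fastforce
          also have "\<dots> \<le> \<sigma> * (w (t, x) - a * h + p * (y - x)) + \<theta> * ((2 * R + 1) * h) + \<theta> * h"
            using w_le[OF y'] by simp
          also have "\<dots> = \<sigma> * (c + p * (y - x))"
            using \<sigma>\<sigma>[of "\<theta> * ((2 * R + 1) * h) + \<theta> * h"] unfolding c_def distrib_left right_diff_distrib by simp
          finally show "\<sigma> * v \<epsilon> (t - h) y \<le> \<sigma> * (c + p * (y - x))" .
        qed (use elim \<open>t - h \<ge> 0\<close> \<open>h > 0\<close> in auto)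
        then show ?case using elim \<open>e > 0\<close> by simp
      qed
    qed (use \<open>t > 0\<close> in simp)
    also have "\<sigma> * (c + h * H p) + \<theta> * h = \<sigma> * w (t, x) + h * (\<sigma> * H p + (2 * R + 3) * \<theta> - \<sigma> * a)"
      using \<sigma>\<sigma>[of "\<theta> * ((2 * R + 1) * h) + \<theta> * h"] unfolding c_def distrib_left right_diff_distrib
      by (simp add: algebra_simps)
    finally have "0 \<le> h * (\<sigma> * H p + (2 * R + 3) * \<theta> - \<sigma> * a)" by simp
    then show ?thesis using \<open>h > 0\<close> by (simp add: zero_le_mult_iff)
  qed
  show ?thesis
  proof (rule field_le_epsilon)
    fix e :: real assume "e > 0"
    then have "e / (2 * R + 3) > 0" using nonneg by simp
    from main[OF this] show "\<sigma> * a \<le> \<sigma> * H p + e" using nonneg by simp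
  qed
qed

end

section \<open>Functions that agree at nonnegative times, and uniqueness for the limit
  equation\<close>

lemma usc_on_cong: "(\<And>x. x \<in> S \<Longrightarrow> f x = g x) \<Longrightarrow> usc_on S f \<Longrightarrow> usc_on S g"
proof (rule usc_onI)
  fix p a assume eq: "\<And>x. x \<in> S \<Longrightarrow> f x = g x" and f: "usc_on S f" and p: "p \<in> S" "g p < a"
  then have less: "f p < a" by simp
  obtain A where "open A" "p \<in> A" "\<And>q. q \<in> A \<Longrightarrow> q \<in> S \<Longrightarrow> f q < a"
    by (rule usc_onD[OF f p(1) less]) (rule that)
  then show "\<exists>A. open A \<and> p \<in> A \<and> (\<forall>q\<in>A \<inter> S. g q < a)" using eq by (intro exI[of _ A]) auto
qed

lemma eventually_pos_time_space: "p \<in> pos_time_space \<Longrightarrow> \<forall>\<^sub>F q in nhds p. q \<in> pos_time_space"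
  by (rule eventually_nhds_in_open) (auto intro: open_Times)

lemma locally_bdd_cong:
  assumes eq: "\<And>p. p \<in> time_space \<Longrightarrow> w p = w' p" and w: "locally_bdd w"
  shows "locally_bdd w'"
proof -
  have "w' ` (ball p r \<inter> time_space) = w ` (ball p r \<inter> time_space)" for p r
    using eq by (auto intro!: image_cong)
  then show ?thesis using w by (simp add: locally_bdd_def)
qed

lemma HJ_subsolution_cong:
  assumes eq: "\<And>p. p \<in> time_space \<Longrightarrow> w p = w' p" and w: "HJ_subsolution H g w"
  shows "HJ_subsolution H g w'"
  unfolding HJ_subsolution_def
proof (intro conjI allI impI ballI)
  show "locally_bdd w'"
    by (rule locally_bdd_cong[OF eq]) (use w in \<open>auto simp: HJ_subsolution_def\<close>)
  show "upper_semicont w'"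
    using usc_on_cong[of time_space w w'] eq w by (simp add: HJ_subsolution_def upper_semicont_iff_usc_on)
  show "w' (0, x) \<le> g x" for x
  proof -
    have "w (0, x) \<le> g x" using w unfolding HJ_subsolution_def by blast
    then show ?thesis using eq[of "(0, x)"] by simp
  qed
  fix \<phi> \<phi>\<^sub>t \<phi>\<^sub>x p
  assume C1: "C1_test \<phi> \<phi>\<^sub>t \<phi>\<^sub>x" and p: "p \<in> pos_time_space" and max: "local_max_at (\<lambda>q. w' q - \<phi> q) p"
  have "local_max_at (\<lambda>q. w q - \<phi> q) p"
    using max eventually_pos_time_space[OF p] unfolding local_max_at_def
    by eventually_elim (use eq p in auto)
  then show "\<phi>\<^sub>t p \<le> H (\<phi>\<^sub>x p)" by (rule HJ_subsolutionD[OF w C1 p])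
qed

lemma HJ_supersolution_cong:
  assumes eq: "\<And>p. p \<in> time_space \<Longrightarrow> w p = w' p" and w: "HJ_supersolution H g w"
  shows "HJ_supersolution H g w'"
  unfolding HJ_supersolution_def
proof (intro conjI allI impI ballI)
  show "locally_bdd w'"
    by (rule locally_bdd_cong[OF eq]) (use w in \<open>auto simp: HJ_supersolution_def\<close>)
  show "lower_semicont w'"
    using usc_on_cong[of time_space "\<lambda>p. - w p" "\<lambda>p. - w' p"] eq w
    by (simp add: HJ_supersolution_def lower_semicont_iff_usc_on)
  show "g x \<le> w' (0, x)" for x
  proof -
    have "g x \<le> w (0, x)" using w unfolding HJ_supersolution_def by blast
    then show ?thesis using eq[of "(0, x)"] by simp
  qed
  fix \<phi> \<phi>\<^sub>t \<phi>\<^sub>x p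
  assume C1: "C1_test \<phi> \<phi>\<^sub>t \<phi>\<^sub>x" and p: "p \<in> pos_time_space" and min: "local_min_at (\<lambda>q. w' q - \<phi> q) p"
  have "local_min_at (\<lambda>q. w q - \<phi> q) p"
    using min eventually_pos_time_space[OF p] unfolding local_min_at_def
    by eventually_elim (use eq p in auto)
  then show "H (\<phi>\<^sub>x p) \<le> \<phi>\<^sub>t p" by (rule HJ_supersolutionD[OF w C1 p])
qed

lemma near_initial_envelope_bounds:
  assumes w: "locally_bdd w" and g: "continuous_on UNIV g" and near: "near_initial g w" and "T > 0"
  shows "\<exists>C. \<forall>t\<in>{0..T}. \<forall>x. usc_envelope w (t, x) \<le> g x + C"
    and "\<exists>C. \<forall>t\<in>{0..T}. \<forall>x. g x - C \<le> lsc_envelope w (t, x)"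
proof -
  have "T + 1 > 0" using \<open>T > 0\<close> by simp
  then obtain C where C: "\<And>t x. t \<in> {0..T + 1} \<Longrightarrow> \<bar>w (t, x) - g x\<bar> \<le> C"
    using near unfolding near_initial_def by blast
  have t: "t \<in> {0..<T + 1}" if "t \<in> {0..T}" for t using that by simp
  show "\<exists>C. \<forall>t\<in>{0..T}. \<forall>x. usc_envelope w (t, x) \<le> g x + C"
    using envelope_uniform_bounds(1)[OF w g t C] by blast
  show "\<exists>C. \<forall>t\<in>{0..T}. \<forall>x. g x - C \<le> lsc_envelope w (t, x)"
    using envelope_uniform_bounds(2)[OF w g t C] by blast
qed

text \<open>Each solution lies between its envelopes, and by comparison the upper envelope of one is
  below the lower envelope of the other; then the roles are exchanged.\<close>

lemma HJ_solution_unique: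
  assumes H: "\<And>p q. \<bar>H p - H q\<bar> \<le> L * \<bar>p - q\<bar>" "L \<ge> 0"
    and g: "\<And>x y. \<bar>g x - g y\<bar> \<le> K * \<bar>x - y\<bar>" "K \<ge> 0"
    and w: "is_HJ_solution H g w" and w': "is_HJ_solution H g w'" and "p \<in> time_space"
  shows "w' p = w p"
proof -
  have "K-lipschitz_on UNIV g" using g by (intro lipschitz_onI) (auto simp: dist_real_def)
  then have g_cont: "continuous_on UNIV g" by (rule lipschitz_on_continuous_on)
  have le: "w1 p \<le> w2 p" if w1: "is_HJ_solution H g w1" and w2: "is_HJ_solution H g w2" for w1 w2
  proof -
    have v: "HJ_subsolution H g (usc_envelope w1)" "locally_bdd w1" "near_initial g w1"
      "HJ_supersolution H g (lsc_envelope w2)" "locally_bdd w2" "near_initial g w2"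
      using w1 w2 unfolding is_HJ_solution_def HJ_viscosity_solution_def by auto
    obtain t x where p: "p = (t, x)" "t \<ge> 0" using \<open>p \<in> time_space\<close> by (cases p) auto
    have "w1 p \<le> usc_envelope w1 p" by (rule Limsup_envelope(2)[OF v(2) \<open>p \<in> time_space\<close>])
    also have "\<dots> \<le> lsc_envelope w2 p"
      unfolding p(1)
      by (rule HJ_comparison[OF H v(1,4) g near_initial_envelope_bounds(1)[OF v(2) g_cont v(3)]
        near_initial_envelope_bounds(2)[OF v(5) g_cont v(6)] p(2)])
    also have "\<dots> \<le> w2 p" by (rule lsc_envelope_le[OF v(5) \<open>p \<in> time_space\<close>])
    finally show ?thesis .
  qed
  show ?thesis using le[OF w w'] le[OF w' w] by simp
qed

section \<open>The two relaxed limits solve the limit equation and coincide\<close>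

context scaling_limit
begin

lemma relaxed_limit_continuous:
  assumes \<sigma>: "\<sigma> = 1 \<or> \<sigma> = - 1" and w: "relaxed_limit \<sigma> w"
  shows "continuous_on time_space w"
proof -
  have "(C + K)-lipschitz_on time_space w"
  proof (rule lipschitz_onI)
    fix p q :: "real \<times> real" assume "p \<in> time_space" "q \<in> time_space"
    then have "fst p \<ge> 0" "fst q \<ge> 0" by auto
    then have "dist (w p) (w q) \<le> C * \<bar>fst p - fst q\<bar> + K * \<bar>snd p - snd q\<bar>"
      using relaxed_limit_lipschitz[OF \<sigma> w, of "fst q" "fst p" "snd p" "snd q"] by (simp add: dist_real_def)
    also have "\<dots> \<le> C * dist p q + K * dist p q"
      using dist_fst_le[of p q] dist_snd_le[of p q] nonneg
      by (intro add_mono mult_left_mono) (auto simp: dist_real_def)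
    finally show "dist (w p) (w q) \<le> (C + K) * dist p q" by (simp add: distrib_right)
  qed (use nonneg in simp)
  then show ?thesis by (rule lipschitz_on_continuous_on)
qed

lemma relaxed_limit_bound:
  assumes \<sigma>: "\<sigma> = 1 \<or> \<sigma> = - 1" and w: "relaxed_limit \<sigma> w" and "t \<in> {0..T}"
  shows "\<bar>w (t, x) - g x\<bar> \<le> C * T"
proof -
  have "\<bar>w (t, x) - w (0, x)\<bar> \<le> C * \<bar>t - 0\<bar> + K * \<bar>x - x\<bar>"
    by (rule relaxed_limit_lipschitz[OF \<sigma> w]) (use \<open>t \<in> {0..T}\<close> in auto)
  also have "\<dots> \<le> C * T" using \<open>t \<in> {0..T}\<close> nonneg by (auto intro: mult_left_mono)
  finally show ?thesis by (simp add: relaxed_limit_init[OF \<sigma> w])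
qed

lemma upper_limit_HJ_subsolution:
  assumes w: "relaxed_limit 1 w" shows "HJ_subsolution H g w"
  unfolding HJ_subsolution_def
proof (intro conjI allI impI ballI)
  have cont: "continuous_on time_space w" by (rule relaxed_limit_continuous[OF _ w]) simp
  show "locally_bdd w" by (rule envelope_continuous(1)[OF cont, of "(0, 0)"]) simp
  show "upper_semicont w" unfolding upper_semicont_iff_usc_on by (rule continuous_on_imp_usc_on[OF cont])
  show "w (0, x) \<le> g x" for x by (simp add: relaxed_limit_init[OF _ w])
  fix \<phi> \<phi>\<^sub>t \<phi>\<^sub>x p
  assume C1: "C1_test \<phi> \<phi>\<^sub>t \<phi>\<^sub>x" and p: "p \<in> pos_time_space" and max: "local_max_at (\<lambda>q. w q - \<phi> q) p"
  obtain t x where tx: "p = (t, x)" by (cases p)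
  have "(\<phi> has_derivative (\<lambda>(s, y). \<phi>\<^sub>t p * s + \<phi>\<^sub>x p * y)) (at (t, x))"
    using C1 p unfolding C1_test_def tx by blast
  from touching_inequality[OF _ w _ this] show "\<phi>\<^sub>t p \<le> H (\<phi>\<^sub>x p)"
    using p max by (auto simp: tx local_max_at_def)
qed

lemma lower_limit_HJ_supersolution:
  assumes w: "relaxed_limit (- 1) w" shows "HJ_supersolution H g w"
  unfolding HJ_supersolution_def
proof (intro conjI allI impI ballI)
  have cont: "continuous_on time_space w" by (rule relaxed_limit_continuous[OF _ w]) simp
  show "locally_bdd w" by (rule envelope_continuous(1)[OF cont, of "(0, 0)"]) simp
  show "lower_semicont w" unfolding lower_semicont_iff_usc_on
    by (rule continuous_on_imp_usc_on[OF continuous_on_minus[OF cont]])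
  show "g x \<le> w (0, x)" for x by (simp add: relaxed_limit_init[OF _ w])
  fix \<phi> \<phi>\<^sub>t \<phi>\<^sub>x p
  assume C1: "C1_test \<phi> \<phi>\<^sub>t \<phi>\<^sub>x" and p: "p \<in> pos_time_space" and min: "local_min_at (\<lambda>q. w q - \<phi> q) p"
  obtain t x where tx: "p = (t, x)" by (cases p)
  have "(\<phi> has_derivative (\<lambda>(s, y). \<phi>\<^sub>t p * s + \<phi>\<^sub>x p * y)) (at (t, x))"
    using C1 p unfolding C1_test_def tx by blast
  moreover have "\<forall>\<^sub>F q in nhds (t, x). - 1 * (w q - \<phi> q) \<le> - 1 * (w (t, x) - \<phi> (t, x))"
    using min unfolding local_min_at_def tx by eventually_elim simp
  moreover have "t > 0" using p by (simp add: tx)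
  ultimately have "- 1 * \<phi>\<^sub>t p \<le> - 1 * H (\<phi>\<^sub>x p)"
    using touching_inequality[OF _ w] by simp
  then show "H (\<phi>\<^sub>x p) \<le> \<phi>\<^sub>t p" by simp
qed

text \<open>Comparison puts the upper limit below the lower one, while the reverse inequality holds
  because \<open>v\<close> is eventually between the two, up to \<open>e / 2\<close> on each side.
  Their common value inherits both viscosity inequalities, and the two one-sided uniform estimates
  combine into uniform convergence.\<close>

theorem converges_to_HJ_solution:
  "\<exists>w. is_unique_HJ_solution H g w \<and>
    (\<forall>S e. compact S \<longrightarrow> S \<subseteq> time_space \<longrightarrow> e > 0 \<longrightarrow>
      (\<forall>\<^sub>F \<epsilon> in at_right 0. \<forall>q\<in>S. \<bar>v \<epsilon> (fst q) (snd q) - w q\<bar> \<le> e))"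
proof -
  obtain w where w: "relaxed_limit 1 w" using relaxed_limit_exists[of 1] by auto
  obtain w' where w': "relaxed_limit (- 1) w'" using relaxed_limit_exists[of "- 1"] by auto
  have g: "\<bar>g x - g y\<bar> \<le> K * \<bar>x - y\<bar>" for x y
    using relaxed_limit_lipschitz[OF _ w, of 0 0 x y] by (simp add: relaxed_limit_init[OF _ w])
  have eq: "w p = w' p" if pts: "p \<in> time_space" for p
  proof (rule antisym)
    obtain t x where p: "p = (t, x)" "t \<ge> 0" using pts by (cases p) auto
    have b1: "\<exists>B. \<forall>t\<in>{0..T}. \<forall>x. w (t, x) \<le> g x + B" for T
    proof (intro exI ballI allI)
      fix t x assume "t \<in> {0..T}"
      then show "w (t, x) \<le> g x + C * T" using relaxed_limit_bound[OF _ w, of t T x] by (simp add: abs_le_iff)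
    qed
    have b2: "\<exists>B. \<forall>t\<in>{0..T}. \<forall>x. g x - B \<le> w' (t, x)" for T
    proof (intro exI ballI allI)
      fix t x assume "t \<in> {0..T}"
      then show "g x - C * T \<le> w' (t, x)" using relaxed_limit_bound[OF _ w', of t T x] by (simp add: abs_le_iff)
    qed
    show "w p \<le> w' p"
      unfolding p(1)
      by (rule HJ_comparison[OF H_lipschitz nonneg(4) upper_limit_HJ_subsolution[OF w]
        lower_limit_HJ_supersolution[OF w'] g nonneg(2) b1 b2 p(2)])
    show "w' p \<le> w p"
    proof (rule field_le_epsilon)
      fix e :: real assume "e > 0"
      then have "e / 2 > 0" by simp
      have "\<forall>\<^sub>F \<epsilon> in at_right (0::real). w' p \<le> w p + e"
        using relaxed_limit_less[OF w p(2) \<open>e / 2 > 0\<close>, of x] relaxed_limit_less[OF w' p(2) \<open>e / 2 > 0\<close>, of x]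
        by eventually_elim (simp add: p(1))
      then show "w' p \<le> w p + e" by (simp add: eventually_const_iff trivial_limit_at_right_real)
    qed
  qed
  have cont: "continuous_on time_space w" by (rule relaxed_limit_continuous[OF _ w]) simp
  have sol: "is_HJ_solution H g w"
    unfolding is_HJ_solution_def HJ_viscosity_solution_def
  proof (intro conjI)
    show "locally_bdd w" by (rule envelope_continuous(1)[OF cont, of "(0, 0)"]) simp
    show "HJ_subsolution H g (usc_envelope w)"
      by (rule HJ_subsolution_cong[OF _ upper_limit_HJ_subsolution[OF w]]) (simp add: envelope_continuous(2)[OF cont])
    show "HJ_supersolution H g (lsc_envelope w)"
      by (rule HJ_supersolution_cong[OF _ lower_limit_HJ_supersolution[OF w']])
        (simp add: envelope_continuous(3)[OF cont] eq)
    show "near_initial g w"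
      unfolding near_initial_def using relaxed_limit_bound[OF _ w] by blast
  qed
  have "is_unique_HJ_solution H g w"
    unfolding is_unique_HJ_solution_def
    using sol HJ_solution_unique[OF H_lipschitz nonneg(4) g nonneg(2) sol] by blast
  moreover have "\<forall>\<^sub>F \<epsilon> in at_right 0. \<forall>q\<in>S. \<bar>v \<epsilon> (fst q) (snd q) - w q\<bar> \<le> e"
    if S: "compact S" "S \<subseteq> time_space" and "e > 0" for S e
  proof -
    have "\<forall>\<^sub>F \<epsilon> in at_right 0. \<forall>q\<in>S. 1 * v \<epsilon> (fst q) (snd q) \<le> 1 * w q + e"
      by (rule relaxed_limit_uniform[OF _ w S \<open>e > 0\<close>]) simp
    moreover have "\<forall>\<^sub>F \<epsilon> in at_right 0. \<forall>q\<in>S. - 1 * v \<epsilon> (fst q) (snd q) \<le> - 1 * w' q + e"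
      by (rule relaxed_limit_uniform[OF _ w' S \<open>e > 0\<close>]) simp
    ultimately show ?thesis
    proof eventually_elim
      case (elim \<epsilon>)
      show ?case
      proof
        fix q assume "q \<in> S"
        then have "w q = w' q" using S eq by blast
        then show "\<bar>v \<epsilon> (fst q) (snd q) - w q\<bar> \<le> e" using elim \<open>q \<in> S\<close> by fastforce
      qed
    qed
  qed
  ultimately show ?thesis by blast
qed

end

section \<open>Gradient bounds\<close>

text \<open>
  In a Riemann sum that is fine enough, the intervals tagged in a null set contribute little because
  \<open>f\<close> is Lipschitz, the others because \<open>f\<close> is differentiable at their tags.
\<close>

lemma lipschitz_AE_deriv_nonneg_imp_mono:
  fixes f :: "real \<Rightarrow> real"
  assumes f: "L-lipschitz_on UNIV f"
    and AE: "AE x in lborel. \<exists>D. (f has_real_derivative D) (at x) \<and> 0 \<le> D"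
    and "a \<le> b"
  shows "f a \<le> f b"
proof (rule field_le_epsilon)
  fix e0 :: real assume "e0 > 0"
  have "L \<ge> 0" using f by (rule lipschitz_on_nonneg)
  \<comment> \<open>The two kinds of intervals cost \<open>e * (b - a)\<close> and
    \<open>L * e\<close>; the denominator collects both, and the 1 keeps it positive.\<close>
  define e where "e = e0 / (b - a + L + 1)"
  have den: "b - a + L + 1 > 0" using \<open>a \<le> b\<close> \<open>L \<ge> 0\<close> by simp
  then have "e > 0" using \<open>e0 > 0\<close> by (simp add: e_def)
  obtain Z where Z: "{x \<in> space lborel. \<not> (\<exists>D. (f has_real_derivative D) (at x) \<and> 0 \<le> D)} \<subseteq> Z"
    "emeasure lborel Z = 0" "Z \<in> sets lborel"
    using AE by (rule AE_E)
  then have "Z \<in> null_sets lebesgue" by (intro null_sets_completionI) (auto simp: null_sets_def)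
  then have "negligible Z" by (simp add: negligible_iff_null_sets)
  \<comment> \<open>The null set enters through its indicator: in a sufficiently fine division the
    intervals tagged in \<open>Z\<close> have total length below \<open>e\<close>.\<close>
  then have "(indicat_real Z has_integral 0) (cbox a b)" by (simp add: negligible_def)
  from has_integralD[OF this \<open>e > 0\<close>] obtain \<gamma>1 where \<gamma>1: "gauge \<gamma>1" "\<And>\<D>. \<D> tagged_division_of cbox a b \<Longrightarrow> \<gamma>1 fine \<D> \<Longrightarrow>
      norm ((\<Sum>(x, k)\<in>\<D>. measure lborel k *\<^sub>R indicat_real Z x) - 0) < e"
    by blast
  \<comment> \<open>Differentiability at \<open>x\<close> controls the increment over any small
    interval containing \<open>x\<close>, because the errors on the two sides of \<open>x\<close>
    add up to \<open>e * (v - u)\<close>.\<close>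
  have "\<exists>d>0. \<forall>u v. u \<le> x \<longrightarrow> x \<le> v \<longrightarrow> x - u < d \<longrightarrow> v - x < d \<longrightarrow> f v - f u \<ge> - e * (v - u)" if xZ: "x \<notin> Z" for x
  proof -
    obtain D where D: "(f has_real_derivative D) (at x)" "0 \<le> D" using Z(1) xZ by auto
    from D(1) have "(f has_derivative (\<lambda>h. D * h)) (at x)" unfolding has_field_derivative_def .
    then obtain d where d: "d > 0" "\<And>y. norm (y - x) < d \<Longrightarrow> norm (f y - f x - D * (y - x)) \<le> e * norm (y - x)"
      using \<open>e > 0\<close> unfolding has_derivative_at_alt by blast
    have "f v - f u \<ge> - e * (v - u)" if "u \<le> x" "x \<le> v" "x - u < d" "v - x < d" for u v
    proof -
      have "\<bar>f v - f x - D * (v - x)\<bar> \<le> e * (v - x)" "\<bar>f u - f x - D * (u - x)\<bar> \<le> e * (x - u)"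
        using d(2)[of v] d(2)[of u] that unfolding real_norm_def by (simp_all only: abs_of_nonneg abs_of_nonpos abs_minus_commute[of u] diff_ge_0_iff_ge)
      moreover have "0 \<le> D * (v - x)" "0 \<le> D * (x - u)" using D(2) that by (simp_all add: mult_nonneg_nonneg)
      ultimately have "- (e * (v - x)) \<le> f v - f x" "- (e * (x - u)) \<le> f x - f u"
        unfolding abs_le_iff right_diff_distrib by linarith+
      then show ?thesis unfolding right_diff_distrib by linarith
    qed
    then show ?thesis using d(1) by blast
  qed
  then obtain d where d: "\<And>x. x \<notin> Z \<Longrightarrow> d x > 0"
    "\<And>x u v. x \<notin> Z \<Longrightarrow> u \<le> x \<Longrightarrow> x \<le> v \<Longrightarrow> x - u < d x \<Longrightarrow> v - x < d x \<Longrightarrow> f v - f u \<ge> - e * (v - u)"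
    by metis
  define \<gamma>2 where "\<gamma>2 x = (if x \<in> Z then UNIV else ball x (d x))" for x
  have "gauge \<gamma>2" using d(1) by (auto simp: gauge_def \<gamma>2_def)
  have "gauge (\<lambda>x. \<gamma>1 x \<inter> \<gamma>2 x)" by (rule gauge_Int[OF \<gamma>1(1) \<open>gauge \<gamma>2\<close>])
  then obtain \<D> where \<D>: "\<D> tagged_division_of {a..b}" "(\<lambda>x. \<gamma>1 x \<inter> \<gamma>2 x) fine \<D>"
    by (rule fine_division_exists_real)
  then have fine: "\<gamma>1 fine \<D>" "\<gamma>2 fine \<D>" by (auto simp: fine_Int)
  have "finite \<D>" using \<D>(1) by (rule tagged_division_of_finite)
  have "- (e * measure lborel k + L * (measure lborel k *\<^sub>R indicat_real Z x)) \<le> f (Sup k) - f (Inf k)"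
    if xk: "(x, k) \<in> \<D>" for x k
  proof -
    obtain u v where k: "k = cbox u v" "x \<in> k" using tagged_division_ofD(2,4)[OF \<D>(1) xk] by blast
    then have uv: "u \<le> x" "x \<le> v" "u \<le> v" by auto
    then have sup: "Sup k = v" "Inf k = u" "measure lborel k = v - u" using k(1) by auto
    show ?thesis
    proof (cases "x \<in> Z")
      case True
      have "\<bar>f v - f u\<bar> \<le> L * (v - u)"
        using lipschitz_onD[OF f, of v u] uv by (simp add: dist_real_def)
      moreover have "0 \<le> e * (v - u)" using \<open>e > 0\<close> uv by simp
      ultimately show ?thesis using True by (simp add: sup abs_le_iff)
    next
      case False
      have "k \<subseteq> ball x (d x)" using fineD[OF fine(2) xk] False by (simp add: \<gamma>2_def)
      moreover have "u \<in> k" "v \<in> k" using k(1) uv by simp_all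
      ultimately have "u \<in> ball x (d x)" "v \<in> ball x (d x)" by blast+
      then have "x - u < d x" "v - x < d x" using uv by (auto simp: dist_real_def)
      from d(2)[OF False uv(1,2) this] show ?thesis using False by (simp add: sup)
    qed
  qed
  then have "(\<Sum>(x, k)\<in>\<D>. - (e * measure lborel k + L * (measure lborel k *\<^sub>R indicat_real Z x))) \<le> (\<Sum>(x, k)\<in>\<D>. f (Sup k) - f (Inf k))"
    by (intro sum_mono) auto
  also have "\<dots> = f b - f a" by (rule additive_tagged_division_1[OF \<open>a \<le> b\<close> \<D>(1)])
  finally have "- (e * (\<Sum>(x, k)\<in>\<D>. measure lborel k) + L * (\<Sum>(x, k)\<in>\<D>. measure lborel k *\<^sub>R indicat_real Z x)) \<le> f b - f a"
    by (simp add: case_prod_unfold sum_negf sum.distrib sum_distrib_left sum_subtractf)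
  moreover have "(\<Sum>(x, k)\<in>\<D>. measure lborel k) = b - a"
    using additive_content_tagged_division[of \<D> a b] \<D>(1) \<open>a \<le> b\<close> by simp
  moreover have "L * (\<Sum>(x, k)\<in>\<D>. measure lborel k *\<^sub>R indicat_real Z x) \<le> L * e"
    using \<gamma>1(2)[of \<D>] \<D>(1) fine(1) \<open>L \<ge> 0\<close> by (intro mult_left_mono) auto
  ultimately have "f a - f b \<le> e * (b - a) + L * e" by simp
  also have "\<dots> \<le> e * (b - a + L + 1)" using \<open>e > 0\<close> by (simp add: algebra_simps)
  also have "\<dots> = e0" using den by (simp add: e_def)
  finally show "f a \<le> f b + e0" by simp
qed

lemma gradient_boundsE:
  assumes "gradient_bounds K f" "K > 0"
  obtains L where "L \<ge> 0" "\<And>x y. \<bar>f x - f y\<bar> \<le> L * \<bar>x - y\<bar>" "mono f" "continuous_on UNIV f"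
proof -
  obtain L where L: "L-lipschitz_on UNIV f"
    and AE: "AE x in lborel. \<exists>D. (f has_real_derivative D) (at x) \<and> 1 / K \<le> D \<and> D \<le> K"
    using assms(1) unfolding gradient_bounds_def by blast
  have "AE x in lborel. \<exists>D. (f has_real_derivative D) (at x) \<and> 0 \<le> D"
    using AE
  proof eventually_elim
    case (elim x)
    then obtain D where "(f has_real_derivative D) (at x)" "1 / K \<le> D" by blast
    moreover have "0 \<le> 1 / K" using \<open>K > 0\<close> by simp
    ultimately show ?case by (meson order_trans)
  qed
  then have "mono f" by (intro monoI lipschitz_AE_deriv_nonneg_imp_mono[OF L])
  moreover have "\<bar>f x - f y\<bar> \<le> L * \<bar>x - y\<bar>" for x y
    using lipschitz_onD[OF L, of x y] by (simp add: dist_real_def)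
  ultimately show thesis
    using that lipschitz_on_nonneg[OF L] lipschitz_on_continuous_on[OF L] by blast
qed

section \<open>Homogenization\<close>

text \<open>
  At the scale \<open>t / \<epsilon>\<close>, \<open>u / \<epsilon>\<close>, the system at each fixed \<open>x\<close> is one and the same particle system; \<open>x\<close>
  and \<open>\<epsilon>\<close> only enter through its initial configuration.
\<close>

definition particle_data ::
    "nat \<Rightarrow> real \<Rightarrow> (real \<Rightarrow> real) \<Rightarrow> (real \<Rightarrow> real) \<Rightarrow> real \<Rightarrow> site \<Rightarrow> real" where
  "particle_data n \<epsilon> f\<^sub>1 f\<^sub>2 x = (\<lambda>(c, j). (if c then f\<^sub>1 else f\<^sub>2) (x + of_int j * \<epsilon> / of_nat n) / \<epsilon>)"

lemma particle_data_increasing: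
  assumes "\<epsilon> > 0" "mono f\<^sub>1" "mono f\<^sub>2"
  shows "increasing (particle_data n \<epsilon> f\<^sub>1 f\<^sub>2 x)"
  unfolding increasing_def particle_data_def prod.case
proof (intro allI divide_right_mono)
  fix c j
  have "of_int j * \<epsilon> / of_nat n \<le> of_int (j + 1) * \<epsilon> / of_nat n"
    using \<open>\<epsilon> > 0\<close> by (intro divide_right_mono mult_right_mono) auto
  then show "(if c then f\<^sub>1 else f\<^sub>2) (x + of_int j * \<epsilon> / of_nat n) \<le> (if c then f\<^sub>1 else f\<^sub>2) (x + of_int (j + 1) * \<epsilon> / of_nat n)"
    using assms(2,3) by (auto intro: monoD)
qed (use \<open>\<epsilon> > 0\<close> in simp)

lemma particle_data_near:
  assumes "\<epsilon> > 0" and near: "\<And>x. \<bar>f\<^sub>1 x - f\<^sub>2 x\<bar> \<le> M * \<epsilon>"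
  shows "\<bar>particle_data n \<epsilon> f\<^sub>1 f\<^sub>2 x (c, j) - f\<^sub>1 (x + of_int j * \<epsilon> / of_nat n) / \<epsilon>\<bar> \<le> M"
proof (cases c)
  case True
  have "0 \<le> M * \<epsilon>" using near[of 0] by linarith
  then show ?thesis using True \<open>\<epsilon> > 0\<close> by (simp add: particle_data_def zero_le_mult_iff)
next
  case False
  define y where "y = x + of_int j * \<epsilon> / of_nat n"
  have "\<bar>f\<^sub>2 y / \<epsilon> - f\<^sub>1 y / \<epsilon>\<bar> = \<bar>f\<^sub>1 y - f\<^sub>2 y\<bar> / \<epsilon>"
    using \<open>\<epsilon> > 0\<close> by (simp add: abs_minus_commute flip: diff_divide_distrib)
  also have "\<dots> \<le> M" using near[of y] \<open>\<epsilon> > 0\<close> by (simp add: pos_divide_le_eq)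
  finally show ?thesis using False by (simp add: particle_data_def y_def)
qed

text \<open>Replacing \<open>f\<^sub>2\<close> by \<open>f\<^sub>1\<close> costs \<open>M\<close> at
  each of the two sites, the distance \<open>M * \<epsilon>\<close> being divided by
  \<open>\<epsilon>\<close>; this makes the spread independent of \<open>\<epsilon>\<close>.\<close>

lemma particle_data_spread:
  assumes "\<epsilon> > 0" "n \<ge> 1" "L \<ge> 0" and f: "\<And>x y. \<bar>f\<^sub>1 x - f\<^sub>1 y\<bar> \<le> L * \<bar>x - y\<bar>"
    and near: "\<And>x. \<bar>f\<^sub>1 x - f\<^sub>2 x\<bar> \<le> M * \<epsilon>"
  shows "spread (L + 2 * M) (particle_data n \<epsilon> f\<^sub>1 f\<^sub>2 x)"
  unfolding spread_def
proof (intro allI)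
  fix c j c' k
  have "0 \<le> M * \<epsilon>" using near[of 0] by linarith
  then have "M \<ge> 0" using \<open>\<epsilon> > 0\<close> by (simp add: zero_le_mult_iff)
  define y where "y j = x + of_int j * \<epsilon> / of_nat n" for j
  have "y j - y k = of_int (j - k) * \<epsilon> / of_nat n" by (simp add: y_def left_diff_distrib diff_divide_distrib)
  then have "\<bar>y j - y k\<bar> = \<bar>of_int (j - k)\<bar> * \<epsilon> / of_nat n" using \<open>\<epsilon> > 0\<close> by (simp add: abs_mult)
  also have "\<dots> \<le> \<bar>of_int (j - k)\<bar> * \<epsilon> / 1" using assms(1,2) by (intro divide_left_mono) auto
  finally have "L * \<bar>y j - y k\<bar> \<le> L * (\<bar>of_int (j - k)\<bar> * \<epsilon>)" using \<open>L \<ge> 0\<close> by (intro mult_left_mono) auto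
  then have "\<bar>f\<^sub>1 (y j) - f\<^sub>1 (y k)\<bar> \<le> L * \<bar>of_int (j - k)\<bar> * \<epsilon>" using f[of "y j" "y k"] by simp
  then have "\<bar>f\<^sub>1 (y j) / \<epsilon> - f\<^sub>1 (y k) / \<epsilon>\<bar> \<le> L * \<bar>of_int (j - k)\<bar>"
    using \<open>\<epsilon> > 0\<close> by (simp add: pos_divide_le_eq flip: diff_divide_distrib)
  then have "\<bar>particle_data n \<epsilon> f\<^sub>1 f\<^sub>2 x (c, j) - particle_data n \<epsilon> f\<^sub>1 f\<^sub>2 x (c', k)\<bar> \<le> L * \<bar>of_int (j - k)\<bar> + 2 * M"
    using particle_data_near[of \<epsilon> f\<^sub>1 f\<^sub>2 M n x c j, OF assms(1) near]
      particle_data_near[of \<epsilon> f\<^sub>1 f\<^sub>2 M n x c' k, OF assms(1) near]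
    unfolding y_def by linarith
  also have "\<dots> \<le> (L + 2 * M) * (1 + \<bar>of_int (j - k)\<bar>)"
    using \<open>L \<ge> 0\<close> \<open>M \<ge> 0\<close> by (simp add: algebra_simps)
  finally show "\<bar>particle_data n \<epsilon> f\<^sub>1 f\<^sub>2 x (c, j) - particle_data n \<epsilon> f\<^sub>1 f\<^sub>2 x (c', k)\<bar> \<le> (L + 2 * M) * (1 + \<bar>of_int (j - k)\<bar>)" .
qed

lemma particle_data_shift:
  assumes "n \<ge> 1"
  shows "particle_data n \<epsilon> f\<^sub>1 f\<^sub>2 x (c, j + q * int n) = particle_data n \<epsilon> f\<^sub>1 f\<^sub>2 (x + of_int q * \<epsilon>) (c, j)"
proof -
  have "x + of_int (j + q * int n) * \<epsilon> / of_nat n = x + of_int q * \<epsilon> + of_int j * \<epsilon> / of_nat n"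
    using assms by (simp add: distrib_right add_divide_distrib)
  then show ?thesis by (simp only: particle_data_def prod.case)
qed

lemma particle_data_translate:
  assumes "\<epsilon> > 0" "mono f\<^sub>1" "mono f\<^sub>2" "x \<le> y"
  shows "particle_data n \<epsilon> f\<^sub>1 f\<^sub>2 x i \<le> particle_data n \<epsilon> f\<^sub>1 f\<^sub>2 y i"
  using assms by (cases i) (auto simp: particle_data_def intro!: divide_right_mono monoD[where f = f\<^sub>1] monoD[where f = f\<^sub>2])

lemma particle_data_translate_le:
  assumes "\<epsilon> > 0" "x \<le> y" and f: "\<And>x y. \<bar>f\<^sub>1 x - f\<^sub>1 y\<bar> \<le> L * \<bar>x - y\<bar>"
    and near: "\<And>x. \<bar>f\<^sub>1 x - f\<^sub>2 x\<bar> \<le> M * \<epsilon>"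
  shows "particle_data n \<epsilon> f\<^sub>1 f\<^sub>2 y i \<le> particle_data n \<epsilon> f\<^sub>1 f\<^sub>2 x i + (L * (y - x) / \<epsilon> + 2 * M)"
proof (cases i)
  case (Pair c j)
  define s where "s = of_int j * \<epsilon> / of_nat n"
  have "f\<^sub>1 (y + s) \<le> f\<^sub>1 (x + s) + L * (y - x)" using f[of "y + s" "x + s"] \<open>x \<le> y\<close> by simp
  then have "f\<^sub>1 (y + s) / \<epsilon> \<le> (f\<^sub>1 (x + s) + L * (y - x)) / \<epsilon>" using \<open>\<epsilon> > 0\<close> by (intro divide_right_mono) auto
  then show ?thesis
    using particle_data_near[of \<epsilon> f\<^sub>1 f\<^sub>2 M n x c j, OF assms(1) near]
      particle_data_near[of \<epsilon> f\<^sub>1 f\<^sub>2 M n y c j, OF assms(1) near]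
    unfolding Pair s_def add_divide_distrib by linarith
qed

theorem theorem1p5:
  fixes n m :: nat and \<alpha>\<^sub>0 K\<^sub>0 M\<^sub>0 :: real
    and F :: "int \<Rightarrow> real \<Rightarrow> (int \<Rightarrow> real) \<Rightarrow> real"
    and u\<^sub>0 :: "real \<Rightarrow> real"
    and \<xi>\<^sub>0 :: "real \<Rightarrow> real \<Rightarrow> real"
    and u \<xi> :: "real \<Rightarrow> int \<Rightarrow> real \<times> real \<Rightarrow> real"
  assumes "n \<ge> 1" and "\<alpha>\<^sub>0 > 0"
    and "admissible n m \<alpha>\<^sub>0 F"
    and "K\<^sub>0 > 0" and "M\<^sub>0 > 0"
    and "gradient_bounds K\<^sub>0 u\<^sub>0"
    and "\<And>\<epsilon>. \<epsilon> > 0 \<Longrightarrow> gradient_bounds K\<^sub>0 (\<xi>\<^sub>0 \<epsilon>)"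
    and "\<And>\<epsilon> x. \<epsilon> > 0 \<Longrightarrow> \<bar>u\<^sub>0 x - \<xi>\<^sub>0 \<epsilon> x\<bar> \<le> M\<^sub>0 * \<epsilon>"
    and "\<And>\<epsilon>. \<epsilon> > 0 \<Longrightarrow>
           is_system_solution n m \<alpha>\<^sub>0 F \<epsilon>
             (\<lambda>j x. u\<^sub>0 (x + of_int j * \<epsilon> / of_nat n))
             (\<lambda>j x. \<xi>\<^sub>0 \<epsilon> (x + of_int j * \<epsilon> / of_nat n))
             (u \<epsilon>) (\<xi> \<epsilon>)"
  shows "\<exists>Fbar :: real \<Rightarrow> real. continuous_on UNIV Fbar \<and>
           (\<exists>u0lim :: real \<times> real \<Rightarrow> real. is_unique_HJ_solution Fbar u\<^sub>0 u0lim \<and>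
              (\<forall>j K. compact K \<and> K \<subseteq> pos_time_space \<longrightarrow>
                 uniform_limit K (\<lambda>\<epsilon>. u \<epsilon> j) u0lim (at_right 0) \<and>
                 uniform_limit K (\<lambda>\<epsilon>. \<xi> \<epsilon> j) u0lim (at_right 0)))"
proof -
  obtain Lg where lattice: "ordered_lattice (particle_field m \<alpha>\<^sub>0 F) m Lg n \<alpha>\<^sub>0"
    using particle_field_lattice[OF assms(1-3)] by blast
  interpret ordered_lattice "particle_field m \<alpha>\<^sub>0 F" m Lg n \<alpha>\<^sub>0 by (rule lattice)
  obtain L\<^sub>0 where "L\<^sub>0 \<ge> 0" and u0_lip: "\<And>x y. \<bar>u\<^sub>0 x - u\<^sub>0 y\<bar> \<le> L\<^sub>0 * \<bar>x - y\<bar>"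
    and u0_mono: "mono u\<^sub>0" and u0_cont: "continuous_on UNIV u\<^sub>0"
    by (rule gradient_boundsE[OF assms(6,4)]) (rule that)
  have \<xi>0: "mono (\<xi>\<^sub>0 \<epsilon>)" "continuous_on UNIV (\<xi>\<^sub>0 \<epsilon>)" if "\<epsilon> > 0" for \<epsilon>
    by (rule gradient_boundsE[OF assms(7)[OF that] assms(4)], assumption)+
  define a where "a \<epsilon> x = particle_data n \<epsilon> u\<^sub>0 (\<xi>\<^sub>0 \<epsilon>) x" for \<epsilon> x
  note near = assms(8)
  have a_inc: "increasing (a \<epsilon> x)" if "\<epsilon> > 0" for \<epsilon> x
    unfolding a_def by (rule particle_data_increasing[OF that u0_mono \<xi>0(1)[OF that]])
  have a_spread: "spread (L\<^sub>0 + 2 * M\<^sub>0) (a \<epsilon> x)" if "\<epsilon> > 0" for \<epsilon> x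
    unfolding a_def by (rule particle_data_spread[OF that assms(1) \<open>L\<^sub>0 \<ge> 0\<close> u0_lip near[OF that]])
  have "\<exists>z. \<epsilon> > 0 \<longrightarrow> solution z \<and> (\<forall>i. z i 0 = a \<epsilon> x i)" for \<epsilon> x
    using spread_solution_exists[OF a_spread, of \<epsilon> x] by metis
  then obtain z where "\<And>\<epsilon> x. \<epsilon> > 0 \<longrightarrow> solution (z \<epsilon> x) \<and> (\<forall>i. z \<epsilon> x i 0 = a \<epsilon> x i)" by metis
  then have z: "solution (z \<epsilon> x)" and z0: "z \<epsilon> x i 0 = a \<epsilon> x i" if "\<epsilon> > 0" for \<epsilon> x i using that by auto
  have "L\<^sub>0 + 2 * M\<^sub>0 \<ge> 0" using \<open>L\<^sub>0 \<ge> 0\<close> assms(5) by simp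
  then obtain K where "K \<ge> 0" and K: "\<And>z t. solution z \<Longrightarrow> increasing (\<lambda>i. z i 0) \<Longrightarrow>
      spread (L\<^sub>0 + 2 * M\<^sub>0) (\<lambda>i. z i 0) \<Longrightarrow> t \<ge> 0 \<Longrightarrow> spread K (\<lambda>i. z i t)"
    by (rule solution_spread) blast
  have z_spread: "spread K (\<lambda>i. z \<epsilon> x i t)" if "\<epsilon> > 0" "t \<ge> 0" for \<epsilon> x t
    by (rule K[OF z[OF that(1)] _ _ that(2)]) (simp_all add: z0[OF that(1)] a_inc[OF that(1)] a_spread[OF that(1)])
  have z_inc: "increasing (\<lambda>i. z \<epsilon> x i t)" if "\<epsilon> > 0" "t \<ge> 0" for \<epsilon> x t
    by (rule solution_increasing[OF z[OF that(1)] _ that(2)]) (simp add: z0[OF that(1)] a_inc[OF that(1)])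
  obtain B where "B \<ge> 0" and B: "\<And>z i s t. solution z \<Longrightarrow> (\<And>t. t \<ge> 0 \<Longrightarrow> spread K (\<lambda>i. z i t)) \<Longrightarrow>
      s \<ge> 0 \<Longrightarrow> t \<ge> 0 \<Longrightarrow> \<bar>z i t - z i s\<bar> \<le> B * \<bar>t - s\<bar>"
    by (rule solution_time_lipschitz[of K]) blast
  have sys: "u \<epsilon> j (t, x) = \<epsilon> * z \<epsilon> x (True, j) (t / \<epsilon>)" "\<xi> \<epsilon> j (t, x) = \<epsilon> * z \<epsilon> x (False, j) (t / \<epsilon>)"
    if "\<epsilon> > 0" "t \<ge> 0" for \<epsilon> j t x
  proof -
    have cont: "continuous_on UNIV (\<lambda>x. f (x + of_int j * \<epsilon> / of_nat n))" if "continuous_on UNIV f" for f :: "real \<Rightarrow> real" and j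
      by (rule continuous_on_compose2[OF that]) (auto intro!: continuous_intros)
    have shift: "f (x + of_int (j + int n) * \<epsilon> / of_nat n) = f ((x + \<epsilon>) + of_int j * \<epsilon> / of_nat n)" for f :: "real \<Rightarrow> real" and j x
      using assms(1) by (simp add: distrib_right add_divide_distrib add_ac)
    have "t / \<epsilon> \<ge> 0" "\<epsilon> * (t / \<epsilon>) = t" using that by auto
    with system_solution_eq_particles[OF lattice that(1) assms(9)[OF that(1)] cont[OF u0_cont]
      cont[OF \<xi>0(2)[OF that(1)]] shift shift z[OF that(1)], of x x "t / \<epsilon>" j]
    show "u \<epsilon> j (t, x) = \<epsilon> * z \<epsilon> x (True, j) (t / \<epsilon>)" "\<xi> \<epsilon> j (t, x) = \<epsilon> * z \<epsilon> x (False, j) (t / \<epsilon>)"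
      using that(1) by (simp_all add: z0 a_def particle_data_def)
  qed
  \<comment> \<open>Shifting by \<open>q\<close> blocks and moving the base point by
    \<open>q * \<epsilon>\<close> produce solutions with equal data, which coincide by monotonicity
    in both directions. A negative \<open>q\<close> is reduced to the opposite shift from the other
    base point.\<close>
  have z_shift: "z \<epsilon> x (c, j + q * int n) t = z \<epsilon> (x + of_int q * \<epsilon>) (c, j) t"
    if "\<epsilon> > 0" "t \<ge> 0" for \<epsilon> x c j q t
  proof -
    have nat: "z \<epsilon> x (c, j + int k * int n) t = z \<epsilon> (x + of_int (int k) * \<epsilon>) (c, j) t" for x j k
    proof -
      have eq: "(case i of (c, j) \<Rightarrow> z \<epsilon> x (c, j + int k * int n)) 0 = z \<epsilon> (x + of_int (int k) * \<epsilon>) i 0" for i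
        using particle_data_shift[OF assms(1), of \<epsilon> u\<^sub>0 "\<xi>\<^sub>0 \<epsilon>" x "fst i" "snd i" "int k"] that(1)
        by (cases i) (simp add: z0 a_def)
      have "(case (c, j) of (c, j) \<Rightarrow> z \<epsilon> x (c, j + int k * int n)) t \<le> z \<epsilon> (x + of_int (int k) * \<epsilon>) (c, j) t"
        by (rule solution_mono[OF solution_shift_type[OF z] z _ that(2)]) (use that(1) eq in auto)
      moreover have "z \<epsilon> (x + of_int (int k) * \<epsilon>) (c, j) t \<le> (case (c, j) of (c, j) \<Rightarrow> z \<epsilon> x (c, j + int k * int n)) t"
        by (rule solution_mono[OF z solution_shift_type[OF z] _ that(2)]) (use that(1) eq in auto)
      ultimately show ?thesis by simp
    qed
    show ?thesis
    proof (cases "q \<ge> 0")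
      case True
      then show ?thesis using nat[of x j "nat q"] by simp
    next
      case False
      then show ?thesis using nat[of "x + of_int q * \<epsilon>" "j + q * int n" "nat (- q)"] by simp
    qed
  qed
  define v where "v \<epsilon> t x = \<epsilon> * z \<epsilon> x (True, 0) (t / \<epsilon>)" for \<epsilon> t x
  \<comment> \<open>Extension to negative slopes by the value at 0, which keeps the Lipschitz
    constant of \<open>speed\<close>.\<close>
  define Fbar where "Fbar p = speed (max 0 p)" for p
  define C where "C = B + 2 * M\<^sub>0 + 1"
  have "C \<ge> 0" "B \<le> C" "2 * M\<^sub>0 + 1 \<le> C" using \<open>B \<ge> 0\<close> assms(5) by (simp_all add: C_def)
  \<comment> \<open>Neighbouring indices are \<open>\<epsilon> / n\<close> apart in \<open>x\<close>
    and \<open>s\<close> is at most \<open>h / \<epsilon> + 1\<close>, so the window of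
    \<open>local_speed_bounds\<close> has radius \<open>2 * rate / n * (h + \<epsilon>)\<close> in
    \<open>x\<close>. The added 1 covers the rounding of indices to multiples of
    \<open>n\<close>.\<close>
  define R where "R = 2 * rate / real n + 1"
  have "R \<ge> 1" using rate_pos by (simp add: R_def)
  define L where "L = 2 * rate / real n"
  have "L \<ge> 0" using rate_pos by (simp add: L_def)
  have v_time: "\<bar>v \<epsilon> t x - v \<epsilon> s x\<bar> \<le> B * \<bar>t - s\<bar>" if "\<epsilon> > 0" "s \<ge> 0" "t \<ge> 0" for \<epsilon> s t x
  proof -
    have "\<bar>z \<epsilon> x (True, 0) (t / \<epsilon>) - z \<epsilon> x (True, 0) (s / \<epsilon>)\<bar> \<le> B * \<bar>t / \<epsilon> - s / \<epsilon>\<bar>"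
      by (rule B[OF z z_spread]) (use that in auto)
    then have "\<epsilon> * \<bar>z \<epsilon> x (True, 0) (t / \<epsilon>) - z \<epsilon> x (True, 0) (s / \<epsilon>)\<bar> \<le> \<epsilon> * (B * \<bar>t / \<epsilon> - s / \<epsilon>\<bar>)"
      using that(1) by (intro mult_left_mono) auto
    moreover have "\<epsilon> * (B * \<bar>t / \<epsilon> - s / \<epsilon>\<bar>) = B * \<bar>t - s\<bar>"
      using that(1) by (simp add: abs_divide flip: diff_divide_distrib)
    ultimately show ?thesis using that(1) by (simp add: v_def abs_mult flip: right_diff_distrib)
  qed
  \<comment> \<open>By \<open>z_shift\<close> the particle \<open>q n\<close> seen from \<open>x\<close> is the particle \<open>0\<close> seen from \<open>x + q \<epsilon>\<close>; the time is
    rounded down to an integer because the forcing has period \<open>1\<close>.\<close>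
  have periods: "z \<epsilon> x (True, q * int n) (real (nat \<lfloor>t / \<epsilon>\<rfloor>)) \<le> v \<epsilon> t (x + of_int q * \<epsilon>) / \<epsilon> + B \<and>
      v \<epsilon> t (x + of_int q * \<epsilon>) / \<epsilon> - B \<le> z \<epsilon> x (True, q * int n) (real (nat \<lfloor>t / \<epsilon>\<rfloor>))"
    if "\<epsilon> > 0" "t \<ge> 0" for \<epsilon> t x q
  proof -
    define N where "N = real (nat \<lfloor>t / \<epsilon>\<rfloor>)"
    have "t / \<epsilon> \<ge> 0" using that by simp
    then have N: "N \<le> t / \<epsilon>" "t / \<epsilon> \<le> N + 1" "N \<ge> 0" by (simp_all add: N_def)
    have "z \<epsilon> x (True, q * int n) N = z \<epsilon> (x + of_int q * \<epsilon>) (True, 0) N"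
      using z_shift[OF that(1) N(3), of x True 0 q] by simp
    moreover have "\<bar>z \<epsilon> (x + of_int q * \<epsilon>) (True, 0) (t / \<epsilon>) - z \<epsilon> (x + of_int q * \<epsilon>) (True, 0) N\<bar> \<le> B * \<bar>t / \<epsilon> - N\<bar>"
      by (rule B[OF z z_spread]) (use that N in auto)
    moreover have "B * \<bar>t / \<epsilon> - N\<bar> \<le> B * 1" using N \<open>B \<ge> 0\<close> by (intro mult_left_mono) auto
    moreover have "v \<epsilon> t (x + of_int q * \<epsilon>) / \<epsilon> = z \<epsilon> (x + of_int q * \<epsilon>) (True, 0) (t / \<epsilon>)"
      using that(1) by (simp add: v_def)
    ultimately show ?thesis unfolding N_def by linarith
  qed
  have block: "j div int n * int n \<le> j" "j \<le> (j div int n + 1) * int n" for j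
  proof -
    have "int n > 0" using assms(1) by simp
    from pos_mod_bound[OF this, of j] pos_mod_sign[OF this, of j] div_mult_mod_eq[of j "int n"]
    show "j div int n * int n \<le> j" "j \<le> (j div int n + 1) * int n"
      unfolding distrib_right by linarith+
  qed
  have cell: "of_int (j div int n) * \<epsilon> \<le> of_int j * \<epsilon> / real n \<and> of_int j * \<epsilon> / real n \<le> of_int (j div int n + 1) * \<epsilon>"
    if "\<epsilon> > 0" for j \<epsilon>
  proof -
    have n0: "0 < real n" "0 < int n" using assms(1) by auto
    have "of_int (j div int n * int n) \<le> (of_int j :: real)" "(of_int j :: real) \<le> of_int ((j div int n + 1) * int n)"
      using block[of j] by (simp_all only: of_int_le_iff)
    then have "of_int (j div int n) * real n * \<epsilon> \<le> of_int j * \<epsilon>" "of_int j * \<epsilon> \<le> of_int (j div int n + 1) * real n * \<epsilon>"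
      using that by (auto intro!: mult_right_mono)
    then show ?thesis using n0 by (simp add: field_simps)
  qed
  have reach: "\<bar>of_int q * \<epsilon>\<bar> \<le> R * (h + \<epsilon>)"
    if "\<epsilon> > 0" "h > 0" "\<bar>real_of_int j\<bar> \<le> 2 * rate * s" "s \<le> h / \<epsilon> + 1" "\<bar>of_int q * \<epsilon> - of_int j * \<epsilon> / real n\<bar> \<le> \<epsilon>"
    for \<epsilon> h s j q
  proof -
    have "\<bar>of_int j * \<epsilon> / real n\<bar> = \<bar>real_of_int j\<bar> * \<epsilon> / real n" using that(1) by (simp add: abs_mult)
    also have "\<dots> \<le> (2 * rate * (h / \<epsilon> + 1)) * \<epsilon> / real n"
    proof -
      have "2 * rate * s \<le> 2 * rate * (h / \<epsilon> + 1)" using that(4) rate_pos by (intro mult_left_mono) auto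
      with that(3) have "\<bar>real_of_int j\<bar> \<le> 2 * rate * (h / \<epsilon> + 1)" by linarith
      then show ?thesis using that(1) by (intro divide_right_mono mult_right_mono) auto
    qed
    also have "\<dots> = 2 * rate / real n * ((h / \<epsilon> + 1) * \<epsilon>)" by simp
    also have "(h / \<epsilon> + 1) * \<epsilon> = h + \<epsilon>" using that(1) by (simp add: distrib_right)
    finally have b: "\<bar>of_int j * \<epsilon> / real n\<bar> \<le> 2 * rate / real n * (h + \<epsilon>)" .
    have "\<bar>of_int q * \<epsilon>\<bar> \<le> \<bar>of_int j * \<epsilon> / real n\<bar> + \<bar>of_int q * \<epsilon> - of_int j * \<epsilon> / real n\<bar>"
      using abs_triangle_ineq[of "of_int j * \<epsilon> / real n" "of_int q * \<epsilon> - of_int j * \<epsilon> / real n"] by simp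
    also have "\<dots> \<le> 2 * rate / real n * (h + \<epsilon>) + \<epsilon>" by (rule add_mono[OF b that(5)])
    also have "\<dots> \<le> R * (h + \<epsilon>)" using that by (simp add: R_def distrib_right)
    finally show ?thesis .
  qed
  interpret scaling_limit v u\<^sub>0 Fbar C L\<^sub>0 R L
  proof
    show "C \<ge> 0" "L\<^sub>0 \<ge> 0" "R \<ge> 0" "L \<ge> 0" using \<open>C \<ge> 0\<close> \<open>L\<^sub>0 \<ge> 0\<close> \<open>R \<ge> 1\<close> \<open>L \<ge> 0\<close> by auto
    show "\<bar>v \<epsilon> t x - v \<epsilon> s x\<bar> \<le> C * \<bar>t - s\<bar>" if "\<epsilon> > 0" "s \<ge> 0" "t \<ge> 0" for \<epsilon> s t x
      using v_time[OF that, of x] mult_right_mono[OF \<open>B \<le> C\<close>, of "\<bar>t - s\<bar>"] by simp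
    show "v \<epsilon> 0 x = u\<^sub>0 x" if "\<epsilon> > 0" for \<epsilon> x
      using that by (simp add: v_def z0 a_def particle_data_def)
    show "v \<epsilon> t x \<le> v \<epsilon> t y" if "\<epsilon> > 0" "t \<ge> 0" "x \<le> y" for \<epsilon> t x y
    proof -
      have "z \<epsilon> x (True, 0) (t / \<epsilon>) \<le> z \<epsilon> y (True, 0) (t / \<epsilon>)"
        by (rule solution_mono[OF z z])
          (use that particle_data_translate[OF that(1) u0_mono \<xi>0(1)[OF that(1)] that(3)] in \<open>auto simp: z0 a_def\<close>)
      then show ?thesis using that(1) by (simp add: v_def)
    qed
    show "v \<epsilon> t y \<le> v \<epsilon> t x + L\<^sub>0 * (y - x) + C * \<epsilon>" if "\<epsilon> > 0" "t \<ge> 0" "x \<le> y" for \<epsilon> t x y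
    proof -
      have "z \<epsilon> y (True, 0) (t / \<epsilon>) \<le> z \<epsilon> x (True, 0) (t / \<epsilon>) + (L\<^sub>0 * (y - x) / \<epsilon> + 2 * M\<^sub>0) + 1"
        by (rule solution_le_add[OF z z])
          (use that particle_data_translate_le[OF that(1,3) u0_lip near[OF that(1)]] in \<open>auto simp: z0 a_def\<close>)
      then have "v \<epsilon> t y \<le> \<epsilon> * (z \<epsilon> x (True, 0) (t / \<epsilon>) + (L\<^sub>0 * (y - x) / \<epsilon> + 2 * M\<^sub>0) + 1)"
        unfolding v_def using that(1) by (intro mult_left_mono) auto
      also have "\<dots> = v \<epsilon> t x + L\<^sub>0 * (y - x) + (2 * M\<^sub>0 + 1) * \<epsilon>"
        using that(1) by (simp add: v_def distrib_left distrib_right ac_simps)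
      also have "\<dots> \<le> v \<epsilon> t x + L\<^sub>0 * (y - x) + C * \<epsilon>"
        using \<open>2 * M\<^sub>0 + 1 \<le> C\<close> that(1) by (intro add_left_mono mult_right_mono) auto
      finally show ?thesis .
    qed
    show "\<bar>Fbar p - Fbar q\<bar> \<le> L * \<bar>p - q\<bar>" for p q
    proof -
      have "\<bar>Fbar p - Fbar q\<bar> \<le> L * \<bar>max 0 p - max 0 q\<bar>"
        unfolding Fbar_def L_def by (rule speed_lipschitz) auto
      also have "\<dots> \<le> L * \<bar>p - q\<bar>" using \<open>L \<ge> 0\<close> by (intro mult_left_mono) (auto simp: max_def)
      finally show ?thesis .
    qed
  next
    fix p :: real assume "p \<ge> 0"
    then have Fp: "Fbar p = speed p" by (simp add: Fbar_def)
    obtain C\<^sub>0 where up: "\<And>z N s c. solution z \<Longrightarrow> (\<And>t. t \<ge> 0 \<Longrightarrow> spread K (\<lambda>i. z i t)) \<Longrightarrow> s \<ge> 0 \<Longrightarrow>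
      (\<And>j. \<bar>real_of_int j\<bar> \<le> 2 * rate * s \<Longrightarrow> z (True, j) (real N) \<le> c + p * real_of_int j / real n) \<Longrightarrow>
      z (True, 0) (real N + s) \<le> c + speed p * s + C\<^sub>0"
      by (rule local_speed_bounds[OF \<open>p \<ge> 0\<close> \<open>K \<ge> 0\<close>]) blast
    \<comment> \<open>In the error, \<open>p\<close> pays for moving an index to the next multiple
      of \<open>n\<close>, \<open>B\<close> for rounding the time to an integer,
      \<open>\<bar>speed p\<bar>\<close> for the excess of \<open>s\<close> over
      \<open>h / \<epsilon>\<close>, and \<open>C\<^sub>0\<close> comes from
      \<open>local_speed_bounds\<close>.\<close>
    have "v \<epsilon> (t + h) x \<le> c + h * Fbar p + (p + B + \<bar>speed p\<bar> + C\<^sub>0) * \<epsilon>"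
      if \<epsilon>: "\<epsilon> > 0" and t: "t \<ge> 0" and h: "h > 0"
        and le: "\<forall>y. \<bar>y - x\<bar> \<le> R * (h + \<epsilon>) \<longrightarrow> v \<epsilon> t y \<le> c + p * (y - x)" for \<epsilon> t h x c
    proof -
      define N where "N = nat \<lfloor>t / \<epsilon>\<rfloor>"
      define s where "s = (t + h) / \<epsilon> - real N"
      have "t / \<epsilon> \<ge> 0" using t \<epsilon> by simp
      then have N: "real N \<le> t / \<epsilon>" "t / \<epsilon> \<le> real N + 1" by (simp_all add: N_def)
      have s: "h / \<epsilon> \<le> s" "s \<le> h / \<epsilon> + 1" using N by (simp_all add: s_def add_divide_distrib)
      have "0 < h / \<epsilon>" using h \<epsilon> by simp
      have "z \<epsilon> x (True, 0) (real N + s) \<le> (c / \<epsilon> + p + B) + speed p * s + C\<^sub>0"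
      proof (rule up[OF z[OF \<epsilon>] z_spread[OF \<epsilon>]])
        fix j assume j: "\<bar>real_of_int j\<bar> \<le> 2 * rate * s"
        \<comment> \<open>For the upper bound the index is rounded up: the particles are ordered, so
          the one at the next multiple of \<open>n\<close> dominates particle
          \<open>j\<close>.\<close>
        define q where "q = j div int n + 1"
        have q: "of_int j * \<epsilon> / real n \<le> of_int q * \<epsilon>" "of_int q * \<epsilon> \<le> of_int j * \<epsilon> / real n + \<epsilon>"
          using cell[OF \<epsilon>, of j] by (simp_all add: q_def distrib_right)
        have "j \<le> q * int n"
          using block(2)[of j] by (simp add: q_def)
        then have "z \<epsilon> x (True, j) (real N) \<le> z \<epsilon> x (True, q * int n) (real N)"
          using increasingD[OF z_inc[OF \<epsilon>]] by simp
        also have "\<dots> \<le> v \<epsilon> t (x + of_int q * \<epsilon>) / \<epsilon> + B" using periods[OF \<epsilon> t, of x q] by (simp add: N_def)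
        also have "\<dots> \<le> (c + p * (of_int j * \<epsilon> / real n + \<epsilon>)) / \<epsilon> + B"
        proof -
          have "\<bar>of_int q * \<epsilon> - of_int j * \<epsilon> / real n\<bar> \<le> \<epsilon>" using q by linarith
          from reach[OF \<epsilon> h j s(2) this] le[THEN spec, of "x + of_int q * \<epsilon>"] have "v \<epsilon> t (x + of_int q * \<epsilon>) \<le> c + p * (of_int q * \<epsilon>)" by simp
          also have "\<dots> \<le> c + p * (of_int j * \<epsilon> / real n + \<epsilon>)" using q(2) \<open>p \<ge> 0\<close> by (intro add_left_mono mult_left_mono)
          finally show ?thesis using \<epsilon> by (intro add_right_mono divide_right_mono) auto
        qed
        also have "\<dots> = c / \<epsilon> + p + B + p * real_of_int j / real n" using \<epsilon> by (simp add: add_divide_distrib distrib_left)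
        finally show "z \<epsilon> x (True, j) (real N) \<le> c / \<epsilon> + p + B + p * real_of_int j / real n" .
      qed (use s \<open>0 < h / \<epsilon>\<close> in auto)
      moreover have "speed p * s \<le> speed p * (h / \<epsilon>) + \<bar>speed p\<bar>"
      proof -
        have "speed p * (s - h / \<epsilon>) \<le> \<bar>speed p\<bar> * (s - h / \<epsilon>)" using s by (intro mult_right_mono) auto
        also have "\<dots> \<le> \<bar>speed p\<bar> * 1" using s by (intro mult_left_mono) auto
        finally show ?thesis by (simp add: right_diff_distrib)
      qed
      moreover have "real N + s = (t + h) / \<epsilon>" by (simp add: s_def)
      ultimately have "z \<epsilon> x (True, 0) ((t + h) / \<epsilon>) \<le> c / \<epsilon> + speed p * (h / \<epsilon>) + (p + B + \<bar>speed p\<bar> + C\<^sub>0)" by simp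
      then have "v \<epsilon> (t + h) x \<le> \<epsilon> * (c / \<epsilon> + speed p * (h / \<epsilon>) + (p + B + \<bar>speed p\<bar> + C\<^sub>0))"
        unfolding v_def using \<epsilon> by (intro mult_left_mono) auto
      also have "\<dots> = c + h * Fbar p + (p + B + \<bar>speed p\<bar> + C\<^sub>0) * \<epsilon>" using \<epsilon> by (simp add: Fp distrib_left mult.commute)
      finally show ?thesis .
    qed
    then show "\<exists>C'. \<forall>\<epsilon>>0. \<forall>t\<ge>0. \<forall>h>0. \<forall>x c.
      (\<forall>y. \<bar>y - x\<bar> \<le> R * (h + \<epsilon>) \<longrightarrow> v \<epsilon> t y \<le> c + p * (y - x)) \<longrightarrow> v \<epsilon> (t + h) x \<le> c + h * Fbar p + C' * \<epsilon>"
      by (intro exI[of _ "p + B + \<bar>speed p\<bar> + C\<^sub>0"]) blast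
    obtain C\<^sub>1 where down: "\<And>z N s c. solution z \<Longrightarrow> (\<And>t. t \<ge> 0 \<Longrightarrow> spread K (\<lambda>i. z i t)) \<Longrightarrow> s \<ge> 0 \<Longrightarrow>
      (\<And>j. \<bar>real_of_int j\<bar> \<le> 2 * rate * s \<Longrightarrow> c + p * real_of_int j / real n \<le> z (True, j) (real N)) \<Longrightarrow>
      c + speed p * s - C\<^sub>1 \<le> z (True, 0) (real N + s)"
      by (rule local_speed_bounds[OF \<open>p \<ge> 0\<close> \<open>K \<ge> 0\<close>]) blast
    have "c + h * Fbar p - (p + B + \<bar>speed p\<bar> + C\<^sub>1) * \<epsilon> \<le> v \<epsilon> (t + h) x"
      if \<epsilon>: "\<epsilon> > 0" and t: "t \<ge> 0" and h: "h > 0"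
        and le: "\<forall>y. \<bar>y - x\<bar> \<le> R * (h + \<epsilon>) \<longrightarrow> c + p * (y - x) \<le> v \<epsilon> t y" for \<epsilon> t h x c
    proof -
      define N where "N = nat \<lfloor>t / \<epsilon>\<rfloor>"
      define s where "s = (t + h) / \<epsilon> - real N"
      have "t / \<epsilon> \<ge> 0" using t \<epsilon> by simp
      then have N: "real N \<le> t / \<epsilon>" "t / \<epsilon> \<le> real N + 1" by (simp_all add: N_def)
      have s: "h / \<epsilon> \<le> s" "s \<le> h / \<epsilon> + 1" using N by (simp_all add: s_def add_divide_distrib)
      have "0 < h / \<epsilon>" using h \<epsilon> by simp
      have "(c / \<epsilon> - p - B) + speed p * s - C\<^sub>1 \<le> z \<epsilon> x (True, 0) (real N + s)"
      proof (rule down[OF z[OF \<epsilon>] z_spread[OF \<epsilon>]])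
        fix j assume j: "\<bar>real_of_int j\<bar> \<le> 2 * rate * s"
        \<comment> \<open>For the lower bound the index is rounded down instead.\<close>
        define q where "q = j div int n"
        have q: "of_int q * \<epsilon> \<le> of_int j * \<epsilon> / real n" "of_int j * \<epsilon> / real n - \<epsilon> \<le> of_int q * \<epsilon>"
          using cell[OF \<epsilon>, of j] by (simp_all add: q_def distrib_right)
        have "q * int n \<le> j"
          using block(1)[of j] by (simp add: q_def)
        have "c / \<epsilon> - p - B + p * real_of_int j / real n = (c + p * (of_int j * \<epsilon> / real n - \<epsilon>)) / \<epsilon> - B"
          using \<epsilon> by (simp add: add_divide_distrib diff_divide_distrib right_diff_distrib)
        also have "\<dots> \<le> v \<epsilon> t (x + of_int q * \<epsilon>) / \<epsilon> - B"
        proof -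
          have "\<bar>of_int q * \<epsilon> - of_int j * \<epsilon> / real n\<bar> \<le> \<epsilon>" using q by linarith
          from reach[OF \<epsilon> h j s(2) this] le[THEN spec, of "x + of_int q * \<epsilon>"] have "c + p * (of_int q * \<epsilon>) \<le> v \<epsilon> t (x + of_int q * \<epsilon>)" by simp
          moreover have "c + p * (of_int j * \<epsilon> / real n - \<epsilon>) \<le> c + p * (of_int q * \<epsilon>)"
            using q(2) \<open>p \<ge> 0\<close> by (intro add_left_mono mult_left_mono)
          ultimately have "c + p * (of_int j * \<epsilon> / real n - \<epsilon>) \<le> v \<epsilon> t (x + of_int q * \<epsilon>)" by linarith
          then show ?thesis using \<epsilon> by (intro diff_right_mono divide_right_mono) auto
        qed
        also have "\<dots> \<le> z \<epsilon> x (True, q * int n) (real N)" using periods[OF \<epsilon> t, of x q] by (simp add: N_def)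
        also have "\<dots> \<le> z \<epsilon> x (True, j) (real N)"
          using increasingD[OF z_inc[OF \<epsilon>]] \<open>q * int n \<le> j\<close> by simp
        finally show "c / \<epsilon> - p - B + p * real_of_int j / real n \<le> z \<epsilon> x (True, j) (real N)" .
      qed (use s \<open>0 < h / \<epsilon>\<close> in auto)
      moreover have "speed p * (h / \<epsilon>) - \<bar>speed p\<bar> \<le> speed p * s"
      proof -
        have "- speed p * (s - h / \<epsilon>) \<le> \<bar>speed p\<bar> * (s - h / \<epsilon>)" using s by (intro mult_right_mono) auto
        also have "\<dots> \<le> \<bar>speed p\<bar> * 1" using s by (intro mult_left_mono) auto
        finally show ?thesis by (simp add: right_diff_distrib)
      qed
      moreover have "real N + s = (t + h) / \<epsilon>" by (simp add: s_def)
      ultimately have "c / \<epsilon> + speed p * (h / \<epsilon>) - (p + B + \<bar>speed p\<bar> + C\<^sub>1) \<le> z \<epsilon> x (True, 0) ((t + h) / \<epsilon>)" by simp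
      then have "\<epsilon> * (c / \<epsilon> + speed p * (h / \<epsilon>) - (p + B + \<bar>speed p\<bar> + C\<^sub>1)) \<le> v \<epsilon> (t + h) x"
        unfolding v_def using \<epsilon> by (intro mult_left_mono) auto
      moreover have "\<epsilon> * (c / \<epsilon> + speed p * (h / \<epsilon>) - (p + B + \<bar>speed p\<bar> + C\<^sub>1)) = c + h * Fbar p - (p + B + \<bar>speed p\<bar> + C\<^sub>1) * \<epsilon>"
        using \<epsilon> by (simp add: Fp distrib_left right_diff_distrib mult.commute)
      ultimately show ?thesis by simp
    qed
    then show "\<exists>C'. \<forall>\<epsilon>>0. \<forall>t\<ge>0. \<forall>h>0. \<forall>x c.
      (\<forall>y. \<bar>y - x\<bar> \<le> R * (h + \<epsilon>) \<longrightarrow> c + p * (y - x) \<le> v \<epsilon> t y) \<longrightarrow> c + h * Fbar p - C' * \<epsilon> \<le> v \<epsilon> (t + h) x"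
      by (intro exI[of _ "p + B + \<bar>speed p\<bar> + C\<^sub>1"]) blast
  qed
  obtain w where w: "is_unique_HJ_solution Fbar u\<^sub>0 w"
    and lim: "\<And>S e. compact S \<Longrightarrow> S \<subseteq> time_space \<Longrightarrow> e > 0 \<Longrightarrow>
      \<forall>\<^sub>F \<epsilon> in at_right 0. \<forall>q\<in>S. \<bar>v \<epsilon> (fst q) (snd q) - w q\<bar> \<le> e"
    using converges_to_HJ_solution by blast
  \<comment> \<open>At the microscopic scale every particle of index \<open>j\<close>, of either
    kind, is within \<open>K * (1 + \<bar>j\<bar>)\<close> of the particle \<open>(True, 0)\<close>
    behind \<open>v\<close>; multiplied by \<open>\<epsilon>\<close> this tends to 0, so all
    families share one limit.\<close>
  have unif: "uniform_limit S (\<lambda>\<epsilon> q. \<epsilon> * z \<epsilon> (snd q) (c, j) (fst q / \<epsilon>)) w (at_right 0)"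
    if S: "compact S" "S \<subseteq> pos_time_space" for S c j
    unfolding uniform_limit_iff
  proof (intro allI impI)
    fix e :: real assume "e > 0"
    then have "e / 2 > 0" by simp
    have "S \<subseteq> time_space" using S(2) by auto
    from lim[OF S(1) this \<open>e / 2 > 0\<close>] small[OF \<open>e / 2 > 0\<close>, of "K * (1 + \<bar>real_of_int j\<bar>)"]
    show "\<forall>\<^sub>F \<epsilon> in at_right 0. \<forall>q\<in>S. dist (\<epsilon> * z \<epsilon> (snd q) (c, j) (fst q / \<epsilon>)) (w q) < e"
    proof eventually_elim
      case (elim \<epsilon>)
      show ?case
      proof
        fix q assume "q \<in> S"
        then have "fst q / \<epsilon> \<ge> 0" using S(2) elim by auto
        from spreadD[OF z_spread[OF _ this], of \<epsilon> "snd q" c j True 0] elim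
        have "\<bar>z \<epsilon> (snd q) (c, j) (fst q / \<epsilon>) - z \<epsilon> (snd q) (True, 0) (fst q / \<epsilon>)\<bar> \<le> K * (1 + \<bar>real_of_int j\<bar>)" by simp
        then have "\<epsilon> * \<bar>z \<epsilon> (snd q) (c, j) (fst q / \<epsilon>) - z \<epsilon> (snd q) (True, 0) (fst q / \<epsilon>)\<bar> \<le> \<epsilon> * (K * (1 + \<bar>real_of_int j\<bar>))"
          using elim by (intro mult_left_mono) auto
        also have "\<dots> < e / 2" using elim by (simp add: mult.commute)
        finally have "\<bar>\<epsilon> * z \<epsilon> (snd q) (c, j) (fst q / \<epsilon>) - v \<epsilon> (fst q) (snd q)\<bar> < e / 2"
          using elim by (simp add: v_def abs_mult flip: right_diff_distrib)
        moreover have "\<bar>v \<epsilon> (fst q) (snd q) - w q\<bar> \<le> e / 2" using elim \<open>q \<in> S\<close> by blast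
        ultimately show "dist (\<epsilon> * z \<epsilon> (snd q) (c, j) (fst q / \<epsilon>)) (w q) < e"
          unfolding dist_real_def by linarith
      qed
    qed
  qed
  have "uniform_limit S (\<lambda>\<epsilon>. u \<epsilon> j) w (at_right 0) \<and> uniform_limit S (\<lambda>\<epsilon>. \<xi> \<epsilon> j) w (at_right 0)"
    if S: "compact S" "S \<subseteq> pos_time_space" for S j
  proof
    have ev: "\<forall>\<^sub>F \<epsilon> in at_right (0::real). \<epsilon> > 0" by (rule eventually_at_right_less)
    have "\<forall>\<^sub>F \<epsilon> in at_right 0. \<forall>q\<in>S. \<epsilon> * z \<epsilon> (snd q) (True, j) (fst q / \<epsilon>) = u \<epsilon> j q"
      using ev by eventually_elim (use S(2) sys(1) in fastforce)
    then show "uniform_limit S (\<lambda>\<epsilon>. u \<epsilon> j) w (at_right 0)"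
      by (rule uniform_limit_cong[THEN iffD1, OF _ _ unif[OF S, of True j]]) auto
    have "\<forall>\<^sub>F \<epsilon> in at_right 0. \<forall>q\<in>S. \<epsilon> * z \<epsilon> (snd q) (False, j) (fst q / \<epsilon>) = \<xi> \<epsilon> j q"
      using ev by eventually_elim (use S(2) sys(2) in fastforce)
    then show "uniform_limit S (\<lambda>\<epsilon>. \<xi> \<epsilon> j) w (at_right 0)"
      by (rule uniform_limit_cong[THEN iffD1, OF _ _ unif[OF S, of False j]]) auto
  qed
  moreover have "continuous_on UNIV Fbar"
  proof (rule lipschitz_on_continuous_on)
    show "L-lipschitz_on UNIV Fbar"
      using H_lipschitz \<open>L \<ge> 0\<close> by (intro lipschitz_onI) (auto simp: dist_real_def)
  qed
  ultimately show ?thesis using w by blast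
qed

end
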